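(* Let $(M^{3},\varphi,\xi,\eta,g)$ be a three-dimensional para-Kenmotsu manifold. If $g$ is a Yamabe soliton, then $g$ is also a Ricci soliton.
   Context: All manifolds are smooth and connected. An almost paracontact structure on a $(2n+1)$-dimensional manifold $M$ consists of a $(1,1)$-tensor field $\varphi$, a vector field $\xi$ and a $1$-form $\eta$ with $\eta(\xi)=1$, $\varphi^2=I-\eta\otimes\xi$, such that the $\pm1$-eigendistributions of $\varphi$ restricted to $\ker\eta$ both have dimension $n$ (so $\varphi\xi=0$, $\eta\circ\varphi=0$). It is an almost paracontact metric manifold if equipped with a semi-Riemannian metric $g$ with $g(\varphi X,\varphi Y)=-g(X,Y)+\eta(X)\eta(Y)$ for all $X,Y$. Its fundamental $2$-form is $\Phi(X,Y)=g(X,\varphi Y)$. It is normal if $[\varphi,\varphi]-2d\eta\otimes\xi=0$, where $[\varphi,\varphi](X,Y)=\varphi^2[X,Y]+[\varphi X,\varphi Y]-\varphi[\varphi X,Y]-\varphi[X,\varphi Y]$. A para-Kenmotsu manifold is a normal almost paracontact metric manifold with $d\eta=0$ and $d\Phi=2\eta\wedge\Phi$; such a manifold satisfies $(\nabla_X\varphi)Y=g(\varphi X,Y)\xi-\eta(Y)\varphi X$ and $\nabla_X\xi=X-\eta(X)\xi$, where $\nabla$ is the Levi-Civita connection. Curvature convention: $R(X,Y)Z=\nabla_X\nabla_YZ-\nabla_Y\nabla_XZ-\nabla_{[X,Y]}Z$, the Ricci tensor is $S(X,Y)=\operatorname{trace}\{Z\mapsto R(Z,X)Y\}$, and the scalar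 curvature $r$ is the $g$-trace of $S$. A semi-Riemannian metric $g$ is a Yamabe soliton if there are a vector field $V$ and a real number $\lambda$ with $\mathcal{L}_Vg=(\lambda-r)g$. It is a Ricci soliton if there are a vector field $V$ and a constant $\mu\in\mathbb{R}$ with $(\mathcal{L}_Vg)(X,Y)+2S(X,Y)+2\mu g(X,Y)=0$ for all vector fields $X,Y$. $\mathcal{L}$ denotes the Lie derivative. *)

theory Defs
  imports "HOL-Analysis.Analysis"
begin

section \<open>Smooth manifolds\<close>

text \<open>For an open set \<open>S\<close>: all iterated directional derivatives up to order \<open>k\<close> exist
  and are continuous.\<close>

primrec Ck_on ::
  "nat \<Rightarrow> 'a::euclidean_space set \<Rightarrow> ('a \<Rightarrow> 'b::euclidean_space) \<Rightarrow> bool" where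
  "Ck_on 0 S f \<longleftrightarrow> continuous_on S f"
| "Ck_on (Suc k) S f \<longleftrightarrow>
     (\<forall>x\<in>S. f differentiable (at x)) \<and>
     (\<forall>v. Ck_on k S (\<lambda>x. frechet_derivative f (at x) v))"

definition smooth_on ::
  "'a::euclidean_space set \<Rightarrow> ('a \<Rightarrow> 'b::euclidean_space) \<Rightarrow> bool" where
  "smooth_on S f \<longleftrightarrow> (\<forall>k. Ck_on k S f)"

text \<open>A chart is a pair of its domain and its coordinate map; values of the map outside the
  domain carry no meaning. The underlying point set of a manifold is a whole type.\<close>

type_synonym ('m, 'n) chart = "'m set \<times> ('m \<Rightarrow> real^'n)"

definition chart_inv :: "('m, 'n::finite) chart \<Rightarrow> real^'n \<Rightarrow> 'm" where
  "chart_inv c = inv_into (fst c) (snd c)"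

definition smooth_atlas ::
  "('m::{t2_space,second_countable_topology}, 'n::finite) chart set \<Rightarrow> bool" where
  "smooth_atlas A \<longleftrightarrow>
     (\<forall>c\<in>A. open (fst c) \<and> open (snd c ` fst c) \<and>
        homeomorphism (fst c) (snd c ` fst c) (snd c) (chart_inv c)) \<and>
     (\<Union>c\<in>A. fst c) = UNIV \<and>
     (\<forall>c\<in>A. \<forall>d\<in>A. smooth_on (snd c ` (fst c \<inter> fst d)) (snd d \<circ> chart_inv c))"

definition connected_smooth_manifold ::
  "('m::{t2_space,second_countable_topology}, 'n::finite) chart set \<Rightarrow> bool" where
  "connected_smooth_manifold A \<longleftrightarrow> smooth_atlas A \<and> connected (UNIV :: 'm set)"

text \<open>The tangent space at \<open>p\<close> is \<open>real^'n\<close>, a vector standing for its components in a preferred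
  chart around \<open>p\<close> selected from the atlas. Nothing relates the preferred charts of neighbouring
  points, so smoothness of a vector field is tested on its components in a fixed chart; these
  are obtained from the preferred ones by the derivative of the change of coordinates.\<close>

definition chart_at :: "('m, 'n::finite) chart set \<Rightarrow> 'm \<Rightarrow> ('m, 'n) chart" where
  "chart_at A p = (SOME c. c \<in> A \<and> p \<in> fst c)"

definition components ::
  "('m, 'n::finite) chart set \<Rightarrow> ('m, 'n) chart \<Rightarrow> 'm \<Rightarrow> real^'n \<Rightarrow> real^'n" where
  "components A c p v =
     frechet_derivative (snd c \<circ> chart_inv (chart_at A p)) (at (snd (chart_at A p) p)) v"

definition smooth_fun :: "('m, 'n::finite) chart set \<Rightarrow> ('m \<Rightarrow> real) \<Rightarrow> bool" where
  "smooth_fun A f \<longleftrightarrow> (\<forall>c\<in>A. smooth_on (snd c ` fst c) (f \<circ> chart_inv c))"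

type_synonym ('m, 'n) vfield = "'m \<Rightarrow> real^'n"

definition vfield_in_chart ::
  "('m, 'n::finite) chart set \<Rightarrow> ('m, 'n) chart \<Rightarrow> ('m, 'n) vfield \<Rightarrow> real^'n \<Rightarrow> real^'n" where
  "vfield_in_chart A c X z = components A c (chart_inv c z) (X (chart_inv c z))"

definition smooth_vfield :: "('m, 'n::finite) chart set \<Rightarrow> ('m, 'n) vfield \<Rightarrow> bool" where
  "smooth_vfield A X \<longleftrightarrow> (\<forall>c\<in>A. smooth_on (snd c ` fst c) (vfield_in_chart A c X))"

text \<open>The function \<open>X f\<close>.\<close>

definition vderiv ::
  "('m, 'n::finite) chart set \<Rightarrow> ('m, 'n) vfield \<Rightarrow> ('m \<Rightarrow> real) \<Rightarrow> 'm \<Rightarrow> real" where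
  "vderiv A X f p =
     frechet_derivative (f \<circ> chart_inv (chart_at A p)) (at (snd (chart_at A p) p)) (X p)"

text \<open>In coordinates, \<open>[X,Y] = DY(X) - DX(Y)\<close>, so that \<open>[X,Y] f = X (Y f) - Y (X f)\<close>.\<close>

definition lie_bracket ::
  "('m, 'n::finite) chart set \<Rightarrow> ('m, 'n) vfield \<Rightarrow> ('m, 'n) vfield \<Rightarrow> ('m, 'n) vfield" where
  "lie_bracket A X Y p =
     (let c = chart_at A p; z = snd c p in
        frechet_derivative (vfield_in_chart A c Y) (at z) (X p)
      - frechet_derivative (vfield_in_chart A c X) (at z) (Y p))"

section \<open>Tensor fields\<close>

definition smooth_one_form ::
  "('m, 'n::finite) chart set \<Rightarrow> ('m \<Rightarrow> real^'n \<Rightarrow> real) \<Rightarrow> bool" where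
  "smooth_one_form A eta \<longleftrightarrow>
     (\<forall>p. linear (eta p)) \<and>
     (\<forall>X. smooth_vfield A X \<longrightarrow> smooth_fun A (\<lambda>p. eta p (X p)))"

definition smooth_endo_field ::
  "('m, 'n::finite) chart set \<Rightarrow> ('m \<Rightarrow> real^'n \<Rightarrow> real^'n) \<Rightarrow> bool" where
  "smooth_endo_field A phi \<longleftrightarrow>
     (\<forall>p. linear (phi p)) \<and>
     (\<forall>X. smooth_vfield A X \<longrightarrow> smooth_vfield A (\<lambda>p. phi p (X p)))"

definition semi_riemannian_metric ::
  "('m, 'n::finite) chart set \<Rightarrow> ('m \<Rightarrow> real^'n \<Rightarrow> real^'n \<Rightarrow> real) \<Rightarrow> bool" where
  "semi_riemannian_metric A g \<longleftrightarrow>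
     (\<forall>p. bilinear (g p)) \<and>
     (\<forall>p v w. g p v w = g p w v) \<and>
     (\<forall>p v. (\<forall>w. g p v w = 0) \<longrightarrow> v = 0) \<and>
     (\<forall>X Y. smooth_vfield A X \<longrightarrow> smooth_vfield A Y \<longrightarrow> smooth_fun A (\<lambda>p. g p (X p) (Y p)))"

text \<open>Exterior derivative and wedge product are normalised so that
  \<open>2 d\<eta>(X,Y) = X \<eta>(Y) - Y \<eta>(X) - \<eta>([X,Y])\<close> and
  \<open>3 (\<eta> \<and> \<Phi>)(X,Y,Z) = \<eta>(X) \<Phi>(Y,Z) + \<eta>(Y) \<Phi>(Z,X) + \<eta>(Z) \<Phi>(X,Y)\<close>, the convention in which
  normality reads \<open>[\<phi>,\<phi>] - 2 d\<eta> \<otimes> \<xi> = 0\<close>.\<close>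

definition ext_deriv_1 ::
  "('m, 'n::finite) chart set \<Rightarrow> ('m \<Rightarrow> real^'n \<Rightarrow> real)
    \<Rightarrow> ('m, 'n) vfield \<Rightarrow> ('m, 'n) vfield \<Rightarrow> 'm \<Rightarrow> real" where
  "ext_deriv_1 A eta X Y p =
     (1/2) * (vderiv A X (\<lambda>q. eta q (Y q)) p - vderiv A Y (\<lambda>q. eta q (X q)) p
              - eta p (lie_bracket A X Y p))"

definition ext_deriv_2 ::
  "('m, 'n::finite) chart set \<Rightarrow> ('m \<Rightarrow> real^'n \<Rightarrow> real^'n \<Rightarrow> real)
    \<Rightarrow> ('m, 'n) vfield \<Rightarrow> ('m, 'n) vfield \<Rightarrow> ('m, 'n) vfield \<Rightarrow> 'm \<Rightarrow> real" where
  "ext_deriv_2 A Phi X Y Z p =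
     (1/3) * (vderiv A X (\<lambda>q. Phi q (Y q) (Z q)) p
            + vderiv A Y (\<lambda>q. Phi q (Z q) (X q)) p
            + vderiv A Z (\<lambda>q. Phi q (X q) (Y q)) p
            - Phi p (lie_bracket A X Y p) (Z p)
            - Phi p (lie_bracket A Y Z p) (X p)
            - Phi p (lie_bracket A Z X p) (Y p))"

definition wedge_1_2 ::
  "('m \<Rightarrow> real^'n::finite \<Rightarrow> real) \<Rightarrow> ('m \<Rightarrow> real^'n \<Rightarrow> real^'n \<Rightarrow> real)
    \<Rightarrow> 'm \<Rightarrow> real^'n \<Rightarrow> real^'n \<Rightarrow> real^'n \<Rightarrow> real" where
  "wedge_1_2 eta Phi p u v w =
     (1/3) * (eta p u * Phi p v w + eta p v * Phi p w u + eta p w * Phi p u v)"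

definition lie_deriv_metric ::
  "('m, 'n::finite) chart set \<Rightarrow> ('m, 'n) vfield \<Rightarrow> ('m \<Rightarrow> real^'n \<Rightarrow> real^'n \<Rightarrow> real)
    \<Rightarrow> ('m, 'n) vfield \<Rightarrow> ('m, 'n) vfield \<Rightarrow> 'm \<Rightarrow> real" where
  "lie_deriv_metric A V g X Y p =
     vderiv A V (\<lambda>q. g q (X q) (Y q)) p
     - g p (lie_bracket A V X p) (Y p) - g p (X p) (lie_bracket A V Y p)"

section \<open>Levi-Civita connection and curvature\<close>

definition is_levi_civita ::
  "('m, 'n::finite) chart set \<Rightarrow> ('m \<Rightarrow> real^'n \<Rightarrow> real^'n \<Rightarrow> real)
    \<Rightarrow> (('m, 'n) vfield \<Rightarrow> ('m, 'n) vfield \<Rightarrow> ('m, 'n) vfield) \<Rightarrow> bool" where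
  "is_levi_civita A g D \<longleftrightarrow>
     (\<forall>X Y Z f. smooth_vfield A X \<longrightarrow> smooth_vfield A Y \<longrightarrow> smooth_vfield A Z \<longrightarrow> smooth_fun A f \<longrightarrow>
        smooth_vfield A (D X Y) \<and>
        D (\<lambda>p. X p + Y p) Z = (\<lambda>p. D X Z p + D Y Z p) \<and>
        D (\<lambda>p. f p *\<^sub>R X p) Y = (\<lambda>p. f p *\<^sub>R D X Y p) \<and>
        D X (\<lambda>p. Y p + Z p) = (\<lambda>p. D X Y p + D X Z p) \<and>
        D X (\<lambda>p. f p *\<^sub>R Y p) = (\<lambda>p. vderiv A X f p *\<^sub>R Y p + f p *\<^sub>R D X Y p) \<and>
        (\<lambda>p. D X Y p - D Y X p) = lie_bracket A X Y \<and>
        vderiv A X (\<lambda>p. g p (Y p) (Z p)) = (\<lambda>p. g p (D X Y p) (Z p) + g p (Y p) (D X Z p)))"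

text \<open>On smooth vector fields the choice is unique, by the fundamental theorem of
  semi-Riemannian geometry.\<close>

definition levi_civita ::
  "('m, 'n::finite) chart set \<Rightarrow> ('m \<Rightarrow> real^'n \<Rightarrow> real^'n \<Rightarrow> real)
    \<Rightarrow> ('m, 'n) vfield \<Rightarrow> ('m, 'n) vfield \<Rightarrow> ('m, 'n) vfield" where
  "levi_civita A g = (SOME D. is_levi_civita A g D)"

definition curvature ::
  "('m, 'n::finite) chart set \<Rightarrow> ('m \<Rightarrow> real^'n \<Rightarrow> real^'n \<Rightarrow> real)
    \<Rightarrow> ('m, 'n) vfield \<Rightarrow> ('m, 'n) vfield \<Rightarrow> ('m, 'n) vfield \<Rightarrow> ('m, 'n) vfield" where
  "curvature A g X Y Z p =
     (let D = levi_civita A g in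
        D X (D Y Z) p - D Y (D X Z) p - D (lie_bracket A X Y) Z p)"

text \<open>The curvature is tensorial, so its value at \<open>p\<close> on tangent vectors is computed with
  arbitrary smooth vector fields through them.\<close>

definition extend_vector ::
  "('m, 'n::finite) chart set \<Rightarrow> 'm \<Rightarrow> real^'n \<Rightarrow> ('m, 'n) vfield" where
  "extend_vector A p v = (SOME X. smooth_vfield A X \<and> X p = v)"

definition curvature_at ::
  "('m, 'n::finite) chart set \<Rightarrow> ('m \<Rightarrow> real^'n \<Rightarrow> real^'n \<Rightarrow> real)
    \<Rightarrow> 'm \<Rightarrow> real^'n \<Rightarrow> real^'n \<Rightarrow> real^'n \<Rightarrow> real^'n" where
  "curvature_at A g p x y z =
     curvature A g (extend_vector A p x) (extend_vector A p y) (extend_vector A p z) p"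

definition ricci ::
  "('m, 'n::finite) chart set \<Rightarrow> ('m \<Rightarrow> real^'n \<Rightarrow> real^'n \<Rightarrow> real)
    \<Rightarrow> 'm \<Rightarrow> real^'n \<Rightarrow> real^'n \<Rightarrow> real" where
  "ricci A g p x y = trace (matrix (\<lambda>z. curvature_at A g p z x y))"

text \<open>The \<open>g\<close>-trace of a bilinear form \<open>b\<close> is the trace of the endomorphism \<open>Q\<close> with
  \<open>g(Q x, y) = b(x, y)\<close>.\<close>

definition metric_trace ::
  "(real^'n::finite \<Rightarrow> real^'n \<Rightarrow> real) \<Rightarrow> (real^'n \<Rightarrow> real^'n \<Rightarrow> real) \<Rightarrow> real" where
  "metric_trace h b = trace (matrix (\<lambda>x. THE q. \<forall>y. h q y = b x y))"

definition scalar_curvature ::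
  "('m, 'n::finite) chart set \<Rightarrow> ('m \<Rightarrow> real^'n \<Rightarrow> real^'n \<Rightarrow> real) \<Rightarrow> 'm \<Rightarrow> real" where
  "scalar_curvature A g p = metric_trace (g p) (ricci A g p)"

section \<open>Solitons\<close>

definition yamabe_soliton ::
  "('m, 'n::finite) chart set \<Rightarrow> ('m \<Rightarrow> real^'n \<Rightarrow> real^'n \<Rightarrow> real) \<Rightarrow> bool" where
  "yamabe_soliton A g \<longleftrightarrow>
     (\<exists>V lam. smooth_vfield A V \<and>
        (\<forall>X Y p. smooth_vfield A X \<longrightarrow> smooth_vfield A Y \<longrightarrow>
           lie_deriv_metric A V g X Y p = (lam - scalar_curvature A g p) * g p (X p) (Y p)))"

definition ricci_soliton ::
  "('m, 'n::finite) chart set \<Rightarrow> ('m \<Rightarrow> real^'n \<Rightarrow> real^'n \<Rightarrow> real) \<Rightarrow> bool" where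
  "ricci_soliton A g \<longleftrightarrow>
     (\<exists>V mu. smooth_vfield A V \<and>
        (\<forall>X Y p. smooth_vfield A X \<longrightarrow> smooth_vfield A Y \<longrightarrow>
           lie_deriv_metric A V g X Y p + 2 * ricci A g p (X p) (Y p)
             + 2 * mu * g p (X p) (Y p) = 0))"

section \<open>Para-Kenmotsu manifolds\<close>

definition almost_paracontact ::
  "('m::{t2_space,second_countable_topology}, 'n::finite) chart set
    \<Rightarrow> ('m \<Rightarrow> real^'n \<Rightarrow> real^'n) \<Rightarrow> ('m, 'n) vfield \<Rightarrow> ('m \<Rightarrow> real^'n \<Rightarrow> real) \<Rightarrow> bool" where
  "almost_paracontact A phi xi eta \<longleftrightarrow>
     connected_smooth_manifold A \<and>
     smooth_endo_field A phi \<and> smooth_vfield A xi \<and> smooth_one_form A eta \<and>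
     (\<forall>p. eta p (xi p) = 1) \<and>
     (\<forall>p v. phi p (phi p v) = v - eta p v *\<^sub>R xi p) \<and>
     (\<exists>n. CARD('n) = 2 * n + 1 \<and>
        (\<forall>p. dim {v. eta p v = 0 \<and> phi p v = v} = n \<and>
             dim {v. eta p v = 0 \<and> phi p v = - v} = n))"

definition almost_paracontact_metric ::
  "('m::{t2_space,second_countable_topology}, 'n::finite) chart set
    \<Rightarrow> ('m \<Rightarrow> real^'n \<Rightarrow> real^'n) \<Rightarrow> ('m, 'n) vfield \<Rightarrow> ('m \<Rightarrow> real^'n \<Rightarrow> real)
    \<Rightarrow> ('m \<Rightarrow> real^'n \<Rightarrow> real^'n \<Rightarrow> real) \<Rightarrow> bool" where
  "almost_paracontact_metric A phi xi eta g \<longleftrightarrow>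
     almost_paracontact A phi xi eta \<and> semi_riemannian_metric A g \<and>
     (\<forall>p v w. g p (phi p v) (phi p w) = - g p v w + eta p v * eta p w)"

definition fundamental_form ::
  "('m \<Rightarrow> real^'n::finite \<Rightarrow> real^'n) \<Rightarrow> ('m \<Rightarrow> real^'n \<Rightarrow> real^'n \<Rightarrow> real)
    \<Rightarrow> 'm \<Rightarrow> real^'n \<Rightarrow> real^'n \<Rightarrow> real" where
  "fundamental_form phi g p v w = g p v (phi p w)"

definition nijenhuis ::
  "('m, 'n::finite) chart set \<Rightarrow> ('m \<Rightarrow> real^'n \<Rightarrow> real^'n)
    \<Rightarrow> ('m, 'n) vfield \<Rightarrow> ('m, 'n) vfield \<Rightarrow> ('m, 'n) vfield" where
  "nijenhuis A phi X Y p =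
     phi p (phi p (lie_bracket A X Y p))
     + lie_bracket A (\<lambda>q. phi q (X q)) (\<lambda>q. phi q (Y q)) p
     - phi p (lie_bracket A (\<lambda>q. phi q (X q)) Y p)
     - phi p (lie_bracket A X (\<lambda>q. phi q (Y q)) p)"

definition normal_structure ::
  "('m, 'n::finite) chart set \<Rightarrow> ('m \<Rightarrow> real^'n \<Rightarrow> real^'n) \<Rightarrow> ('m, 'n) vfield
    \<Rightarrow> ('m \<Rightarrow> real^'n \<Rightarrow> real) \<Rightarrow> bool" where
  "normal_structure A phi xi eta \<longleftrightarrow>
     (\<forall>X Y p. smooth_vfield A X \<longrightarrow> smooth_vfield A Y \<longrightarrow>
        nijenhuis A phi X Y p - (2 * ext_deriv_1 A eta X Y p) *\<^sub>R xi p = 0)"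

definition para_kenmotsu ::
  "('m::{t2_space,second_countable_topology}, 'n::finite) chart set
    \<Rightarrow> ('m \<Rightarrow> real^'n \<Rightarrow> real^'n) \<Rightarrow> ('m, 'n) vfield \<Rightarrow> ('m \<Rightarrow> real^'n \<Rightarrow> real)
    \<Rightarrow> ('m \<Rightarrow> real^'n \<Rightarrow> real^'n \<Rightarrow> real) \<Rightarrow> bool" where
  "para_kenmotsu A phi xi eta g \<longleftrightarrow>
     almost_paracontact_metric A phi xi eta g \<and>
     normal_structure A phi xi eta \<and>
     (\<forall>X Y p. smooth_vfield A X \<longrightarrow> smooth_vfield A Y \<longrightarrow> ext_deriv_1 A eta X Y p = 0) \<and>
     (\<forall>X Y Z p. smooth_vfield A X \<longrightarrow> smooth_vfield A Y \<longrightarrow> smooth_vfield A Z \<longrightarrow>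
        ext_deriv_2 A (fundamental_form phi g) X Y Z p
          = 2 * wedge_1_2 eta (fundamental_form phi g) p (X p) (Y p) (Z p))"

end

theory Submission
  imports Defs
begin

text \<open>
  The conclusion holds with the zero field: we show that a Yamabe soliton forces \<open>S = - 2 g\<close>.

  The identity \<open>D\<^sub>X \<xi> = X - \<eta>(X) \<xi>\<close> fixes the curvature in all directions involving \<open>\<xi>\<close>, so in
  dimension three the curvature is that of constant curvature \<open>- 1\<close> plus \<open>\<kappa>\<close> times a
  horizontal part, with \<open>S = - 2 g + \<kappa> (g - \<eta> \<otimes> \<eta>)\<close>, \<open>r = 2 \<kappa> - 6\<close> and, by the second Bianchi
  identity, \<open>\<xi> \<kappa> = - 2 \<kappa>\<close>.

  Let \<open>L\<^sub>V g = (\<lambda> - r) g\<close>, \<open>c = \<lambda> + 6\<close>, and write \<open>V = a \<xi> + W\<close> with \<open>a = \<eta>(V)\<close>. On horizontal vectors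
  \<open>L\<^sub>W g\<close> is a multiple of \<open>g\<close>, this property is inherited by \<open>[\<xi>,W]\<close> (with the \<open>\<xi>\<close>-derivative of the
  factor), and \<open>- [\<xi>,W]\<close> is the horizontal gradient of \<open>a\<close>. Taking brackets with \<open>\<xi>\<close> repeatedly, the
  horizontal Hessians of \<open>a\<close> and \<open>\<kappa>\<close> become \<open>(c / 2 - 3 \<kappa>) g\<close> and \<open>- c g\<close>, and one further bracket
  gives \<open>c = 0\<close>. The Ricci identity for the two gradients now reads \<open>\<kappa> d\<kappa> = 0\<close> and
  \<open>\<kappa> da = 3 d\<kappa>\<close> on horizontal vectors. Hence \<open>\<kappa>\<^sup>2 da = 0\<close>, and differentiating once more gives
  \<open>\<kappa>\<^sup>3 = 0\<close>.
\<close>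

text \<open>Brackets with \<open>xi\<close> are effective because \<open>L xi\<close> equals twice g
  on horizontal fields and because \<open>eta\<close> is closed, so that brackets of horizontal
  fields with \<open>xi\<close> and with each other stay horizontal. Bracketing then turns a
  conformal factor t into xi t, and the gradient of u into that of xi u - 2 u. Since xi a and xi
  kappa are expressions in kappa and constants, all potentials and factors remain in the span of 1,
  a and kappa; hence the gradient of kappa is itself a combination of brackets. The last bracket
  multiplies this gradient by -4 but kills its constant conformal factor. Multiplication by powers
  of kappa replaces division, so no open set where kappa is nonzero is singled out. Much of the
  length has another cause: connection, extensions of vectors and curvature coefficient are choices
  by \<open>SOME\<close>, and tangent vectors live in preferred charts that jump from point to
  point. Existence and independence of the choices come from bump functions, tensoriality and
  Cramer's rule. The horizontal metric is neutral, so null frames take the place of orthonormal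
  ones.\<close>

section \<open>Calculus of smooth functions\<close>

lemma Ck_on_cong:
  assumes "Ck_on k S f" "open S" "\<And>x. x \<in> S \<Longrightarrow> f x = g x"
  shows "Ck_on k S g"
  using assms
proof (induction k arbitrary: f g)
  case 0
  then show ?case by (auto intro: continuous_on_eq)
next
  case (Suc k)
  have diff: "g differentiable at x" if "x \<in> S" for x
    using Suc.prems that
    by (metis Ck_on.simps(2) differentiable_def has_derivative_transform_within_open)
  have "frechet_derivative f (at x) = frechet_derivative g (at x)" if "x \<in> S" for x
    using Suc.prems that by (metis Ck_on.simps(2) frechet_derivative_transform_within_open)
  then show ?case
    using Suc.prems diff Suc.IH by (metis (no_types, lifting) Ck_on.simps(2))
qed

lemma Ck_on_subset: "Ck_on k S f \<Longrightarrow> T \<subseteq> S \<Longrightarrow> Ck_on k T f"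
  by (induction k arbitrary: f) (auto intro: continuous_on_subset)

text \<open>Allows a different formula near each point: on a chart overlap, off a support, or where
  a denominator is nonzero.\<close>

lemma Ck_on_local:
  assumes "\<And>x. x \<in> S \<Longrightarrow> \<exists>T. open T \<and> x \<in> T \<and> Ck_on k T f"
  shows "Ck_on k S f"
  using assms
proof (induction k arbitrary: f)
  case 0
  then have "isCont f x" if "x \<in> S" for x
    using that by (metis Ck_on.simps(1) continuous_on_eq_continuous_at)
  then show ?case by (simp add: continuous_at_imp_continuous_on)
next
  case (Suc k)
  have "f differentiable at x" if "x \<in> S" for x
    using Suc.prems[OF that] by auto
  moreover have "Ck_on k S (\<lambda>x. frechet_derivative f (at x) v)" for v
    by (rule Suc.IH) (use Suc.prems in \<open>fastforce dest: spec\<close>)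
  ultimately show ?case by simp
qed

lemma Ck_on_continuous: "Ck_on k S f \<Longrightarrow> continuous_on S f"
  by (cases k) (auto intro!: continuous_at_imp_continuous_on differentiable_imp_continuous_within)

lemma Ck_on_SucD: "Ck_on (Suc k) S f \<Longrightarrow> Ck_on k S f"
proof (induction k arbitrary: f)
  case 0
  then show ?case using Ck_on_continuous[OF 0] by simp
next
  case (Suc k)
  from Suc.prems have "f differentiable at x" if "x \<in> S" for x
    using that by simp
  moreover from Suc.prems have "Ck_on (Suc k) S (\<lambda>x. frechet_derivative f (at x) v)" for v
    by (subst (asm) Ck_on.simps(2)) blast
  ultimately show ?case
    using Suc.IH by (subst Ck_on.simps(2)) blast
qed

text \<open>Any candidate derivative may be supplied, so the closure proofs can use
  \<open>has_derivative\<close> rules instead of computing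
  \<open>frechet_derivative\<close>.\<close>

lemma Ck_on_SucI:
  assumes "open S" "\<And>x. x \<in> S \<Longrightarrow> (f has_derivative f' x) (at x)"
    "\<And>v. Ck_on k S (\<lambda>x. f' x v)"
  shows "Ck_on (Suc k) S f"
proof -
  have "frechet_derivative f (at x) = f' x" if "x \<in> S" for x
    using assms(2)[OF that] by (rule frechet_derivative_at[symmetric])
  then show ?thesis
    using assms by (auto simp: differentiable_def intro!: Ck_on_cong[OF assms(3)])
qed

lemma Ck_on_SucE:
  assumes "Ck_on (Suc k) S f"
  shows "\<And>x. x \<in> S \<Longrightarrow> (f has_derivative frechet_derivative f (at x)) (at x)"
    "\<And>v. Ck_on k S (\<lambda>x. frechet_derivative f (at x) v)"
  using assms by (auto simp: frechet_derivative_works)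

lemma Ck_on_const: "Ck_on k S (\<lambda>x. c)"
  by (induction k arbitrary: c) auto

lemma Ck_on_add:
  assumes "open S" "Ck_on k S f" "Ck_on k S g"
  shows "Ck_on k S (\<lambda>x. f x + g x)"
  using assms(2,3)
proof (induction k arbitrary: f g)
  case (Suc k)
  show ?case
    by (rule Ck_on_SucI[OF assms(1) has_derivative_add[OF Ck_on_SucE(1)[OF Suc.prems(1)]
            Ck_on_SucE(1)[OF Suc.prems(2)]]])
      (auto intro: Suc.IH Ck_on_SucE(2)[OF Suc.prems(1)] Ck_on_SucE(2)[OF Suc.prems(2)])
qed (auto intro: continuous_on_add)

lemma Ck_on_sum:
  assumes "open S" "\<And>i. i \<in> I \<Longrightarrow> Ck_on k S (f i)"
  shows "Ck_on k S (\<lambda>x. \<Sum>i\<in>I. f i x)"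
  using assms(2) by (induction I rule: infinite_finite_induct) (auto intro: Ck_on_add assms(1) Ck_on_const)

text \<open>One product rule serves scalar multiples, products and inner products. Each term of the
  derivative differentiates one factor only; the other has an order to spare, which
  \<open>Ck_on_SucD\<close> drops.\<close>

lemma Ck_on_bilinear:
  assumes "bounded_bilinear B" "open S" "Ck_on k S f" "Ck_on k S g"
  shows "Ck_on k S (\<lambda>x. B (f x) (g x))"
  using assms(3,4)
proof (induction k arbitrary: f g)
  case 0
  then show ?case using assms(1) by (auto intro: bounded_bilinear.continuous_on)
next
  case (Suc k)
  show ?case
    by (rule Ck_on_SucI[OF assms(2) bounded_bilinear.FDERIV[OF assms(1) Ck_on_SucE(1)[OF Suc.prems(1)]
            Ck_on_SucE(1)[OF Suc.prems(2)]]])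
      (auto intro!: Ck_on_add assms(2) Suc.IH Ck_on_SucE(2)[OF Suc.prems(1)] Ck_on_SucE(2)[OF Suc.prems(2)]
        intro: Suc.prems[THEN Ck_on_SucD])
qed

lemmas Ck_on_scaleR = Ck_on_bilinear[OF bounded_bilinear_scaleR]
lemmas Ck_on_mult = Ck_on_bilinear[OF bounded_bilinear_mult]
lemmas Ck_on_inner = Ck_on_bilinear[OF bounded_bilinear_inner]

lemma Ck_on_ident: "Ck_on k S (\<lambda>x. x)"
  by (cases k) (auto simp: Ck_on_const)

text \<open>\<open>Ck_on\<close> controls derivatives in fixed directions. Expanding a direction
  that varies with the point in \<open>Basis\<close> reduces it to these.\<close>

lemma linear_Basis_sum:
  fixes h :: "'a::euclidean_space \<Rightarrow> 'b::real_vector"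
  assumes "linear h"
  shows "h v = (\<Sum>b\<in>Basis. (v \<bullet> b) *\<^sub>R h b)"
proof -
  have "h v = h (\<Sum>b\<in>Basis. (v \<bullet> b) *\<^sub>R b)" by (simp add: euclidean_representation)
  also have "\<dots> = (\<Sum>b\<in>Basis. (v \<bullet> b) *\<^sub>R h b)"
    using assms by (simp add: linear_sum linear_scale)
  finally show ?thesis .
qed

text \<open>The chain rule applies the derivative of f to a direction moving with x, hence the
  expansion in \<open>Basis\<close>. The induction keeps g and replaces f by its directional
  derivatives.\<close>

lemma Ck_on_compose:
  assumes "open S" "open T" "g ` S \<subseteq> T" "Ck_on k S g" "Ck_on k T f"
  shows "Ck_on k S (\<lambda>x. f (g x))"
  using assms(4,5)
proof (induction k arbitrary: f)
  case 0
  then show ?case using assms(3) by (auto intro: continuous_on_compose2)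
next
  case (Suc k)
  let ?f' = "\<lambda>x. \<lambda>v. frechet_derivative f (at (g x)) (frechet_derivative g (at x) v)"
  have "((\<lambda>x. f (g x)) has_derivative ?f' x) (at x)" if "x \<in> S" for x
    using Ck_on_SucE(1)[OF Suc.prems(2), of "g x"] Ck_on_SucE(1)[OF Suc.prems(1), of x] assms(3) that
    by (auto intro: has_derivative_compose)
  moreover have "Ck_on k S (\<lambda>x. ?f' x v)" for v
  proof -
    have "Ck_on k S (\<lambda>x. \<Sum>b\<in>Basis. (frechet_derivative g (at x) v \<bullet> b) *\<^sub>R frechet_derivative f (at (g x)) b)"
      by (intro Ck_on_sum Ck_on_scaleR Ck_on_inner assms(1) Ck_on_const Ck_on_SucE(2)[OF Suc.prems(1)]
          Suc.IH[OF Ck_on_SucD[OF Suc.prems(1)]] Ck_on_SucE(2)[OF Suc.prems(2)])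
    moreover have "linear (frechet_derivative f (at (g x)))" if "x \<in> S" for x
      using Suc.prems(2) assms(3) that by (auto intro!: linear_frechet_derivative)
    ultimately show ?thesis
      using assms(1) by (elim Ck_on_cong) (auto simp: linear_Basis_sum[symmetric])
  qed
  ultimately show ?case by (rule Ck_on_SucI[OF assms(1)])
qed

text \<open>The derivative is minus the square of the function itself, so the product rule closes
  the induction.\<close>

lemma Ck_on_inverse: "Ck_on k (- {0}) (inverse :: real \<Rightarrow> real)"
proof (induction k)
  case 0
  then show ?case by (auto intro: continuous_on_inverse)
next
  case (Suc k)
  have "open (- {0::real})" by auto
  moreover have "Ck_on k (- {0::real}) (\<lambda>x. (- v) * (inverse x * inverse x))" for v
    using Suc by (intro Ck_on_mult Ck_on_const) auto
  ultimately show ?case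
    by (intro Ck_on_SucI[where f' = "\<lambda>x v. (- v) * (inverse x * inverse x)"])
      (auto intro!: derivative_eq_intros)
qed

lemma smooth_on_cong:
  "smooth_on S f \<Longrightarrow> open S \<Longrightarrow> (\<And>x. x \<in> S \<Longrightarrow> f x = g x) \<Longrightarrow> smooth_on S g"
  unfolding smooth_on_def using Ck_on_cong by metis

lemma smooth_on_subset: "smooth_on S f \<Longrightarrow> T \<subseteq> S \<Longrightarrow> smooth_on T f"
  unfolding smooth_on_def using Ck_on_subset by metis

lemma smooth_on_local:
  "(\<And>x. x \<in> S \<Longrightarrow> \<exists>T. open T \<and> x \<in> T \<and> smooth_on T f) \<Longrightarrow> smooth_on S f"
  unfolding smooth_on_def using Ck_on_local by metis

lemma smooth_on_const: "smooth_on S (\<lambda>x. c)"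
  by (simp add: smooth_on_def Ck_on_const)

lemma smooth_on_ident: "smooth_on S (\<lambda>x. x)"
  by (simp add: smooth_on_def Ck_on_ident)

lemma smooth_on_add:
  "open S \<Longrightarrow> smooth_on S f \<Longrightarrow> smooth_on S g \<Longrightarrow> smooth_on S (\<lambda>x. f x + g x)"
  by (simp add: smooth_on_def Ck_on_add)

lemma smooth_on_sum:
  "open S \<Longrightarrow> (\<And>i. i \<in> I \<Longrightarrow> smooth_on S (f i)) \<Longrightarrow> smooth_on S (\<lambda>x. \<Sum>i\<in>I. f i x)"
  by (simp add: smooth_on_def Ck_on_sum)

lemma smooth_on_scaleR:
  "open S \<Longrightarrow> smooth_on S f \<Longrightarrow> smooth_on S g \<Longrightarrow> smooth_on S (\<lambda>x. f x *\<^sub>R g x)"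
  by (simp add: smooth_on_def Ck_on_scaleR)

lemma smooth_on_inner:
  "open S \<Longrightarrow> smooth_on S f \<Longrightarrow> smooth_on S g \<Longrightarrow> smooth_on S (\<lambda>x. f x \<bullet> g x)"
  by (simp add: smooth_on_def Ck_on_inner)

lemma smooth_on_mult:
  fixes f g :: "'a::euclidean_space \<Rightarrow> real"
  shows "open S \<Longrightarrow> smooth_on S f \<Longrightarrow> smooth_on S g \<Longrightarrow> smooth_on S (\<lambda>x. f x * g x)"
  by (simp add: smooth_on_def Ck_on_mult)

lemma smooth_on_diff:
  fixes f g :: "'a::euclidean_space \<Rightarrow> 'b::euclidean_space"
  assumes "open S" "smooth_on S f" "smooth_on S g"
  shows "smooth_on S (\<lambda>x. f x - g x)"
  using smooth_on_add[OF assms(1,2) smooth_on_scaleR[OF assms(1) smooth_on_const[of S "-1"] assms(3)]]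
  by simp

lemma smooth_on_compose:
  "open S \<Longrightarrow> open T \<Longrightarrow> g ` S \<subseteq> T \<Longrightarrow> smooth_on S g \<Longrightarrow> smooth_on T f
    \<Longrightarrow> smooth_on S (\<lambda>x. f (g x))"
  unfolding smooth_on_def using Ck_on_compose by metis

lemma smooth_on_inverse:
  fixes f :: "'a::euclidean_space \<Rightarrow> real"
  shows "open S \<Longrightarrow> smooth_on S f \<Longrightarrow> (\<And>x. x \<in> S \<Longrightarrow> f x \<noteq> 0) \<Longrightarrow> smooth_on S (\<lambda>x. inverse (f x))"
  by (rule smooth_on_compose[where T = "- {0}"]) (auto simp: smooth_on_def Ck_on_inverse)

lemma smooth_on_has_derivative:
  "smooth_on S f \<Longrightarrow> x \<in> S \<Longrightarrow> (f has_derivative frechet_derivative f (at x)) (at x)"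
  unfolding smooth_on_def using Ck_on_SucE(1) by blast

lemma smooth_on_frechet_derivative:
  "smooth_on S f \<Longrightarrow> smooth_on S (\<lambda>x. frechet_derivative f (at x) v)"
  unfolding smooth_on_def using Ck_on_SucE(2) by blast

lemma smooth_on_frechet_derivative_field:
  assumes "open S" "smooth_on S f" "smooth_on S Y"
  shows "smooth_on S (\<lambda>x. frechet_derivative f (at x) (Y x))"
proof -
  have "smooth_on S (\<lambda>x. \<Sum>b\<in>Basis. (Y x \<bullet> b) *\<^sub>R frechet_derivative f (at x) b)"
    using assms by (intro smooth_on_sum smooth_on_scaleR smooth_on_inner smooth_on_const
        smooth_on_frechet_derivative)
  moreover have "linear (frechet_derivative f (at x))" if "x \<in> S" for x
    using smooth_on_has_derivative[OF assms(2) that] by (rule has_derivative_linear)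
  ultimately show ?thesis
    using assms(1) by (elim smooth_on_cong) (auto simp: linear_Basis_sum[symmetric])
qed

section \<open>A smooth function vanishing on a half-line\<close>

definition flat_exp :: "real \<Rightarrow> real" where
  "flat_exp x = (if x > 0 then exp (- inverse x) else 0)"

lemma poly_times_exp_tendsto_0:
  "((\<lambda>y. poly p y * exp (- y)) \<longlongrightarrow> (0::real)) at_top"
proof -
  have "((\<lambda>y. \<Sum>i\<le>degree p. coeff p i * (y ^ i / exp y)) \<longlongrightarrow> (\<Sum>i\<le>degree p. coeff p i * 0)) at_top"
    by (intro tendsto_sum tendsto_mult tendsto_const tendsto_power_div_exp_0)
  moreover have "poly p y * exp (- y) = (\<Sum>i\<le>degree p. coeff p i * (y ^ i / exp y))" for y
    by (simp add: poly_altdef sum_distrib_right exp_minus divide_inverse mult.assoc)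
  ultimately show ?thesis by simp
qed

text \<open>The polynomial in 1/x makes the induction close: differentiation sends p to X^2 (p -
  p'). At 0 the convention \<open>inverse 0 = 0\<close> is harmless because \<open>flat_exp\<close>
  vanishes there.\<close>

lemma Ck_on_flat_exp_times_poly:
  "Ck_on k UNIV (\<lambda>x::real. poly p (inverse x) * flat_exp x)"
proof (induction k arbitrary: p)
  have deriv: "((\<lambda>x. poly p (inverse x) * flat_exp x) has_derivative
      (\<lambda>v. v * (poly ([:0, 0, 1:] * (p - pderiv p)) (inverse x) * flat_exp x))) (at x)"
    (is "(?f has_derivative ?f' x) (at x)")
    for p :: "real poly" and x
  proof -
    consider "x > 0" | "x < 0" | "x = 0" by linarith
    then show ?thesis
    proof cases
      case 1
      have "((\<lambda>x. poly p (inverse x) * exp (- inverse x)) has_derivative ?f' x) (at x)"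
        using 1 by (auto intro!: derivative_eq_intros poly_DERIV[THEN DERIV_compose_FDERIV]
            simp: flat_exp_def algebra_simps power2_eq_square)
      then show ?thesis
        by (rule has_derivative_transform_within_open[where s = "{0<..}"])
          (use 1 in \<open>auto simp: flat_exp_def\<close>)
    next
      case 2
      have "((\<lambda>x. 0) has_derivative ?f' x) (at x)"
        using 2 by (auto simp: flat_exp_def)
      then show ?thesis
        by (rule has_derivative_transform_within_open[where s = "{..<0}"])
          (use 2 in \<open>auto simp: flat_exp_def\<close>)
    next
      case 3
      \<comment> \<open>For h > 0 the difference quotient at 0 is y p(y) exp(-y) with y = 1/h;
        \<open>pCons 0 p\<close> stands for y p(y).\<close>
      have "((\<lambda>h. poly (pCons 0 p) (inverse h) * exp (- inverse h)) \<longlongrightarrow> 0) (at_right (0::real))"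
        by (rule filterlim_compose[OF poly_times_exp_tendsto_0 filterlim_inverse_at_top_right])
      then have "((\<lambda>h. (?f (0 + h) - ?f 0) / h) \<longlongrightarrow> 0) (at_right 0)"
        by (rule Lim_transform_eventually)
          (auto simp: eventually_at_right_field flat_exp_def field_simps intro!: exI[of _ 1])
      moreover have "((\<lambda>h. (?f (0 + h) - ?f 0) / h) \<longlongrightarrow> 0) (at_left 0)"
        by (rule tendsto_eventually)
          (auto simp: eventually_at_left_field flat_exp_def intro!: exI[of _ "-1"])
      ultimately have "(\<lambda>h. (?f (0 + h) - ?f 0) / h) \<midarrow>0\<rightarrow> 0"
        by (simp add: filterlim_split_at)
      then have "(?f has_field_derivative 0) (at x)"
        by (simp add: DERIV_def 3)
      then show ?thesis
        unfolding has_field_derivative_def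
        by (rule has_derivative_eq_rhs) (simp add: 3 flat_exp_def fun_eq_iff)
    qed
  qed
  {
    case 0
    have "continuous_on UNIV (\<lambda>x. poly p (inverse x) * flat_exp x)"
      using deriv[of p] by (meson continuous_at_imp_continuous_on has_derivative_continuous)
    then show ?case by simp
  next
    case (Suc k)
    show ?case
      by (rule Ck_on_SucI[OF open_UNIV deriv]) (intro Ck_on_mult Ck_on_const Suc open_UNIV)
  }
qed

lemma smooth_on_flat_exp: "smooth_on UNIV flat_exp"
  using Ck_on_flat_exp_times_poly[of _ 1] by (simp add: smooth_on_def)

section \<open>Symmetry of second derivatives\<close>

text \<open>Both iterated difference quotients are evaluated by the mean value theorem on the
  parallelogram spanned by \<open>s u\<close> and \<open>s v\<close>.\<close>

lemma second_difference_mean_value: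
  fixes f :: "'a::euclidean_space \<Rightarrow> real"
  assumes S: "open S" and f: "Ck_on 2 S f" and s: "0 < s"
    and sub: "\<And>a b. 0 \<le> a \<Longrightarrow> a \<le> s \<Longrightarrow> 0 \<le> b \<Longrightarrow> b \<le> s \<Longrightarrow> z + a *\<^sub>R u + b *\<^sub>R v \<in> S"
  obtains a b where "0 \<le> a" "a \<le> s" "0 \<le> b" "b \<le> s"
    "f (z + s *\<^sub>R u + s *\<^sub>R v) - f (z + s *\<^sub>R u) - f (z + s *\<^sub>R v) + f z
      = s * (s * frechet_derivative (\<lambda>x. frechet_derivative f (at x) u) (at (z + a *\<^sub>R u + b *\<^sub>R v)) v)"
proof -
  define fu where "fu = (\<lambda>x. frechet_derivative f (at x) u)"
  have d1: "(f has_derivative frechet_derivative f (at x)) (at x)" if "x \<in> S" for x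
    using f that by (simp add: numeral_2_eq_2 frechet_derivative_works)
  have d2: "(fu has_derivative frechet_derivative fu (at x)) (at x)" if "x \<in> S" for x
    using f that by (simp add: numeral_2_eq_2 frechet_derivative_works fu_def)
  have line: "((\<lambda>t. h (w + t *\<^sub>R e)) has_real_derivative h' e) (at t)"
    if "(h has_derivative h') (at (w + t *\<^sub>R e))" for h :: "'a \<Rightarrow> real" and h' w e t
  proof -
    have "((\<lambda>t. h (w + t *\<^sub>R e)) has_derivative (\<lambda>r. h' (r *\<^sub>R e))) (at t)"
      by (rule has_derivative_compose[where f = "\<lambda>t. w + t *\<^sub>R e" and g = h, OF _ that])
        (auto intro!: derivative_eq_intros)
    moreover have "h' (r *\<^sub>R e) = h' e * r" for r
      using has_derivative_linear[OF that] by (simp add: linear_scale)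
    ultimately show ?thesis by (simp add: has_field_derivative_def)
  qed
  define \<phi> where "\<phi> = (\<lambda>t. f ((z + s *\<^sub>R v) + t *\<^sub>R u) - f (z + t *\<^sub>R u))"
  have "\<exists>a. 0 < a \<and> a < s \<and> \<phi> s - \<phi> 0 = (s - 0) * (fu ((z + s *\<^sub>R v) + a *\<^sub>R u) - fu (z + a *\<^sub>R u))"
  proof (rule MVT2[OF s])
    fix t assume "0 \<le> t" "t \<le> s"
    then show "(\<phi> has_real_derivative fu ((z + s *\<^sub>R v) + t *\<^sub>R u) - fu (z + t *\<^sub>R u)) (at t)"
      unfolding \<phi>_def fu_def using sub[of t s] sub[of t 0] s
      by (intro DERIV_diff line d1) (auto simp: algebra_simps)
  qed
  then obtain a where a: "0 < a" "a < s"
    "\<phi> s - \<phi> 0 = s * (fu ((z + s *\<^sub>R v) + a *\<^sub>R u) - fu (z + a *\<^sub>R u))" by auto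
  define \<theta> where "\<theta> = (\<lambda>t. fu ((z + a *\<^sub>R u) + t *\<^sub>R v))"
  have "\<exists>b. 0 < b \<and> b < s \<and> \<theta> s - \<theta> 0 = (s - 0) * frechet_derivative fu (at ((z + a *\<^sub>R u) + b *\<^sub>R v)) v"
  proof (rule MVT2[OF s])
    fix t assume "0 \<le> t" "t \<le> s"
    then show "(\<theta> has_real_derivative frechet_derivative fu (at ((z + a *\<^sub>R u) + t *\<^sub>R v)) v) (at t)"
      unfolding \<theta>_def using sub[of a t] a
      by (intro line d2) (auto simp: algebra_simps)
  qed
  then obtain b where b: "0 < b" "b < s"
    "\<theta> s - \<theta> 0 = s * frechet_derivative fu (at ((z + a *\<^sub>R u) + b *\<^sub>R v)) v" by auto
  have "fu ((z + s *\<^sub>R v) + a *\<^sub>R u) - fu (z + a *\<^sub>R u) = \<theta> s - \<theta> 0"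
    by (simp add: \<theta>_def algebra_simps)
  moreover have "\<phi> s - \<phi> 0 = f (z + s *\<^sub>R u + s *\<^sub>R v) - f (z + s *\<^sub>R u) - f (z + s *\<^sub>R v) + f z"
    by (simp add: \<phi>_def algebra_simps)
  ultimately show ?thesis
    using a b that[of a b] by (simp add: fu_def)
qed

text \<open>The second difference is unchanged when u and v are exchanged, so one mixed derivative
  at some point of a small parallelogram equals the other at another point of it; continuity carries
  this to z.\<close>

lemma frechet_derivative_symmetric:
  fixes f :: "'a::euclidean_space \<Rightarrow> real"
  assumes S: "open S" and f: "Ck_on 2 S f" and z: "z \<in> S"
  shows "frechet_derivative (\<lambda>x. frechet_derivative f (at x) u) (at z) v
       = frechet_derivative (\<lambda>x. frechet_derivative f (at x) v) (at z) u"
proof -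
  define F where "F = (\<lambda>u v x. frechet_derivative (\<lambda>x. frechet_derivative f (at x) u) (at x) v)"
  have cont: "isCont (F u v) z" for u v
    using f S z unfolding F_def numeral_2_eq_2 by (simp add: continuous_on_eq_continuous_at)
  have "\<bar>F u v z - F v u z\<bar> < e" if e: "e > 0" for e
  proof -
    obtain d1 where d1: "d1 > 0" "\<And>x. dist x z < d1 \<Longrightarrow> \<bar>F u v x - F u v z\<bar> < e / 2"
      using cont[of u v] e unfolding continuous_at_eps_delta dist_real_def by (meson half_gt_zero)
    obtain d2 where d2: "d2 > 0" "\<And>x. dist x z < d2 \<Longrightarrow> \<bar>F v u x - F v u z\<bar> < e / 2"
      using cont[of v u] e unfolding continuous_at_eps_delta dist_real_def by (meson half_gt_zero)
    obtain d3 where d3: "d3 > 0" "ball z d3 \<subseteq> S"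
      using S z open_contains_ball by blast
    define d where "d = min d1 (min d2 d3)"
    \<comment> \<open>Keeps the parallelogram within distance d / 2 of z; the summand 1 covers u = v
      = 0.\<close>
    define s where "s = d / (2 * (norm u + norm v + 1))"
    have d: "d > 0" using d1 d2 d3 by (simp add: d_def)
    have nn: "norm u + norm v + 1 > 0" by (smt (verit) norm_ge_zero)
    then have s: "s > 0" using d by (simp add: s_def)
    have near: "dist (z + a *\<^sub>R u + b *\<^sub>R v) z < d" if "0 \<le> a" "a \<le> s" "0 \<le> b" "b \<le> s" for a b
    proof -
      have "dist (z + a *\<^sub>R u + b *\<^sub>R v) z \<le> a * norm u + b * norm v"
        using that norm_triangle_ineq[of "a *\<^sub>R u" "b *\<^sub>R v"] by (simp add: dist_norm)
      also have "\<dots> \<le> s * norm u + s * norm v"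
        using that by (intro add_mono mult_right_mono) auto
      also have "\<dots> \<le> s * (norm u + norm v + 1)"
        using s by (simp add: algebra_simps)
      also have "\<dots> = d / 2"
      proof -
        have "d / (2 * n) * n = d / 2" if "n > 0" for n :: real using that by simp
        then show ?thesis unfolding s_def using nn by blast
      qed
      also have "\<dots> < d" using d by simp
      finally show ?thesis .
    qed
    have inS: "z + a *\<^sub>R u + b *\<^sub>R v \<in> S" if "0 \<le> a" "a \<le> s" "0 \<le> b" "b \<le> s" for a b
      using near[OF that] d3 by (auto simp: d_def dist_commute subset_iff)
    obtain a b where ab: "0 \<le> a" "a \<le> s" "0 \<le> b" "b \<le> s"
      "f (z + s *\<^sub>R u + s *\<^sub>R v) - f (z + s *\<^sub>R u) - f (z + s *\<^sub>R v) + f z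
        = s * (s * F u v (z + a *\<^sub>R u + b *\<^sub>R v))"
      unfolding F_def by (rule second_difference_mean_value[OF S f s, of z u v]) (use inS in auto)
    obtain a' b' where ab': "0 \<le> a'" "a' \<le> s" "0 \<le> b'" "b' \<le> s"
      "f (z + s *\<^sub>R v + s *\<^sub>R u) - f (z + s *\<^sub>R v) - f (z + s *\<^sub>R u) + f z
        = s * (s * F v u (z + a' *\<^sub>R v + b' *\<^sub>R u))"
      unfolding F_def
      by (rule second_difference_mean_value[OF S f s, of z v u]) (use inS in \<open>auto simp: add.assoc add.commute[of "_ *\<^sub>R v"]\<close>)
    have "f (z + s *\<^sub>R u + s *\<^sub>R v) = f (z + s *\<^sub>R v + s *\<^sub>R u)"
      by (simp add: algebra_simps)
    then have "s * (s * F u v (z + a *\<^sub>R u + b *\<^sub>R v)) = s * (s * F v u (z + a' *\<^sub>R v + b' *\<^sub>R u))"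
      using ab(5) ab'(5) by linarith
    then have "F u v (z + a *\<^sub>R u + b *\<^sub>R v) = F v u (z + a' *\<^sub>R v + b' *\<^sub>R u)"
      using s by simp
    moreover have "\<bar>F u v (z + a *\<^sub>R u + b *\<^sub>R v) - F u v z\<bar> < e / 2"
      using near[OF ab(1-4)] by (intro d1(2)) (simp add: d_def)
    moreover have "\<bar>F v u (z + a' *\<^sub>R v + b' *\<^sub>R u) - F v u z\<bar> < e / 2"
      using near[OF ab'(3,4,1,2)] by (intro d2(2)) (simp add: d_def algebra_simps)
    ultimately show ?thesis by linarith
  qed
  then have "F u v z = F v u z"
    by (metis less_irrefl zero_less_abs_iff eq_iff_diff_eq_0)
  then show ?thesis by (simp add: F_def)
qed

text \<open>Separates the second derivative of f from the derivative of Y: in a commutator the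
  former cancels by symmetry and the latter gives the Lie bracket.\<close>

lemma has_derivative_frechet_derivative_field:
  fixes f :: "'a::euclidean_space \<Rightarrow> real"
  assumes S: "open S" and f: "smooth_on S f" and Y: "smooth_on S Y" and z: "z \<in> S"
  shows "frechet_derivative (\<lambda>x. frechet_derivative f (at x) (Y x)) (at z) h
     = frechet_derivative (\<lambda>x. frechet_derivative f (at x) (Y z)) (at z) h
       + frechet_derivative f (at z) (frechet_derivative Y (at z) h)"
proof -
  let ?F = "\<lambda>v x. frechet_derivative f (at x) v"
  have lin: "linear (frechet_derivative f (at x))" if "x \<in> S" for x
    using smooth_on_has_derivative[OF f that] by (rule has_derivative_linear)
  have dF: "(?F v has_derivative frechet_derivative (?F v) (at z)) (at z)" for v
    using smooth_on_has_derivative[OF smooth_on_frechet_derivative[OF f] z] .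
  have dY: "(Y has_derivative frechet_derivative Y (at z)) (at z)"
    using smooth_on_has_derivative[OF Y z] .
  have const: "((\<lambda>x. frechet_derivative f (at x) y) has_derivative
      (\<lambda>h. \<Sum>b\<in>Basis. (y \<bullet> b) * frechet_derivative (?F b) (at z) h)) (at z)" for y
  proof -
    have "((\<lambda>x. \<Sum>b\<in>Basis. (y \<bullet> b) * ?F b x) has_derivative
      (\<lambda>h. \<Sum>b\<in>Basis. (y \<bullet> b) * frechet_derivative (?F b) (at z) h)) (at z)"
      by (intro has_derivative_sum has_derivative_mult_right dF)
    then show ?thesis
      by (rule has_derivative_transform_within_open[OF _ S z])
        (use linear_Basis_sum[OF lin] in simp)
  qed
  have "((\<lambda>x. \<Sum>b\<in>Basis. (Y x \<bullet> b) * ?F b x) has_derivative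
    (\<lambda>h. \<Sum>b\<in>Basis. (Y z \<bullet> b) * frechet_derivative (?F b) (at z) h
        + (frechet_derivative Y (at z) h \<bullet> b) * ?F b z)) (at z)"
    by (intro has_derivative_sum has_derivative_mult dF
        bounded_linear.has_derivative[OF bounded_linear_inner_left dY])
  then have "((\<lambda>x. frechet_derivative f (at x) (Y x)) has_derivative
    (\<lambda>h. \<Sum>b\<in>Basis. (Y z \<bullet> b) * frechet_derivative (?F b) (at z) h
        + (frechet_derivative Y (at z) h \<bullet> b) * ?F b z)) (at z)"
    by (rule has_derivative_transform_within_open[OF _ S z])
      (use linear_Basis_sum[OF lin] in simp)
  then show ?thesis
    using frechet_derivative_at[OF const[of "Y z"]]
    by (simp add: frechet_derivative_at[symmetric] sum.distrib linear_Basis_sum[OF lin[OF z], of "frechet_derivative Y (at z) h"])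
      (metis (no_types, lifting))
qed

section \<open>Linear algebra\<close>

lemma subspace_dim_1_multiple:
  fixes a w :: "'a::euclidean_space"
  assumes "subspace S" "dim S = 1" "a \<in> S" "a \<noteq> 0" "w \<in> S"
  obtains c where "w = c *\<^sub>R a"
proof -
  have "span {a} \<subseteq> S" using assms by (simp add: span_minimal)
  then have "span {a} = S"
    using assms by (intro subspace_dim_equal) (auto simp: dim_insert)
  then show ?thesis using assms(5) that by (auto simp: span_singleton)
qed

lemma trace_matrix_scaleR: "trace (matrix (\<lambda>z. c *\<^sub>R z) :: real^'n^'n) = c * CARD('n::finite)"
  by (simp add: trace_def matrix_def axis_def)

text \<open>Ricci and scalar curvature are traces of maps that split into a multiple of the identity
  and rank one maps, so they can be computed without a frame.\<close>

lemma trace_matrix_rank_one: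
  fixes v :: "real^'n::finite"
  assumes "linear \<alpha>"
  shows "trace (matrix (\<lambda>z. \<alpha> z *\<^sub>R v)) = \<alpha> v"
proof -
  have "\<alpha> v = \<alpha> (\<Sum>i\<in>UNIV. (v $ i) *\<^sub>R axis i 1)"
    using basis_expansion[of v] by (simp add: scalar_mult_eq_scaleR)
  also have "\<dots> = (\<Sum>i\<in>UNIV. v $ i * \<alpha> (axis i 1))"
    using assms by (simp add: linear_sum linear_scale)
  finally show ?thesis by (simp add: trace_def matrix_def mult.commute)
qed

lemma trace_matrix_add:
  "trace (matrix (\<lambda>z. f z + h z) :: real^'n^'n) = trace (matrix f :: real^'n^'n) + trace (matrix h :: real^'n::finite^'n)"
  by (simp add: trace_def matrix_def sum.distrib)

text \<open>Collecting equal vector summands can leave a componentwise product with a numeral, which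
  this turns back into a scalar multiple.\<close>

lemma numeral_mult_vec: "numeral k * (v :: real^'n) = numeral k *\<^sub>R v"
  by (simp add: vec_eq_iff)

section \<open>Vector fields on manifolds\<close>

locale smooth_manifold =
  fixes A :: "('m::{t2_space,second_countable_topology}, 'n::finite) chart set"
  assumes atlas: "smooth_atlas A"
begin

section \<open>Changes of coordinates\<close>

abbreviation transition :: "('m, 'n) chart \<Rightarrow> ('m, 'n) chart \<Rightarrow> real^'n \<Rightarrow> real^'n" where
  "transition c d \<equiv> snd d \<circ> chart_inv c"

lemma chart_at_atlas: "chart_at A p \<in> A" and chart_at_mem: "p \<in> fst (chart_at A p)"
proof -
  have "\<exists>c. c \<in> A \<and> p \<in> fst c" using atlas unfolding smooth_atlas_def by (metis UNIV_I UN_E)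
  then have "chart_at A p \<in> A \<and> p \<in> fst (chart_at A p)"
    unfolding chart_at_def by (rule someI_ex)
  then show "chart_at A p \<in> A" "p \<in> fst (chart_at A p)" by auto
qed

lemma chart_homeomorphism:
  "c \<in> A \<Longrightarrow> homeomorphism (fst c) (snd c ` fst c) (snd c) (chart_inv c)"
  and open_chart_dom: "c \<in> A \<Longrightarrow> open (fst c)"
  and open_chart_img: "c \<in> A \<Longrightarrow> open (snd c ` fst c)"
  using atlas by (auto simp: smooth_atlas_def)

lemma chart_inv_chart: "c \<in> A \<Longrightarrow> p \<in> fst c \<Longrightarrow> chart_inv c (snd c p) = p"
  using chart_homeomorphism by (metis homeomorphism_apply1)

lemma chart_chart_inv: "c \<in> A \<Longrightarrow> z \<in> snd c ` fst c \<Longrightarrow> snd c (chart_inv c z) = z"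
  using chart_homeomorphism by (metis homeomorphism_apply2)

lemma chart_inv_mem: "c \<in> A \<Longrightarrow> z \<in> snd c ` fst c \<Longrightarrow> chart_inv c z \<in> fst c"
  by (metis chart_inv_chart imageE)

lemma open_chart_image:
  assumes "c \<in> A" "open U"
  shows "open (snd c ` (fst c \<inter> U))"
proof -
  have "openin (top_of_set (fst c)) (fst c \<inter> U)"
    using assms by (simp add: openin_open_Int)
  then have "openin (top_of_set (snd c ` fst c)) (snd c ` (fst c \<inter> U))"
    by (rule homeomorphism_imp_open_map[OF chart_homeomorphism[OF assms(1)]])
  then show ?thesis
    using open_chart_img[OF assms(1)] openin_open_eq by blast
qed

lemma smooth_on_transition:
  "c \<in> A \<Longrightarrow> d \<in> A \<Longrightarrow> smooth_on (snd c ` (fst c \<inter> fst d)) (transition c d)"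
  using atlas by (auto simp: smooth_atlas_def)

lemma transition_has_derivative:
  assumes "c \<in> A" "d \<in> A" "p \<in> fst c" "p \<in> fst d"
  shows "(transition c d has_derivative frechet_derivative (transition c d) (at (snd c p))) (at (snd c p))"
  using smooth_on_has_derivative[OF smooth_on_transition[OF assms(1,2)], of "snd c p"] assms(3,4) by auto

lemma linear_transition_derivative:
  assumes "c \<in> A" "d \<in> A" "p \<in> fst c" "p \<in> fst d"
  shows "linear (frechet_derivative (transition c d) (at (snd c p)))"
  using transition_has_derivative[OF assms] by (rule has_derivative_linear)

lemma transition_derivative_self:
  assumes "c \<in> A" "p \<in> fst c"
  shows "frechet_derivative (transition c c) (at (snd c p)) w = w"
proof -
  have "((\<lambda>z. z) has_derivative (\<lambda>z. z)) (at (snd c p))" by (rule has_derivative_ident)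
  then have "(transition c c has_derivative (\<lambda>z. z)) (at (snd c p))"
    by (rule has_derivative_transform_within_open[OF _ open_chart_img[OF assms(1)]])
      (use assms chart_chart_inv in auto)
  then show ?thesis by (metis frechet_derivative_at)
qed

lemma transition_derivative_trans:
  assumes "c \<in> A" "d \<in> A" "e \<in> A" "p \<in> fst c" "p \<in> fst d" "p \<in> fst e"
  shows "frechet_derivative (transition d e) (at (snd d p))
      (frechet_derivative (transition c d) (at (snd c p)) w)
    = frechet_derivative (transition c e) (at (snd c p)) w"
proof -
  let ?S = "snd c ` (fst c \<inter> fst d)"
  have tr: "transition c d (snd c p) = snd d p"
    using assms by (simp add: chart_inv_chart)
  have "((\<lambda>z. transition d e (transition c d z)) has_derivative
     (\<lambda>w. frechet_derivative (transition d e) (at (snd d p))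
      (frechet_derivative (transition c d) (at (snd c p)) w))) (at (snd c p))"
    by (rule has_derivative_compose[OF transition_has_derivative[OF assms(1,2,4,5)]])
      (unfold tr, rule transition_has_derivative[OF assms(2,3,5,6)])
  then have "(transition c e has_derivative
     (\<lambda>w. frechet_derivative (transition d e) (at (snd d p))
      (frechet_derivative (transition c d) (at (snd c p)) w))) (at (snd c p))"
    by (rule has_derivative_transform_within_open[where s = ?S])
      (use assms in \<open>auto simp: chart_inv_chart open_chart_image open_chart_dom\<close>)
  then show ?thesis by (metis (no_types, lifting) frechet_derivative_at)
qed

lemma components_transition:
  assumes "c \<in> A" "d \<in> A" "p \<in> fst c" "p \<in> fst d"
  shows "frechet_derivative (transition c d) (at (snd c p)) (components A c p v) = components A d p v"
  unfolding components_def
  by (rule transition_derivative_trans) (use assms in \<open>auto simp: chart_at_atlas chart_at_mem\<close>)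

lemma components_chart_at: "components A (chart_at A p) p v = v"
  unfolding components_def
  by (rule transition_derivative_self) (auto simp: chart_at_atlas chart_at_mem)

lemma linear_components: "c \<in> A \<Longrightarrow> p \<in> fst c \<Longrightarrow> linear (components A c p)"
  unfolding components_def[abs_def]
  by (rule linear_transition_derivative) (auto simp: chart_at_atlas chart_at_mem)

text \<open>Inverse of \<open>components\<close>: it yields the tangent vector at p with prescribed
  components in a chosen chart, so that a field can be defined inside one chart.\<close>

definition from_components :: "('m, 'n) chart \<Rightarrow> 'm \<Rightarrow> real^'n \<Rightarrow> real^'n" where
  "from_components c p w = frechet_derivative (transition c (chart_at A p)) (at (snd c p)) w"

lemma linear_from_components: "c \<in> A \<Longrightarrow> p \<in> fst c \<Longrightarrow> linear (from_components c p)"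
  unfolding from_components_def[abs_def]
  by (rule linear_transition_derivative) (auto simp: chart_at_atlas chart_at_mem)

lemma from_components_components:
  "c \<in> A \<Longrightarrow> p \<in> fst c \<Longrightarrow> from_components c p (components A c p v) = v"
  unfolding from_components_def
  by (simp add: components_transition chart_at_atlas chart_at_mem components_chart_at)

lemma components_from_components:
  assumes "c \<in> A" "d \<in> A" "p \<in> fst c" "p \<in> fst d"
  shows "components A d p (from_components c p w) = frechet_derivative (transition c d) (at (snd c p)) w"
  unfolding from_components_def components_def
  by (rule transition_derivative_trans) (use assms in \<open>auto simp: chart_at_atlas chart_at_mem\<close>)

section \<open>Smooth functions and smooth vector fields\<close>

lemma vfield_in_chart_add:
  "c \<in> A \<Longrightarrow> z \<in> snd c ` fst c \<Longrightarrow>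
    vfield_in_chart A c (\<lambda>p. X p + Y p) z = vfield_in_chart A c X z + vfield_in_chart A c Y z"
  unfolding vfield_in_chart_def using linear_components chart_inv_mem by (metis linear_add)

lemma vfield_in_chart_scaleR:
  "c \<in> A \<Longrightarrow> z \<in> snd c ` fst c \<Longrightarrow>
    vfield_in_chart A c (\<lambda>p. f p *\<^sub>R X p) z = (f \<circ> chart_inv c) z *\<^sub>R vfield_in_chart A c X z"
  unfolding vfield_in_chart_def using linear_components chart_inv_mem by (metis linear_scale comp_apply)

lemma smooth_funD: "smooth_fun A f \<Longrightarrow> c \<in> A \<Longrightarrow> smooth_on (snd c ` fst c) (f \<circ> chart_inv c)"
  by (simp add: smooth_fun_def)

lemma smooth_vfieldD:
  "smooth_vfield A X \<Longrightarrow> c \<in> A \<Longrightarrow> smooth_on (snd c ` fst c) (vfield_in_chart A c X)"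
  by (simp add: smooth_vfield_def)

lemma smooth_fun_const [simp]: "smooth_fun A (\<lambda>p. k)"
  by (simp add: smooth_fun_def comp_def smooth_on_const)

lemma smooth_fun_add [simp]:
  "smooth_fun A f \<Longrightarrow> smooth_fun A h \<Longrightarrow> smooth_fun A (\<lambda>p. f p + h p)"
  using smooth_on_add open_chart_img unfolding smooth_fun_def comp_def by blast

lemma smooth_fun_mult [simp]:
  "smooth_fun A f \<Longrightarrow> smooth_fun A h \<Longrightarrow> smooth_fun A (\<lambda>p. f p * h p)"
  using smooth_on_mult open_chart_img unfolding smooth_fun_def comp_def by blast

lemma smooth_fun_uminus [simp]: "smooth_fun A f \<Longrightarrow> smooth_fun A (\<lambda>p. - f p)"
  using smooth_fun_mult[OF smooth_fun_const[of "-1"]] by simp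

lemma smooth_fun_diff [simp]:
  "smooth_fun A f \<Longrightarrow> smooth_fun A h \<Longrightarrow> smooth_fun A (\<lambda>p. f p - h p)"
  using smooth_fun_add[OF _ smooth_fun_uminus, of f h] by simp

lemma smooth_fun_divide_const [simp]: "smooth_fun A f \<Longrightarrow> smooth_fun A (\<lambda>p. f p / k)"
  using smooth_fun_mult[OF smooth_fun_const[of "1 / k"], of f] by simp

lemma smooth_fun_sum: "(\<And>i. i \<in> I \<Longrightarrow> smooth_fun A (f i)) \<Longrightarrow> smooth_fun A (\<lambda>p. \<Sum>i\<in>I. f i p)"
  by (induction I rule: infinite_finite_induct) auto

lemma smooth_fun_prod: "(\<And>i. i \<in> I \<Longrightarrow> smooth_fun A (f i)) \<Longrightarrow> smooth_fun A (\<lambda>p. \<Prod>i\<in>I. f i p)"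
  by (induction I rule: infinite_finite_induct) auto

lemma smooth_fun_det:
  assumes "\<And>i j. smooth_fun A (\<lambda>p. M p $ i $ j)"
  shows "smooth_fun A (\<lambda>p. det (M p :: real^'k^'k))"
  unfolding det_def by (intro smooth_fun_sum smooth_fun_mult smooth_fun_const smooth_fun_prod assms)

lemma smooth_vfield_add [simp]:
  assumes "smooth_vfield A X" "smooth_vfield A Y"
  shows "smooth_vfield A (\<lambda>p. X p + Y p)"
  unfolding smooth_vfield_def
proof
  fix c assume c: "c \<in> A"
  show "smooth_on (snd c ` fst c) (vfield_in_chart A c (\<lambda>p. X p + Y p))"
    by (rule smooth_on_cong[OF smooth_on_add[OF open_chart_img[OF c] smooth_vfieldD[OF assms(1) c]
            smooth_vfieldD[OF assms(2) c]]])
      (simp_all add: c open_chart_img vfield_in_chart_add)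
qed

lemma smooth_vfield_scaleR [simp]:
  assumes "smooth_fun A f" "smooth_vfield A X"
  shows "smooth_vfield A (\<lambda>p. f p *\<^sub>R X p)"
  unfolding smooth_vfield_def
proof
  fix c assume c: "c \<in> A"
  show "smooth_on (snd c ` fst c) (vfield_in_chart A c (\<lambda>p. f p *\<^sub>R X p))"
    by (rule smooth_on_cong[OF smooth_on_scaleR[OF open_chart_img[OF c] smooth_funD[OF assms(1) c]
            smooth_vfieldD[OF assms(2) c]]])
      (simp_all add: c open_chart_img vfield_in_chart_scaleR)
qed

lemma smooth_vfield_scaleR_const [simp]:
  "smooth_vfield A X \<Longrightarrow> smooth_vfield A (\<lambda>p. k *\<^sub>R X p)"
  by (rule smooth_vfield_scaleR) auto

lemma smooth_vfield_uminus [simp]: "smooth_vfield A X \<Longrightarrow> smooth_vfield A (\<lambda>p. - X p)"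
  using smooth_vfield_scaleR_const[of X "-1"] by simp

lemma smooth_vfield_diff [simp]:
  "smooth_vfield A X \<Longrightarrow> smooth_vfield A Y \<Longrightarrow> smooth_vfield A (\<lambda>p. X p - Y p)"
  using smooth_vfield_add[OF _ smooth_vfield_uminus, of X Y] by simp

lemma smooth_vfield_zero [simp]: "smooth_vfield A (\<lambda>p. 0)"
proof -
  have "smooth_on (snd c ` fst c) (vfield_in_chart A c (\<lambda>p. 0))" if "c \<in> A" for c
    by (rule smooth_on_cong[OF smooth_on_const[of _ 0]])
      (use that linear_components chart_inv_mem in \<open>auto simp: open_chart_img vfield_in_chart_def linear_0\<close>)
  then show ?thesis by (simp add: smooth_vfield_def)
qed

lemma smooth_vfield_sum:
  "(\<And>i. i \<in> I \<Longrightarrow> smooth_vfield A (X i)) \<Longrightarrow> smooth_vfield A (\<lambda>p. \<Sum>i\<in>I. X i p)"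
  by (induction I rule: infinite_finite_induct) auto

section \<open>Local division, extension by zero and bump functions\<close>

lemma open_nonzero:
  assumes "smooth_fun A h" "c \<in> A"
  shows "open {z \<in> snd c ` fst c. h (chart_inv c z) \<noteq> 0}"
proof -
  have "continuous_on (snd c ` fst c) (h \<circ> chart_inv c)"
    using smooth_funD[OF assms] unfolding smooth_on_def by (metis Ck_on.simps(1))
  then have "open ((h \<circ> chart_inv c) -` (- {0}) \<inter> snd c ` fst c)"
    using iffD1[OF continuous_on_open_vimage[OF open_chart_img[OF assms(2)]]] by blast
  moreover have "(h \<circ> chart_inv c) -` (- {0}) \<inter> snd c ` fst c = {z \<in> snd c ` fst c. h (chart_inv c z) \<noteq> 0}"
    by auto
  ultimately show ?thesis by simp
qed

text \<open>Meant for functions given only pointwise, such as a coefficient obtained by choice. Both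
  h and the product are smooth on the whole manifold, as smoothness is defined for global functions;
  near p one divides by h.\<close>

lemma smooth_fun_divide_local:
  assumes "\<And>p. \<exists>h. smooth_fun A h \<and> smooth_fun A (\<lambda>q. h q * f q) \<and> h p \<noteq> 0"
  shows "smooth_fun A f"
  unfolding smooth_fun_def
proof (intro ballI smooth_on_local)
  fix c z assume c: "c \<in> A" and z: "z \<in> snd c ` fst c"
  obtain h where h: "smooth_fun A h" "smooth_fun A (\<lambda>q. h q * f q)" "h (chart_inv c z) \<noteq> 0"
    using assms by blast
  define T where "T = {z \<in> snd c ` fst c. h (chart_inv c z) \<noteq> 0}"
  have T: "open T" "T \<subseteq> snd c ` fst c" "z \<in> T"
    using open_nonzero[OF h(1) c] z h(3) by (auto simp: T_def)
  have "smooth_on T (\<lambda>z. inverse ((h \<circ> chart_inv c) z) * ((\<lambda>q. h q * f q) \<circ> chart_inv c) z)"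
    by (intro smooth_on_mult smooth_on_inverse T
        smooth_on_subset[OF smooth_funD[OF h(1) c] T(2)] smooth_on_subset[OF smooth_funD[OF h(2) c] T(2)])
      (auto simp: T_def)
  then have "smooth_on T (f \<circ> chart_inv c)"
    by (rule smooth_on_cong[OF _ T(1)]) (auto simp: T_def)
  then show "\<exists>T. open T \<and> z \<in> T \<and> smooth_on T (f \<circ> chart_inv c)"
    using T by blast
qed

lemma smooth_vfield_divide_local:
  assumes "\<And>p. \<exists>h. smooth_fun A h \<and> smooth_vfield A (\<lambda>q. h q *\<^sub>R X q) \<and> h p \<noteq> 0"
  shows "smooth_vfield A X"
  unfolding smooth_vfield_def
proof (intro ballI smooth_on_local)
  fix c z assume c: "c \<in> A" and z: "z \<in> snd c ` fst c"
  obtain h where h: "smooth_fun A h" "smooth_vfield A (\<lambda>q. h q *\<^sub>R X q)" "h (chart_inv c z) \<noteq> 0"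
    using assms by blast
  define T where "T = {z \<in> snd c ` fst c. h (chart_inv c z) \<noteq> 0}"
  have T: "open T" "T \<subseteq> snd c ` fst c" "z \<in> T"
    using open_nonzero[OF h(1) c] z h(3) by (auto simp: T_def)
  have "smooth_on T (\<lambda>z. inverse ((h \<circ> chart_inv c) z) *\<^sub>R vfield_in_chart A c (\<lambda>q. h q *\<^sub>R X q) z)"
    by (intro smooth_on_scaleR smooth_on_inverse T
        smooth_on_subset[OF smooth_funD[OF h(1) c] T(2)] smooth_on_subset[OF smooth_vfieldD[OF h(2) c] T(2)])
      (auto simp: T_def)
  then have "smooth_on T (vfield_in_chart A c X)"
    by (rule smooth_on_cong[OF _ T(1)]) (use T(2) c in \<open>auto simp: T_def vfield_in_chart_scaleR\<close>)
  then show "\<exists>T. open T \<and> z \<in> T \<and> smooth_on T (vfield_in_chart A c X)"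
    using T by blast
qed

text \<open>The chart domain and the complement of K form an open cover because K is closed in the
  whole manifold, and on the second set the function is zero.\<close>

lemma smooth_fun_extend_zero:
  assumes c: "c \<in> A" and K: "closed K" "K \<subseteq> fst c" and F: "smooth_on (snd c ` fst c) F"
    and supp: "\<And>p. p \<in> fst c \<Longrightarrow> p \<notin> K \<Longrightarrow> F (snd c p) = 0"
  shows "smooth_fun A (\<lambda>p. if p \<in> fst c then F (snd c p) else 0)" (is "smooth_fun A ?f")
  unfolding smooth_fun_def
proof (intro ballI smooth_on_local)
  fix d z assume d: "d \<in> A" and z: "z \<in> snd d ` fst d"
  show "\<exists>T. open T \<and> z \<in> T \<and> smooth_on T (?f \<circ> chart_inv d)"
  proof (cases "chart_inv d z \<in> fst c")
    case True
    let ?T = "snd d ` (fst d \<inter> fst c)"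
    have T: "open ?T" using c d by (simp add: open_chart_image open_chart_dom)
    have zT: "z \<in> ?T" using True z d chart_chart_inv chart_inv_mem by (metis IntI image_eqI)
    have "smooth_on ?T (\<lambda>z. F (transition d c z))"
      by (rule smooth_on_compose[OF T open_chart_img[OF c] _ smooth_on_transition[OF d c] F])
        (auto simp: chart_inv_chart[OF d])
    then have "smooth_on ?T (?f \<circ> chart_inv d)"
      by (rule smooth_on_cong[OF _ T]) (auto simp: chart_inv_chart[OF d])
    then show ?thesis using T zT by blast
  next
    case False
    let ?T = "snd d ` (fst d \<inter> - K)"
    have T: "open ?T" using K d by (simp add: open_chart_image open_Compl)
    have zT: "z \<in> ?T" using False z d K chart_chart_inv chart_inv_mem
      by (metis ComplI IntI image_eqI subsetD)
    have "smooth_on ?T (?f \<circ> chart_inv d)"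
      by (rule smooth_on_cong[OF smooth_on_const[of _ 0] T]) (auto simp: chart_inv_chart[OF d] supp)
    then show ?thesis using T zT by blast
  qed
qed

text \<open>Same cover as for functions. On an overlap the components in chart d are the derivative
  of the transition map in the direction F, which varies with the point.\<close>

lemma smooth_vfield_extend_zero:
  assumes c: "c \<in> A" and K: "closed K" "K \<subseteq> fst c" and F: "smooth_on (snd c ` fst c) F"
    and supp: "\<And>p. p \<in> fst c \<Longrightarrow> p \<notin> K \<Longrightarrow> F (snd c p) = 0"
  shows "smooth_vfield A (\<lambda>p. if p \<in> fst c then from_components c p (F (snd c p)) else 0)"
    (is "smooth_vfield A ?X")
  unfolding smooth_vfield_def
proof (intro ballI smooth_on_local)
  fix d z assume d: "d \<in> A" and z: "z \<in> snd d ` fst d"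
  show "\<exists>T. open T \<and> z \<in> T \<and> smooth_on T (vfield_in_chart A d ?X)"
  proof (cases "chart_inv d z \<in> fst c")
    case True
    let ?T = "snd d ` (fst d \<inter> fst c)" and ?S = "snd c ` (fst c \<inter> fst d)"
    have T: "open ?T" and S: "open ?S" using c d by (simp_all add: open_chart_image open_chart_dom)
    have zT: "z \<in> ?T" using True z d chart_chart_inv chart_inv_mem by (metis IntI image_eqI)
    have "smooth_on ?S (\<lambda>w. frechet_derivative (transition c d) (at w) (F w))"
      by (rule smooth_on_frechet_derivative_field[OF S smooth_on_transition[OF c d] smooth_on_subset[OF F]])
        auto
    then have "smooth_on ?T (\<lambda>z. frechet_derivative (transition c d) (at (transition d c z)) (F (transition d c z)))"
      by (rule smooth_on_compose[OF T S _ smooth_on_transition[OF d c], rotated])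
        (auto simp: chart_inv_chart[OF d])
    then have "smooth_on ?T (vfield_in_chart A d ?X)"
      by (rule smooth_on_cong[OF _ T])
        (auto simp: chart_inv_chart[OF d] vfield_in_chart_def components_from_components c d)
    then show ?thesis using T zT by blast
  next
    case False
    let ?T = "snd d ` (fst d \<inter> - K)"
    have T: "open ?T" using K d by (simp add: open_chart_image open_Compl)
    have zT: "z \<in> ?T" using False z d K chart_chart_inv chart_inv_mem
      by (metis ComplI IntI image_eqI subsetD)
    have "smooth_on ?T (vfield_in_chart A d ?X)"
      by (rule smooth_on_cong[OF smooth_on_const[of _ 0] T])
        (auto simp: chart_inv_chart[OF d] supp vfield_in_chart_def linear_0[OF linear_components[OF d]]
          linear_0[OF linear_from_components[OF c]])
    then show ?thesis using T zT by blast
  qed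
qed

text \<open>A closed coordinate ball corresponds to a compact set K, and compact sets are closed
  since the manifold is Hausdorff. This is the closed support that extension by zero asks
  for.\<close>

lemma exists_bump:
  assumes c: "c \<in> A" and p: "p \<in> fst c"
  obtains b :: "real^'n \<Rightarrow> real" and K where "smooth_on UNIV b" "closed K" "K \<subseteq> fst c"
    "\<And>q. q \<in> fst c \<Longrightarrow> q \<notin> K \<Longrightarrow> b (snd c q) = 0" "b (snd c p) > 0"
proof -
  let ?z = "snd c p"
  obtain e where e: "e > 0" "cball ?z e \<subseteq> snd c ` fst c"
    using open_chart_img[OF c] p by (meson open_contains_cball imageI)
  define K where "K = chart_inv c ` cball ?z e"
  \<comment> \<open>Positive exactly inside the ball of radius e around \<open>?z\<close>.\<close>
  define b where "b = (\<lambda>z. flat_exp (e\<^sup>2 - (z - ?z) \<bullet> (z - ?z)))"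
  have "continuous_on (snd c ` fst c) (chart_inv c)"
    using chart_homeomorphism[OF c] by (simp add: homeomorphism_def)
  then have "compact K"
    unfolding K_def using e by (intro compact_continuous_image compact_cball) (auto intro: continuous_on_subset)
  then have "closed K" by (rule compact_imp_closed)
  moreover have "K \<subseteq> fst c" using e chart_inv_mem[OF c] by (auto simp: K_def)
  moreover have "smooth_on UNIV b"
    unfolding b_def
    by (rule smooth_on_compose[OF _ _ _ _ smooth_on_flat_exp])
      (auto intro!: smooth_on_diff smooth_on_inner smooth_on_const smooth_on_ident)
  moreover have "b (snd c q) = 0" if "q \<in> fst c" "q \<notin> K" for q
  proof -
    have "snd c q \<notin> cball ?z e"
      using that chart_inv_chart[OF c] by (metis K_def image_eqI)
    then have "e < norm (snd c q - ?z)" by (simp add: dist_norm norm_minus_commute)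
    then have "e\<^sup>2 < (norm (snd c q - ?z))\<^sup>2" using e by (intro power_strict_mono) auto
    then show ?thesis by (simp add: b_def flat_exp_def power2_norm_eq_inner)
  qed
  moreover have "b ?z > 0" using e by (simp add: b_def flat_exp_def)
  ultimately show ?thesis using that by blast
qed

text \<open>Constant components in the preferred chart, cut off by a bump and divided by its value
  at p. This gives meaning to the choice in \<open>extend_vector\<close>.\<close>

lemma exists_smooth_vfield: "\<exists>X. smooth_vfield A X \<and> X p = v"
proof -
  let ?c = "chart_at A p"
  obtain b :: "real^'n \<Rightarrow> real" and K where b: "smooth_on UNIV b" "closed K" "K \<subseteq> fst ?c"
    "\<And>q. q \<in> fst ?c \<Longrightarrow> q \<notin> K \<Longrightarrow> b (snd ?c q) = 0" "b (snd ?c p) > 0"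
    using exists_bump[OF chart_at_atlas chart_at_mem] by blast
  let ?w = "components A ?c p v"
  let ?X = "\<lambda>q. if q \<in> fst ?c then from_components ?c q (b (snd ?c q) *\<^sub>R ?w) else 0"
  have "smooth_vfield A ?X"
    by (rule smooth_vfield_extend_zero[where K = K])
      (auto simp: chart_at_atlas b open_chart_img intro!: smooth_on_scaleR smooth_on_const smooth_on_subset[OF b(1)])
  then have "smooth_vfield A (\<lambda>q. inverse (b (snd ?c p)) *\<^sub>R ?X q)" by simp
  moreover have "inverse (b (snd ?c p)) *\<^sub>R ?X p = v"
    using b(5) chart_at_mem chart_at_atlas linear_from_components
    by (simp add: linear_scale from_components_components)
  ultimately show ?thesis by blast
qed

lemma extend_vector: "smooth_vfield A (extend_vector A p v)" "extend_vector A p v p = v"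
  using someI_ex[OF exists_smooth_vfield[of p v]] by (auto simp: extend_vector_def)

section \<open>Vector fields as derivations\<close>

lemma fun_in_chart_has_derivative:
  assumes "smooth_fun A f" "c \<in> A" "p \<in> fst c"
  shows "(f \<circ> chart_inv c has_derivative frechet_derivative (f \<circ> chart_inv c) (at (snd c p))) (at (snd c p))"
  using smooth_on_has_derivative[OF smooth_funD[OF assms(1,2)]] assms(3) by auto

text \<open>\<open>vderiv\<close> uses a chart that changes with p in an uncontrolled way; its
  result can be differentiated again once it is expressed in a fixed chart.\<close>

lemma vderiv_chart:
  assumes f: "smooth_fun A f" and c: "c \<in> A" "p \<in> fst c"
  shows "vderiv A X f p = frechet_derivative (f \<circ> chart_inv c) (at (snd c p)) (components A c p (X p))"
proof -
  let ?k = "chart_at A p"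
  have k: "?k \<in> A" "p \<in> fst ?k" by (auto simp: chart_at_atlas chart_at_mem)
  have tr: "transition ?k c (snd ?k p) = snd c p"
    using k by (simp add: chart_inv_chart)
  have "((\<lambda>z. (f \<circ> chart_inv c) (transition ?k c z)) has_derivative
     (\<lambda>w. frechet_derivative (f \<circ> chart_inv c) (at (snd c p))
      (frechet_derivative (transition ?k c) (at (snd ?k p)) w))) (at (snd ?k p))"
    by (rule has_derivative_compose[OF transition_has_derivative[OF k(1) c(1) k(2) c(2)]])
      (unfold tr, rule fun_in_chart_has_derivative[OF f c])
  then have "(f \<circ> chart_inv ?k has_derivative
     (\<lambda>w. frechet_derivative (f \<circ> chart_inv c) (at (snd c p))
      (frechet_derivative (transition ?k c) (at (snd ?k p)) w))) (at (snd ?k p))"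
    by (rule has_derivative_transform_within_open[where s = "snd ?k ` (fst ?k \<inter> fst c)"])
      (use k c in \<open>auto simp: chart_inv_chart open_chart_image open_chart_dom\<close>)
  then show ?thesis
    unfolding vderiv_def components_def by (simp add: frechet_derivative_at[symmetric])
qed

lemma vderiv_in_chart:
  assumes "smooth_fun A f" "c \<in> A" "z \<in> snd c ` fst c"
  shows "(vderiv A X f \<circ> chart_inv c) z
    = frechet_derivative (f \<circ> chart_inv c) (at z) (vfield_in_chart A c X z)"
  using vderiv_chart[OF assms(1,2) chart_inv_mem[OF assms(2,3)]] assms
  by (simp add: vfield_in_chart_def chart_chart_inv)

lemma smooth_fun_vderiv [simp]:
  assumes "smooth_fun A f" "smooth_vfield A X"
  shows "smooth_fun A (vderiv A X f)"
  unfolding smooth_fun_def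
proof
  fix c assume c: "c \<in> A"
  show "smooth_on (snd c ` fst c) (vderiv A X f \<circ> chart_inv c)"
    by (rule smooth_on_cong[OF smooth_on_frechet_derivative_field[OF open_chart_img[OF c]
          smooth_funD[OF assms(1) c] smooth_vfieldD[OF assms(2) c]] open_chart_img[OF c]])
      (rule vderiv_in_chart[OF assms(1) c, symmetric])
qed

text \<open>The test function is a bump times a centred coordinate: as the coordinate vanishes at p,
  the derivative of the bump drops out and the component along i remains, up to a positive
  factor.\<close>

lemma vector_eqI_chart:
  assumes c: "c \<in> A" "p \<in> fst c"
    and eq: "\<And>f. smooth_fun A f \<Longrightarrow> frechet_derivative (f \<circ> chart_inv c) (at (snd c p)) v
      = frechet_derivative (f \<circ> chart_inv c) (at (snd c p)) w"
  shows "v = w"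
proof (rule euclidean_eqI)
  fix i :: "real^'n" assume "i \<in> Basis"
  obtain b :: "real^'n \<Rightarrow> real" and K where b: "smooth_on UNIV b" "closed K" "K \<subseteq> fst c"
    "\<And>q. q \<in> fst c \<Longrightarrow> q \<notin> K \<Longrightarrow> b (snd c q) = 0" "b (snd c p) > 0"
    using exists_bump[OF c] by blast
  define F where "F = (\<lambda>z. b z * ((z - snd c p) \<bullet> i))"
  define f where "f = (\<lambda>q. if q \<in> fst c then F (snd c q) else 0)"
  have F: "smooth_on UNIV F"
    unfolding F_def by (intro smooth_on_mult smooth_on_inner smooth_on_diff smooth_on_ident smooth_on_const b open_UNIV)
  have f: "smooth_fun A f"
    unfolding f_def
    by (rule smooth_fun_extend_zero[OF c(1) b(2,3) smooth_on_subset[OF F]]) (auto simp: F_def b(4))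
  have "(b has_derivative frechet_derivative b (at (snd c p))) (at (snd c p))"
    by (rule smooth_on_has_derivative[OF b(1)]) simp
  then have "(F has_derivative (\<lambda>h. b (snd c p) * (h \<bullet> i))) (at (snd c p))"
    unfolding F_def by (auto intro!: derivative_eq_intros)
  then have "(f \<circ> chart_inv c has_derivative (\<lambda>h. b (snd c p) * (h \<bullet> i))) (at (snd c p))"
    by (rule has_derivative_transform_within_open[OF _ open_chart_img[OF c(1)]])
      (use c in \<open>auto simp: f_def chart_inv_chart\<close>)
  then show "v \<bullet> i = w \<bullet> i"
    using eq[OF f] b(5) by (simp add: frechet_derivative_at[symmetric])
qed

lemma vector_eqI:
  assumes "\<And>f. smooth_fun A f \<Longrightarrow> vderiv A X f p = vderiv A Y f p"
  shows "X p = Y p"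
  using vector_eqI_chart[OF chart_at_atlas chart_at_mem, of p "X p" "Y p"] assms
  by (simp add: vderiv_def)

lemma vderiv_add_field:
    "smooth_fun A f \<Longrightarrow> vderiv A (\<lambda>q. X q + Y q) f = (\<lambda>p. vderiv A X f p + vderiv A Y f p)"
  and vderiv_scaleR_field:
    "smooth_fun A f \<Longrightarrow> vderiv A (\<lambda>q. h q *\<^sub>R X q) f = (\<lambda>p. h p * vderiv A X f p)"
  and vderiv_uminus_field:
    "smooth_fun A f \<Longrightarrow> vderiv A (\<lambda>q. - X q) f = (\<lambda>p. - vderiv A X f p)"
  and vderiv_diff_field:
    "smooth_fun A f \<Longrightarrow> vderiv A (\<lambda>q. X q - Y q) f = (\<lambda>p. vderiv A X f p - vderiv A Y f p)"
  and vderiv_zero_field: "smooth_fun A f \<Longrightarrow> vderiv A (\<lambda>q. 0) f = (\<lambda>p. 0)"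
  unfolding vderiv_def
  using has_derivative_linear[OF fun_in_chart_has_derivative[OF _ chart_at_atlas chart_at_mem, of f]]
  by (auto simp: linear_add linear_scale linear_neg linear_diff linear_0)

lemma vderiv_const [simp]: "vderiv A X (\<lambda>q. k) = (\<lambda>p. 0)"
  by (simp add: vderiv_def comp_def fun_eq_iff)

lemma vderiv_add:
  assumes "smooth_fun A f" "smooth_fun A h"
  shows "vderiv A X (\<lambda>q. f q + h q) = (\<lambda>p. vderiv A X f p + vderiv A X h p)"
proof
  fix p
  let ?k = "chart_at A p"
  have "(\<lambda>q. f q + h q) \<circ> chart_inv ?k = (\<lambda>z. (f \<circ> chart_inv ?k) z + (h \<circ> chart_inv ?k) z)"
    by auto
  moreover note has_derivative_add[OF fun_in_chart_has_derivative[OF assms(1) chart_at_atlas chart_at_mem]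
      fun_in_chart_has_derivative[OF assms(2) chart_at_atlas chart_at_mem], of p,
      THEN frechet_derivative_at, THEN fun_cong, of "X p"]
  ultimately show "vderiv A X (\<lambda>q. f q + h q) p = vderiv A X f p + vderiv A X h p"
    unfolding vderiv_def by (simp only:)
qed

lemma vderiv_mult:
  assumes "smooth_fun A f" "smooth_fun A h"
  shows "vderiv A X (\<lambda>q. f q * h q) = (\<lambda>p. vderiv A X f p * h p + f p * vderiv A X h p)"
proof
  fix p
  let ?k = "chart_at A p"
  have "(\<lambda>q. f q * h q) \<circ> chart_inv ?k = (\<lambda>z. (f \<circ> chart_inv ?k) z * (h \<circ> chart_inv ?k) z)"
    by auto
  moreover have "(f \<circ> chart_inv ?k) (snd ?k p) = f p" "(h \<circ> chart_inv ?k) (snd ?k p) = h p"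
    by (simp_all add: chart_inv_chart chart_at_atlas chart_at_mem)
  moreover note has_derivative_mult[OF fun_in_chart_has_derivative[OF assms(1) chart_at_atlas chart_at_mem]
      fun_in_chart_has_derivative[OF assms(2) chart_at_atlas chart_at_mem], of p,
      THEN frechet_derivative_at, THEN fun_cong, of "X p"]
  ultimately show "vderiv A X (\<lambda>q. f q * h q) p = vderiv A X f p * h p + f p * vderiv A X h p"
    unfolding vderiv_def by (simp only: add.commute)
qed

lemma vderiv_cmult: "smooth_fun A f \<Longrightarrow> vderiv A X (\<lambda>q. k * f q) = (\<lambda>p. k * vderiv A X f p)"
  by (simp add: vderiv_mult)

lemma vderiv_uminus: "smooth_fun A f \<Longrightarrow> vderiv A X (\<lambda>q. - f q) = (\<lambda>p. - vderiv A X f p)"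
  using vderiv_cmult[of f X "-1"] by simp

lemma vderiv_diff:
  "smooth_fun A f \<Longrightarrow> smooth_fun A h \<Longrightarrow>
    vderiv A X (\<lambda>q. f q - h q) = (\<lambda>p. vderiv A X f p - vderiv A X h p)"
  using vderiv_add[OF _ smooth_fun_uminus, of f h] by (simp add: vderiv_uminus)

section \<open>The Lie bracket in an arbitrary chart\<close>

definition chart_bracket ::
  "('m, 'n) chart \<Rightarrow> ('m, 'n) vfield \<Rightarrow> ('m, 'n) vfield \<Rightarrow> real^'n \<Rightarrow> real^'n" where
  "chart_bracket c X Y z =
     frechet_derivative (vfield_in_chart A c Y) (at z) (vfield_in_chart A c X z)
   - frechet_derivative (vfield_in_chart A c X) (at z) (vfield_in_chart A c Y z)"

text \<open>In the difference of the iterated derivatives the second derivatives of f cancel by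
  symmetry; the derivatives of the components remain.\<close>

lemma derivative_chart_bracket:
  assumes f: "smooth_fun A f" and X: "smooth_vfield A X" and Y: "smooth_vfield A Y"
    and c: "c \<in> A" "p \<in> fst c"
  shows "frechet_derivative (f \<circ> chart_inv c) (at (snd c p)) (chart_bracket c X Y (snd c p))
    = vderiv A X (vderiv A Y f) p - vderiv A Y (vderiv A X f) p"
proof -
  let ?F = "f \<circ> chart_inv c" and ?S = "snd c ` fst c" and ?z = "snd c p"
  have S: "open ?S" "?z \<in> ?S" using c by (auto simp: open_chart_img)
  have second: "vderiv A X (vderiv A Y f) p =
      frechet_derivative (\<lambda>x. frechet_derivative ?F (at x) (vfield_in_chart A c Y ?z)) (at ?z) (vfield_in_chart A c X ?z)
    + frechet_derivative ?F (at ?z) (frechet_derivative (vfield_in_chart A c Y) (at ?z) (vfield_in_chart A c X ?z))"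
    if X: "smooth_vfield A X" and Y: "smooth_vfield A Y" for X Y
  proof -
    have "vderiv A X (vderiv A Y f) p
        = frechet_derivative (vderiv A Y f \<circ> chart_inv c) (at ?z) (vfield_in_chart A c X ?z)"
      using vderiv_chart[OF smooth_fun_vderiv[OF f Y] c] c by (simp add: vfield_in_chart_def chart_inv_chart)
    also have "frechet_derivative (vderiv A Y f \<circ> chart_inv c) (at ?z)
        = frechet_derivative (\<lambda>x. frechet_derivative ?F (at x) (vfield_in_chart A c Y x)) (at ?z)"
      by (rule frechet_derivative_transform_within_open[OF _ S])
        (use smooth_on_has_derivative[OF smooth_funD[OF smooth_fun_vderiv[OF f Y] c(1)] S(2)]
          vderiv_in_chart[OF f c(1)] in \<open>auto simp: differentiable_def\<close>)
    also have "\<dots> (vfield_in_chart A c X ?z) =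
        frechet_derivative (\<lambda>x. frechet_derivative ?F (at x) (vfield_in_chart A c Y ?z)) (at ?z) (vfield_in_chart A c X ?z)
        + frechet_derivative ?F (at ?z) (frechet_derivative (vfield_in_chart A c Y) (at ?z) (vfield_in_chart A c X ?z))"
      by (rule has_derivative_frechet_derivative_field[OF S(1) smooth_funD[OF f c(1)] smooth_vfieldD[OF Y c(1)] S(2)])
    finally show ?thesis .
  qed
  have "Ck_on 2 ?S ?F" using smooth_funD[OF f c(1)] by (simp only: smooth_on_def)
  from frechet_derivative_symmetric[OF S(1) this S(2)]
  show ?thesis
    unfolding second[OF X Y] second[OF Y X] chart_bracket_def
    using has_derivative_linear[OF fun_in_chart_has_derivative[OF f c]] by (simp add: linear_diff)
qed

lemma lie_bracket_chart_at: "lie_bracket A X Y p = chart_bracket (chart_at A p) X Y (snd (chart_at A p) p)"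
  by (simp add: lie_bracket_def chart_bracket_def Let_def vfield_in_chart_def chart_inv_chart
      chart_at_atlas chart_at_mem components_chart_at)

lemma vderiv_lie_bracket:
  assumes "smooth_fun A f" "smooth_vfield A X" "smooth_vfield A Y"
  shows "vderiv A (lie_bracket A X Y) f = (\<lambda>p. vderiv A X (vderiv A Y f) p - vderiv A Y (vderiv A X f) p)"
  using derivative_chart_bracket[OF assms chart_at_atlas chart_at_mem]
  by (simp add: lie_bracket_chart_at vderiv_def fun_eq_iff)

text \<open>Both sides act on functions as the commutator of derivations, which mentions no chart.
  Smoothness of the bracket rests on this, since its definition switches charts from point to
  point.\<close>

lemma lie_bracket_in_chart:
  assumes "smooth_vfield A X" "smooth_vfield A Y" "c \<in> A" "z \<in> snd c ` fst c"
  shows "vfield_in_chart A c (lie_bracket A X Y) z = chart_bracket c X Y z"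
proof -
  let ?p = "chart_inv c z"
  have p: "?p \<in> fst c" "snd c ?p = z" using assms chart_inv_mem chart_chart_inv by auto
  show ?thesis
    unfolding vfield_in_chart_def
  proof (rule vector_eqI_chart[OF assms(3) p(1)])
    fix f assume f: "smooth_fun A f"
    show "frechet_derivative (f \<circ> chart_inv c) (at (snd c ?p)) (components A c ?p (lie_bracket A X Y ?p))
      = frechet_derivative (f \<circ> chart_inv c) (at (snd c ?p)) (chart_bracket c X Y z)"
      using derivative_chart_bracket[OF f assms(1,2,3) p(1)] fun_cong[OF vderiv_lie_bracket[OF f assms(1,2)], of ?p]
        vderiv_chart[OF f assms(3) p(1), of "lie_bracket A X Y"] p(2) by simp
  qed
qed

lemma smooth_vfield_lie_bracket [simp]:
  assumes "smooth_vfield A X" "smooth_vfield A Y"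
  shows "smooth_vfield A (lie_bracket A X Y)"
  unfolding smooth_vfield_def
proof
  fix c assume c: "c \<in> A"
  have "smooth_on (snd c ` fst c) (chart_bracket c X Y)"
    unfolding chart_bracket_def[abs_def]
    by (intro smooth_on_diff smooth_on_frechet_derivative_field open_chart_img smooth_vfieldD assms c)
  then show "smooth_on (snd c ` fst c) (vfield_in_chart A c (lie_bracket A X Y))"
    by (rule smooth_on_cong[OF _ open_chart_img[OF c]]) (simp add: lie_bracket_in_chart assms c)
qed

lemma lie_bracket_antisym:
  "smooth_vfield A X \<Longrightarrow> smooth_vfield A Y \<Longrightarrow> lie_bracket A X Y = (\<lambda>p. - lie_bracket A Y X p)"
  by (rule ext, rule vector_eqI) (simp add: vderiv_lie_bracket vderiv_uminus_field)

lemma lie_bracket_add_right: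
  "smooth_vfield A X \<Longrightarrow> smooth_vfield A Y \<Longrightarrow> smooth_vfield A Z \<Longrightarrow>
    lie_bracket A X (\<lambda>q. Y q + Z q) = (\<lambda>p. lie_bracket A X Y p + lie_bracket A X Z p)"
  by (rule ext, rule vector_eqI) (simp add: vderiv_lie_bracket vderiv_add_field vderiv_add)

lemma lie_bracket_scaleR_right:
  "smooth_vfield A X \<Longrightarrow> smooth_vfield A Y \<Longrightarrow> smooth_fun A h \<Longrightarrow>
    lie_bracket A X (\<lambda>q. h q *\<^sub>R Y q) = (\<lambda>p. vderiv A X h p *\<^sub>R Y p + h p *\<^sub>R lie_bracket A X Y p)"
  by (rule ext, rule vector_eqI)
    (simp add: vderiv_lie_bracket vderiv_add_field vderiv_scaleR_field vderiv_mult algebra_simps)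

lemma lie_bracket_jacobi:
  "smooth_vfield A X \<Longrightarrow> smooth_vfield A Y \<Longrightarrow> smooth_vfield A Z \<Longrightarrow>
    lie_bracket A X (lie_bracket A Y Z) =
      (\<lambda>p. lie_bracket A (lie_bracket A X Y) Z p + lie_bracket A Y (lie_bracket A X Z) p)"
  by (rule ext, rule vector_eqI) (simp add: vderiv_lie_bracket vderiv_add_field vderiv_diff)

lemma lie_bracket_add_left:
  "smooth_vfield A X \<Longrightarrow> smooth_vfield A Y \<Longrightarrow> smooth_vfield A Z \<Longrightarrow>
    lie_bracket A (\<lambda>q. X q + Y q) Z = (\<lambda>p. lie_bracket A X Z p + lie_bracket A Y Z p)"
  by (rule ext, rule vector_eqI) (simp add: vderiv_lie_bracket vderiv_add_field vderiv_add)

lemma lie_bracket_scaleR_left: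
  "smooth_vfield A X \<Longrightarrow> smooth_vfield A Y \<Longrightarrow> smooth_fun A h \<Longrightarrow>
    lie_bracket A (\<lambda>q. h q *\<^sub>R X q) Y = (\<lambda>p. h p *\<^sub>R lie_bracket A X Y p - vderiv A Y h p *\<^sub>R X p)"
  by (rule ext, rule vector_eqI)
    (simp add: vderiv_lie_bracket vderiv_diff_field vderiv_scaleR_field vderiv_mult algebra_simps)

lemma lie_bracket_uminus_right:
  "smooth_vfield A X \<Longrightarrow> smooth_vfield A Y \<Longrightarrow>
    lie_bracket A X (\<lambda>q. - Y q) = (\<lambda>p. - lie_bracket A X Y p)"
  using lie_bracket_scaleR_right[of X Y "\<lambda>p. -1"] by simp

lemma lie_bracket_jacobi_cyclic:
  assumes "smooth_vfield A X" "smooth_vfield A Y" "smooth_vfield A Z"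
  shows "lie_bracket A (lie_bracket A X Y) Z p + lie_bracket A (lie_bracket A Y Z) X p
    + lie_bracket A (lie_bracket A Z X) Y p = 0"
proof -
  have "lie_bracket A (lie_bracket A Y Z) X p = - lie_bracket A X (lie_bracket A Y Z) p"
    "lie_bracket A (lie_bracket A Z X) Y p = - lie_bracket A Y (lie_bracket A Z X) p"
    by (rule fun_cong[OF lie_bracket_antisym], simp_all add: assms)+
  moreover have "lie_bracket A Y (lie_bracket A X Z) p = - lie_bracket A Y (lie_bracket A Z X) p"
    using assms by (subst lie_bracket_antisym[of X Z]) (simp_all add: lie_bracket_uminus_right)
  moreover note fun_cong[OF lie_bracket_jacobi[OF assms], of p]
  ultimately show ?thesis by simp
qed

section \<open>Tensorial maps depend on the value at one point\<close>

lemma sum_tensorial: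
  fixes \<alpha> :: "('m, 'n) vfield \<Rightarrow> 'b::real_vector"
  assumes add: "\<And>X Y. smooth_vfield A X \<Longrightarrow> smooth_vfield A Y \<Longrightarrow> \<alpha> (\<lambda>q. X q + Y q) = \<alpha> X + \<alpha> Y"
    and scale: "\<And>f X. smooth_fun A f \<Longrightarrow> smooth_vfield A X \<Longrightarrow> \<alpha> (\<lambda>q. f q *\<^sub>R X q) = f p *\<^sub>R \<alpha> X"
    and X: "\<And>i. i \<in> I \<Longrightarrow> smooth_vfield A (X i)"
  shows "\<alpha> (\<lambda>q. \<Sum>i\<in>I. X i q) = (\<Sum>i\<in>I. \<alpha> (X i))"
proof -
  have "\<alpha> (\<lambda>q. 0) = 0" using scale[of "\<lambda>q. 0" "\<lambda>q. 0"] by simp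
  then show ?thesis
    using X by (induction I rule: infinite_finite_induct) (auto simp: add smooth_vfield_sum)
qed

text \<open>The hypotheses concern global fields, so Z is multiplied by the square of a bump: one
  factor makes the components global functions, the other makes the coordinate fields global. The
  coefficients vanish at p together with Z.\<close>

lemma tensorial_zero:
  fixes \<alpha> :: "('m, 'n) vfield \<Rightarrow> 'b::real_vector"
  assumes add: "\<And>X Y. smooth_vfield A X \<Longrightarrow> smooth_vfield A Y \<Longrightarrow> \<alpha> (\<lambda>q. X q + Y q) = \<alpha> X + \<alpha> Y"
    and scale: "\<And>f X. smooth_fun A f \<Longrightarrow> smooth_vfield A X \<Longrightarrow> \<alpha> (\<lambda>q. f q *\<^sub>R X q) = f p *\<^sub>R \<alpha> X"
    and Z: "smooth_vfield A Z" and Z0: "Z p = 0"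
  shows "\<alpha> Z = 0"
proof -
  let ?c = "chart_at A p"
  obtain b :: "real^'n \<Rightarrow> real" and K where b: "smooth_on UNIV b" "closed K" "K \<subseteq> fst ?c"
    "\<And>q. q \<in> fst ?c \<Longrightarrow> q \<notin> K \<Longrightarrow> b (snd ?c q) = 0" "b (snd ?c p) > 0"
    using exists_bump[OF chart_at_atlas chart_at_mem] by blast
  have c: "?c \<in> A" "p \<in> fst ?c" by (auto simp: chart_at_atlas chart_at_mem)
  define B where "B = (\<lambda>q. if q \<in> fst ?c then b (snd ?c q) else 0)"
  define u where "u = (\<lambda>i q. if q \<in> fst ?c then b (snd ?c q) * (vfield_in_chart A ?c Z (snd ?c q) \<bullet> i) else 0)"
  define E where "E = (\<lambda>i q. if q \<in> fst ?c then from_components ?c q (b (snd ?c q) *\<^sub>R i) else 0)"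
  have B: "smooth_fun A B"
    unfolding B_def by (rule smooth_fun_extend_zero[OF c(1) b(2,3) smooth_on_subset[OF b(1)] b(4)]) auto
  have u: "smooth_fun A (u i)" for i
    unfolding u_def
    by (rule smooth_fun_extend_zero[OF c(1) b(2,3)])
      (auto simp: b(4) intro!: smooth_on_mult smooth_on_inner smooth_on_const open_chart_img[OF c(1)]
        smooth_on_subset[OF b(1)] smooth_vfieldD[OF Z c(1)])
  have E: "smooth_vfield A (E i)" for i
    unfolding E_def
    by (rule smooth_vfield_extend_zero[OF c(1) b(2,3)])
      (auto simp: b(4) intro!: smooth_on_scaleR smooth_on_const open_chart_img[OF c(1)] smooth_on_subset[OF b(1)])
  have "(\<lambda>q. (B q * B q) *\<^sub>R Z q) = (\<lambda>q. \<Sum>i\<in>Basis. u i q *\<^sub>R E i q)"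
  proof
    fix q
    show "(B q * B q) *\<^sub>R Z q = (\<Sum>i\<in>Basis. u i q *\<^sub>R E i q)"
    proof (cases "q \<in> fst ?c")
      case True
      have "Z q = from_components ?c q (\<Sum>i\<in>Basis. (vfield_in_chart A ?c Z (snd ?c q) \<bullet> i) *\<^sub>R i)"
        using True c by (simp add: euclidean_representation vfield_in_chart_def chart_inv_chart
            from_components_components)
      also have "\<dots> = (\<Sum>i\<in>Basis. (vfield_in_chart A ?c Z (snd ?c q) \<bullet> i) *\<^sub>R from_components ?c q i)"
        using linear_from_components[OF c(1) True] by (simp add: linear_sum linear_scale)
      finally show ?thesis
        using True linear_from_components[OF c(1) True]
        by (simp add: B_def u_def E_def scaleR_sum_right linear_scale ac_simps)
    qed (simp add: B_def u_def)
  qed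
  then have "(B p * B p) *\<^sub>R \<alpha> Z = \<alpha> (\<lambda>q. \<Sum>i\<in>Basis. u i q *\<^sub>R E i q)"
    using scale[OF smooth_fun_mult[OF B B] Z] by metis
  also have "\<dots> = (\<Sum>i\<in>Basis. \<alpha> (\<lambda>q. u i q *\<^sub>R E i q))"
    by (rule sum_tensorial[where p = p]) (auto intro: add scale smooth_vfield_scaleR u E)
  also have "\<dots> = (\<Sum>i\<in>Basis. u i p *\<^sub>R \<alpha> (E i))"
    using scale[OF u E] by simp
  also have "\<dots> = 0"
    using c Z0 linear_0[OF linear_components[OF c]] by (simp add: u_def vfield_in_chart_def chart_inv_chart)
  finally show ?thesis using b(5) c by (simp add: B_def)
qed

lemma tensorial_cong:
  fixes \<alpha> :: "('m, 'n) vfield \<Rightarrow> 'b::real_vector"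
  assumes add: "\<And>X Y. smooth_vfield A X \<Longrightarrow> smooth_vfield A Y \<Longrightarrow> \<alpha> (\<lambda>q. X q + Y q) = \<alpha> X + \<alpha> Y"
    and scale: "\<And>f X. smooth_fun A f \<Longrightarrow> smooth_vfield A X \<Longrightarrow> \<alpha> (\<lambda>q. f q *\<^sub>R X q) = f p *\<^sub>R \<alpha> X"
    and X: "smooth_vfield A X" and Y: "smooth_vfield A Y" and eq: "X p = Y p"
  shows "\<alpha> X = \<alpha> Y"
proof -
  have "\<alpha> (\<lambda>q. X q - Y q) = 0"
    by (rule tensorial_zero[OF add scale]) (use X Y eq in auto)
  then show ?thesis
    using add[of "\<lambda>q. X q - Y q" Y] X Y by simp
qed

lemma tensorial_linear:
  fixes \<alpha> :: "('m, 'n) vfield \<Rightarrow> 'b::real_vector"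
  assumes add: "\<And>X Y. smooth_vfield A X \<Longrightarrow> smooth_vfield A Y \<Longrightarrow> \<alpha> (\<lambda>q. X q + Y q) = \<alpha> X + \<alpha> Y"
    and scale: "\<And>f X. smooth_fun A f \<Longrightarrow> smooth_vfield A X \<Longrightarrow> \<alpha> (\<lambda>q. f q *\<^sub>R X q) = f p *\<^sub>R \<alpha> X"
  shows "linear (\<lambda>v. \<alpha> (extend_vector A p v))"
proof (rule linearI)
  fix v w :: "real^'n" and r :: real
  have "\<alpha> (extend_vector A p (v + w)) = \<alpha> (\<lambda>q. extend_vector A p v q + extend_vector A p w q)"
    by (rule tensorial_cong[OF add scale]) (auto simp: extend_vector)
  then show "\<alpha> (extend_vector A p (v + w)) = \<alpha> (extend_vector A p v) + \<alpha> (extend_vector A p w)"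
    by (simp add: add extend_vector)
  have "\<alpha> (extend_vector A p (r *\<^sub>R v)) = \<alpha> (\<lambda>q. r *\<^sub>R extend_vector A p v q)"
    by (rule tensorial_cong[OF add scale]) (auto simp: extend_vector)
  then show "\<alpha> (extend_vector A p (r *\<^sub>R v)) = r *\<^sub>R \<alpha> (extend_vector A p v)"
    using scale[OF smooth_fun_const extend_vector(1)] by simp
qed

lemma exists_local_frame:
  obtains E :: "'n \<Rightarrow> ('m, 'n) vfield" where "\<And>i. smooth_vfield A (E i)"
    "\<And>v. \<exists>x. v = (\<Sum>i\<in>UNIV. (x $ i) *\<^sub>R E i p)"
proof -
  let ?E = "\<lambda>i. extend_vector A p (axis i (1::real))"
  have "v = (\<Sum>i\<in>UNIV. (v $ i) *\<^sub>R ?E i p)" for v :: "real^'n"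
    using basis_expansion[of v] by (simp add: extend_vector scalar_mult_eq_scaleR)
  then show ?thesis using that[of ?E] extend_vector(1) by blast
qed

end

section \<open>The Levi-Civita connection\<close>

locale semi_riemannian_manifold = smooth_manifold A
  for A :: "('m::{t2_space,second_countable_topology}, 'n::finite) chart set" +
  fixes g :: "'m \<Rightarrow> real^'n \<Rightarrow> real^'n \<Rightarrow> real"
  assumes metric: "semi_riemannian_metric A g"
begin

lemma bilinear_metric: "bilinear (g p)"
  and metric_sym: "g p v w = g p w v"
  and metric_nondegenerate: "(\<And>w. g p v w = 0) \<Longrightarrow> v = 0"
  using metric unfolding semi_riemannian_metric_def by metis+

lemma smooth_fun_metric [simp]:
  "smooth_vfield A X \<Longrightarrow> smooth_vfield A Y \<Longrightarrow> smooth_fun A (\<lambda>p. g p (X p) (Y p))"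
  using metric by (auto simp: semi_riemannian_metric_def)

lemma metric_simps:
  "g p (u + v) w = g p u w + g p v w" "g p u (v + w) = g p u v + g p u w"
  "g p (u - v) w = g p u w - g p v w" "g p u (v - w) = g p u v - g p u w"
  "g p (- v) w = - g p v w" "g p v (- w) = - g p v w"
  "g p (k *\<^sub>R v) w = k * g p v w" "g p v (k *\<^sub>R w) = k * g p v w"
  "g p 0 w = 0" "g p v 0 = 0"
  using bilinear_metric[of p]
  by (auto simp: bilinear_ladd bilinear_radd bilinear_lsub bilinear_rsub bilinear_lneg bilinear_rneg
      bilinear_lmul bilinear_rmul bilinear_lzero bilinear_rzero)

lemma metric_sum_left: "g p (\<Sum>i\<in>I. x i) w = (\<Sum>i\<in>I. g p (x i) w)"
  by (induction I rule: infinite_finite_induct) (auto simp: metric_simps)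

lemma metric_eqI: "(\<And>w. g p u w = g p v w) \<Longrightarrow> u = v"
  using metric_nondegenerate[of p "u - v"] by (simp add: metric_simps)

lemma metric_eqI_field:
  assumes "\<And>Z. smooth_vfield A Z \<Longrightarrow> g p u (Z p) = g p v (Z p)"
  shows "u = v"
proof (rule metric_eqI)
  show "g p u w = g p v w" for w
    using assms[OF extend_vector(1)[of p w]] by (simp add: extend_vector(2))
qed

lemma field_eqI:
  "(\<And>Z p. smooth_vfield A Z \<Longrightarrow> g p (X p) (Z p) = g p (Y p) (Z p)) \<Longrightarrow> X = Y"
  by (rule ext) (rule metric_eqI_field)

text \<open>Nondegeneracy is injectivity of the map from vectors to covectors, and equality of
  dimensions gives surjectivity.\<close>

lemma metric_represents:
  assumes "linear h"
  obtains x where "\<And>w. g p x w = h w"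
proof -
  let ?T = "\<lambda>v. \<Sum>b\<in>Basis. g p v b *\<^sub>R (b :: real^'n)"
  have lin: "linear ?T"
    by (rule linearI) (auto simp: metric_simps scaleR_add_left sum.distrib scaleR_sum_right)
  have inj: "x = y" if "?T x = ?T y" for x y
  proof (rule metric_eqI)
    fix w
    have "g p x b = g p y b" if "b \<in> Basis" for b
      using arg_cong[OF \<open>?T x = ?T y\<close>, of "\<lambda>v. v \<bullet> b"] that by (simp add: inner_sum_left_Basis)
    moreover have "linear (g p x)" "linear (g p y)"
      using bilinear_metric[of p] by (auto simp: bilinear_def)
    ultimately show "g p x w = g p y w"
      by (simp add: linear_Basis_sum[of "g p x" w] linear_Basis_sum[of "g p y" w])
  qed
  then have "inj ?T" by (rule injI)
  with lin have "surj ?T" by (rule linear_injective_imp_surjective) (rule refl)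
  from surjD[OF this, of "\<Sum>b\<in>Basis. h b *\<^sub>R b"]
  obtain x where x: "?T x = (\<Sum>b\<in>Basis. h b *\<^sub>R b)" by (elim exE) (erule that[OF sym])
  have "g p x w = h w" for w
  proof -
    have "g p x b = h b" if "b \<in> Basis" for b
      using arg_cong[OF x, of "\<lambda>v. v \<bullet> b"] that by (simp add: inner_sum_left_Basis)
    moreover have "linear (g p x)"
      using bilinear_metric[of p] by (auto simp: bilinear_def)
    ultimately show ?thesis
      by (simp add: linear_Basis_sum[of "g p x" w] linear_Basis_sum[OF assms, of w])
  qed
  then show ?thesis by (rule that)
qed

text \<open>The Gram matrix applied to coefficients lists the products of the combination with the
  frame. Spanning thus becomes nonvanishing of a function that is smooth for smooth fields.\<close>

lemma gram_det_nonzero_iff: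
  fixes e :: "'n \<Rightarrow> real^'n" and p :: 'm
  defines "G \<equiv> (\<chi> i j. g p (e j) (e i))"
  shows "det G \<noteq> 0 \<longleftrightarrow> (\<forall>v. \<exists>x. v = (\<Sum>i\<in>UNIV. (x $ i) *\<^sub>R e i))"
proof -
  let ?L = "\<lambda>x :: real^'n. \<Sum>i\<in>UNIV. (x $ i) *\<^sub>R e i"
  have lin: "linear ?L"
    by (rule linearI) (auto simp: scaleR_add_left sum.distrib scaleR_sum_right)
  have G: "(G *v x) $ i = g p (?L x) (e i)" for x i
    by (simp add: G_def matrix_vector_mult_def metric_sum_left metric_simps mult.commute)
  show ?thesis
  proof
    assume det: "det G \<noteq> 0"
    have "x = 0" if "?L x = 0" for x
    proof -
      have "G *v x = 0" by (simp add: vec_eq_iff G that metric_simps)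
      then show ?thesis
        using det by (metis invertible_det_nz invertible_left_inverse matrix_left_invertible_ker)
    qed
    then have "surj ?L"
      using lin by (intro linear_injective_imp_surjective) (auto simp: linear_injective_0)
    then show "\<forall>v. \<exists>x. v = ?L x" unfolding surj_def .
  next
    assume span: "\<forall>v. \<exists>x. v = ?L x"
    then have "surj ?L" unfolding surj_def .
    with lin have inj: "inj ?L" by (rule linear_surjective_imp_injective) simp_all
    have "x = 0" if "G *v x = 0" for x
    proof -
      have "g p (?L x) w = 0" for w
      proof -
        obtain y where y: "w = ?L y" using span by blast
        have "g p (?L x) (e i) = 0" for i using that G[of x i] by simp
        then have "g p (e i) (?L x) = 0" for i by (metis metric_sym)
        then have "g p (?L y) (?L x) = 0" by (subst metric_sum_left) (simp add: metric_simps)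
        then show ?thesis unfolding y by (subst metric_sym)
      qed
      then have "?L x = 0" by (rule metric_nondegenerate)
      then show ?thesis using inj lin by (simp add: linear_injective_0)
    qed
    then show "det G \<noteq> 0"
      by (metis invertible_det_nz invertible_left_inverse matrix_left_invertible_ker)
  qed
qed

text \<open>Smoothness follows from Cramer's rule in a local frame \<open>E\<close>. The determinant occurs squared
  in \<open>h\<close> so that the identity for \<open>h X\<close> also holds where \<open>E\<close> degenerates.\<close>

lemma exists_sharp:
  fixes \<alpha> :: "('m, 'n) vfield \<Rightarrow> 'm \<Rightarrow> real"
  assumes smooth: "\<And>Z. smooth_vfield A Z \<Longrightarrow> smooth_fun A (\<alpha> Z)"
    and add: "\<And>Y Z p. smooth_vfield A Y \<Longrightarrow> smooth_vfield A Z \<Longrightarrow> \<alpha> (\<lambda>q. Y q + Z q) p = \<alpha> Y p + \<alpha> Z p"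
    and scale: "\<And>f Z p. smooth_fun A f \<Longrightarrow> smooth_vfield A Z \<Longrightarrow> \<alpha> (\<lambda>q. f q *\<^sub>R Z q) p = f p * \<alpha> Z p"
  shows "\<exists>X. smooth_vfield A X \<and> (\<forall>Z p. smooth_vfield A Z \<longrightarrow> g p (X p) (Z p) = \<alpha> Z p)"
proof -
  have "\<exists>x. \<forall>w. g p x w = \<alpha> (extend_vector A p w) p" for p
  proof -
    have "linear (\<lambda>w. \<alpha> (extend_vector A p w) p)"
      by (rule tensorial_linear) (simp_all add: add scale)
    then show ?thesis by (metis metric_represents)
  qed
  then obtain X where X0: "g p (X p) w = \<alpha> (extend_vector A p w) p" for p w by metis
  have X: "g p (X p) (Z p) = \<alpha> Z p" if Z: "smooth_vfield A Z" for Z p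
    unfolding X0 by (rule tensorial_cong[of "\<lambda>Z. \<alpha> Z p" p]) (simp_all add: add scale extend_vector Z)
  have "smooth_vfield A X"
  proof (rule smooth_vfield_divide_local)
    fix p
    obtain E :: "'n \<Rightarrow> ('m, 'n) vfield" where E: "\<And>i. smooth_vfield A (E i)"
      and span: "\<And>v. \<exists>x. v = (\<Sum>i\<in>UNIV. (x $ i) *\<^sub>R E i p)"
      using exists_local_frame by blast
    define G :: "'m \<Rightarrow> real^'n^'n" where "G = (\<lambda>q. \<chi> i j. g q (E j q) (E i q))"
    define M :: "'n \<Rightarrow> 'm \<Rightarrow> real^'n^'n" where
      "M = (\<lambda>k q. \<chi> i j. if j = k then \<alpha> (E i) q else G q $ i $ j)"
    define h where "h = (\<lambda>q. det (G q) * det (G q))"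
    have G: "smooth_fun A (\<lambda>q. det (G q))"
      by (rule smooth_fun_det) (simp add: G_def E)
    have M: "smooth_fun A (\<lambda>q. det (M k q))" for k
    proof (rule smooth_fun_det)
      show "smooth_fun A (\<lambda>q. M k q $ i $ j)" for i j
        using smooth[OF E[of i]] by (cases "j = k") (simp_all add: M_def G_def E)
    qed
    have "h q *\<^sub>R X q = (\<Sum>k\<in>UNIV. (det (G q) * det (M k q)) *\<^sub>R E k q)" for q
    proof (cases "det (G q) = 0")
      case False
      then obtain x where x: "X q = (\<Sum>k\<in>UNIV. (x $ k) *\<^sub>R E k q)"
        using gram_det_nonzero_iff[of q "\<lambda>i. E i q"] by (auto simp: G_def)
      have "(G q *v x) $ i = \<alpha> (E i) q" for i
        using X[OF E, of q i] x
        by (simp add: G_def matrix_vector_mult_def metric_sum_left metric_simps mult.commute)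
      then have "G q *v x = (\<chi> i. \<alpha> (E i) q)" by (simp add: vec_eq_iff)
      then have "x = (\<chi> k. det (\<chi> i j. if j = k then (\<chi> i. \<alpha> (E i) q) $ i else G q $ i $ j) / det (G q))"
        using cramer[OF False] by blast
      then have "x $ k = det (M k q) / det (G q)" for k
        by (simp add: M_def cong: if_cong)
      then show ?thesis using False by (simp add: x h_def scaleR_sum_right)
    qed (simp add: h_def)
    then have "smooth_vfield A (\<lambda>q. h q *\<^sub>R X q)"
      using G M E by (simp add: smooth_vfield_sum)
    moreover have "smooth_fun A h" using G by (simp add: h_def)
    moreover have "h p \<noteq> 0"
      using span gram_det_nonzero_iff[of p "\<lambda>i. E i p"] by (simp add: h_def G_def)
    ultimately show "\<exists>h. smooth_fun A h \<and> smooth_vfield A (\<lambda>q. h q *\<^sub>R X q) \<and> h p \<noteq> 0" by blast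
  qed
  then show ?thesis using X by blast
qed

section \<open>The Koszul formula\<close>

definition koszul :: "('m, 'n) vfield \<Rightarrow> ('m, 'n) vfield \<Rightarrow> ('m, 'n) vfield \<Rightarrow> 'm \<Rightarrow> real" where
  "koszul X Y Z p = (1/2) * (vderiv A X (\<lambda>q. g q (Y q) (Z q)) p + vderiv A Y (\<lambda>q. g q (X q) (Z q)) p
     - vderiv A Z (\<lambda>q. g q (X q) (Y q)) p + g p (lie_bracket A X Y p) (Z p)
     - g p (lie_bracket A X Z p) (Y p) - g p (lie_bracket A Y Z p) (X p))"

lemmas field_calculus =
  vderiv_add_field vderiv_diff_field vderiv_scaleR_field vderiv_uminus_field vderiv_zero_field
  vderiv_add vderiv_diff vderiv_mult vderiv_uminus
  lie_bracket_add_left lie_bracket_add_right lie_bracket_scaleR_left lie_bracket_scaleR_right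

text \<open>Tensoriality in Z: when Z is multiplied by f, the derivatives of f from the first two
  metric terms cancel those from the two brackets with Z.\<close>

lemma exists_koszul_field:
  assumes "smooth_vfield A X" "smooth_vfield A Y"
  shows "\<exists>W. smooth_vfield A W \<and> (\<forall>Z p. smooth_vfield A Z \<longrightarrow> g p (W p) (Z p) = koszul X Y Z p)"
proof (rule exists_sharp)
  show "smooth_fun A (koszul X Y Z)" if "smooth_vfield A Z" for Z
    using that assms by (simp add: koszul_def[abs_def])
  fix U V p
  assume U: "smooth_vfield A U"
  {
    assume V: "smooth_vfield A V"
    show "koszul X Y (\<lambda>q. U q + V q) p = koszul X Y U p + koszul X Y V p"
      by (simp add: koszul_def vderiv_add_field vderiv_add lie_bracket_add_right metric_simps assms U V algebra_simps)
  next
    fix f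
    assume f: "smooth_fun A f"
    show "koszul X Y (\<lambda>q. f q *\<^sub>R U q) p = f p * koszul X Y U p"
      by (simp add: koszul_def vderiv_scaleR_field vderiv_mult lie_bracket_scaleR_right metric_simps metric_sym assms U f algebra_simps)
  }
qed

lemma exists_levi_civita: "\<exists>D. is_levi_civita A g D"
proof -
  obtain D where D: "\<And>X Y. smooth_vfield A X \<Longrightarrow> smooth_vfield A Y \<Longrightarrow> smooth_vfield A (D X Y) \<and>
      (\<forall>Z p. smooth_vfield A Z \<longrightarrow> g p (D X Y p) (Z p) = koszul X Y Z p)"
    using exists_koszul_field by metis
  have smooth: "smooth_vfield A (D X Y)" if "smooth_vfield A X" "smooth_vfield A Y" for X Y
    using D that by blast
  have gD: "g p (D X Y p) (Z p) = koszul X Y Z p"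
    if "smooth_vfield A X" "smooth_vfield A Y" "smooth_vfield A Z" for X Y Z p
    using D that by blast
  have "is_levi_civita A g D"
    unfolding is_levi_civita_def
  proof (intro allI impI conjI)
    fix X Y Z f
    assume s [simp]: "smooth_vfield A X" "smooth_vfield A Y" "smooth_vfield A Z" "smooth_fun A f"
    show "smooth_vfield A (D X Y)" by (simp add: smooth)
    show "D (\<lambda>p. X p + Y p) Z = (\<lambda>p. D X Z p + D Y Z p)"
      by (rule field_eqI) (simp add: metric_simps gD, simp add: koszul_def field_calculus metric_simps field_simps)
    show "D (\<lambda>p. f p *\<^sub>R X p) Y = (\<lambda>p. f p *\<^sub>R D X Y p)"
      by (rule field_eqI) (simp add: metric_simps gD, simp add: koszul_def field_calculus metric_simps metric_sym field_simps)
    show "D X (\<lambda>p. Y p + Z p) = (\<lambda>p. D X Y p + D X Z p)"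
      by (rule field_eqI) (simp add: metric_simps gD, simp add: koszul_def field_calculus metric_simps field_simps)
    show "D X (\<lambda>p. f p *\<^sub>R Y p) = (\<lambda>p. vderiv A X f p *\<^sub>R Y p + f p *\<^sub>R D X Y p)"
      by (rule field_eqI) (simp add: metric_simps gD, simp add: koszul_def field_calculus metric_simps metric_sym field_simps)
    show "(\<lambda>p. D X Y p - D Y X p) = lie_bracket A X Y"
      by (rule field_eqI)
        (simp add: metric_simps gD, simp add: koszul_def lie_bracket_antisym[of Y X] metric_simps metric_sym field_simps)
    show "vderiv A X (\<lambda>p. g p (Y p) (Z p)) = (\<lambda>p. g p (D X Y p) (Z p) + g p (Y p) (D X Z p))"
      by (simp add: gD metric_sym[of _ "Y _" "D X Z _"] fun_eq_iff,
          simp add: koszul_def lie_bracket_antisym[of Z Y] metric_simps metric_sym field_simps)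
  qed
  then show ?thesis by blast
qed

abbreviation D :: "('m, 'n) vfield \<Rightarrow> ('m, 'n) vfield \<Rightarrow> ('m, 'n) vfield" where
  "D \<equiv> levi_civita A g"

lemma is_levi_civita: "is_levi_civita A g D"
  unfolding levi_civita_def by (rule someI_ex[OF exists_levi_civita])

lemmas levi_civita_properties = is_levi_civita[unfolded is_levi_civita_def, rule_format]

lemma smooth_vfield_D [simp]: "smooth_vfield A X \<Longrightarrow> smooth_vfield A Y \<Longrightarrow> smooth_vfield A (D X Y)"
  and D_add_left: "smooth_vfield A X \<Longrightarrow> smooth_vfield A Y \<Longrightarrow> smooth_vfield A Z \<Longrightarrow>
    D (\<lambda>p. X p + Y p) Z = (\<lambda>p. D X Z p + D Y Z p)"
  and D_scaleR_left: "smooth_vfield A X \<Longrightarrow> smooth_vfield A Y \<Longrightarrow> smooth_fun A f \<Longrightarrow>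
    D (\<lambda>p. f p *\<^sub>R X p) Y = (\<lambda>p. f p *\<^sub>R D X Y p)"
  and D_add_right: "smooth_vfield A X \<Longrightarrow> smooth_vfield A Y \<Longrightarrow> smooth_vfield A Z \<Longrightarrow>
    D X (\<lambda>p. Y p + Z p) = (\<lambda>p. D X Y p + D X Z p)"
  and D_scaleR_right: "smooth_vfield A X \<Longrightarrow> smooth_vfield A Y \<Longrightarrow> smooth_fun A f \<Longrightarrow>
    D X (\<lambda>p. f p *\<^sub>R Y p) = (\<lambda>p. vderiv A X f p *\<^sub>R Y p + f p *\<^sub>R D X Y p)"
  and lie_bracket_eq_D: "smooth_vfield A X \<Longrightarrow> smooth_vfield A Y \<Longrightarrow>
    lie_bracket A X Y = (\<lambda>p. D X Y p - D Y X p)"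
  and vderiv_metric: "smooth_vfield A X \<Longrightarrow> smooth_vfield A Y \<Longrightarrow> smooth_vfield A Z \<Longrightarrow>
    vderiv A X (\<lambda>p. g p (Y p) (Z p)) = (\<lambda>p. g p (D X Y p) (Z p) + g p (Y p) (D X Z p))"
  using levi_civita_properties[of X Y X "\<lambda>p. 0"] levi_civita_properties[of X Y Z "\<lambda>p. 0"]
    levi_civita_properties[of X Y X f] by auto

lemma D_uminus_left: "smooth_vfield A X \<Longrightarrow> smooth_vfield A Y \<Longrightarrow> D (\<lambda>p. - X p) Y = (\<lambda>p. - D X Y p)"
  using D_scaleR_left[of X Y "\<lambda>p. -1"] by simp

lemma D_uminus_right: "smooth_vfield A X \<Longrightarrow> smooth_vfield A Y \<Longrightarrow> D X (\<lambda>p. - Y p) = (\<lambda>p. - D X Y p)"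
  using D_scaleR_right[of X Y "\<lambda>p. -1"] by simp

lemma D_diff_left: "smooth_vfield A X \<Longrightarrow> smooth_vfield A Y \<Longrightarrow> smooth_vfield A Z \<Longrightarrow>
    D (\<lambda>p. X p - Y p) Z = (\<lambda>p. D X Z p - D Y Z p)"
  using D_add_left[of X "\<lambda>p. - Y p" Z] by (simp add: D_uminus_left)

lemma D_diff_right: "smooth_vfield A X \<Longrightarrow> smooth_vfield A Y \<Longrightarrow> smooth_vfield A Z \<Longrightarrow>
    D X (\<lambda>p. Y p - Z p) = (\<lambda>p. D X Y p - D X Z p)"
  using D_add_right[of X Y "\<lambda>p. - Z p"] by (simp add: D_uminus_right)

lemmas D_calculus = D_add_left D_add_right D_diff_left D_diff_right D_uminus_left D_uminus_right
  D_scaleR_left D_scaleR_right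

section \<open>Curvature\<close>

abbreviation R :: "('m, 'n) vfield \<Rightarrow> ('m, 'n) vfield \<Rightarrow> ('m, 'n) vfield \<Rightarrow> ('m, 'n) vfield" where
  "R \<equiv> curvature A g"

lemma curvature_eq: "R X Y Z = (\<lambda>p. D X (D Y Z) p - D Y (D X Z) p - D (lie_bracket A X Y) Z p)"
  by (simp add: curvature_def Let_def fun_eq_iff)

lemma smooth_vfield_curvature [simp]:
  "smooth_vfield A X \<Longrightarrow> smooth_vfield A Y \<Longrightarrow> smooth_vfield A Z \<Longrightarrow> smooth_vfield A (R X Y Z)"
  by (simp add: curvature_eq)

lemma curvature_add:
  assumes "smooth_vfield A X" "smooth_vfield A X'" "smooth_vfield A Y" "smooth_vfield A Z"
  shows "R (\<lambda>q. X q + X' q) Y Z p = R X Y Z p + R X' Y Z p"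
    "R Y (\<lambda>q. X q + X' q) Z p = R Y X Z p + R Y X' Z p"
    "R Y Z (\<lambda>q. X q + X' q) p = R Y Z X p + R Y Z X' p"
  using assms
  by (simp_all add: curvature_eq D_calculus field_calculus algebra_simps)

text \<open>In the third slot the second derivatives of f enter as a commutator along the first two
  fields, which the term with their bracket removes.\<close>

lemma curvature_scaleR:
  assumes "smooth_vfield A X" "smooth_vfield A Y" "smooth_vfield A Z" "smooth_fun A f"
  shows "R (\<lambda>q. f q *\<^sub>R X q) Y Z p = f p *\<^sub>R R X Y Z p"
    "R Y (\<lambda>q. f q *\<^sub>R X q) Z p = f p *\<^sub>R R Y X Z p"
    "R Y Z (\<lambda>q. f q *\<^sub>R X q) p = f p *\<^sub>R R Y Z X p"
  using assms
  by (simp_all add: curvature_eq D_calculus field_calculus vderiv_lie_bracket algebra_simps)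

lemma curvature_cong:
  assumes "smooth_vfield A X" "smooth_vfield A Y" "smooth_vfield A Z"
    "smooth_vfield A X'" "smooth_vfield A Y'" "smooth_vfield A Z'" "X p = X' p" "Y p = Y' p" "Z p = Z' p"
  shows "R X Y Z p = R X' Y' Z' p"
proof -
  have "R X Y Z p = R X' Y Z p"
    by (rule tensorial_cong[of "\<lambda>X. R X Y Z p" p]) (simp_all add: curvature_add curvature_scaleR assms)
  also have "\<dots> = R X' Y' Z p"
    by (rule tensorial_cong[of "\<lambda>Y. R X' Y Z p" p]) (simp_all add: curvature_add curvature_scaleR assms)
  also have "\<dots> = R X' Y' Z' p"
    by (rule tensorial_cong[of "\<lambda>Z. R X' Y' Z p" p]) (simp_all add: curvature_add curvature_scaleR assms)
  finally show ?thesis .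
qed

lemma curvature_at_eq:
  "smooth_vfield A X \<Longrightarrow> smooth_vfield A Y \<Longrightarrow> smooth_vfield A Z \<Longrightarrow>
    curvature_at A g p (X p) (Y p) (Z p) = R X Y Z p"
  unfolding curvature_at_def by (rule curvature_cong) (simp_all add: extend_vector)

lemma curvature_antisym:
  "smooth_vfield A X \<Longrightarrow> smooth_vfield A Y \<Longrightarrow> smooth_vfield A Z \<Longrightarrow> R X Y Z p = - R Y X Z p"
  by (simp add: curvature_eq lie_bracket_antisym[of X Y] D_uminus_left)

text \<open>Differentiates g(Z, W) along the bracket of X and Y in two ways: as a commutator of
  derivations and directly by metric compatibility.\<close>

lemma curvature_metric_antisym:
  assumes "smooth_vfield A X" "smooth_vfield A Y" "smooth_vfield A Z" "smooth_vfield A W"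
  shows "g p (R X Y Z p) (W p) = - g p (R X Y W p) (Z p)"
proof -
  have "vderiv A (lie_bracket A X Y) (\<lambda>q. g q (Z q) (W q)) p =
      g p (D X (D Y Z) p) (W p) + g p (Z p) (D X (D Y W) p)
    - g p (D Y (D X Z) p) (W p) - g p (Z p) (D Y (D X W) p)"
    using assms by (subst vderiv_lie_bracket) (simp_all add: vderiv_metric vderiv_add)
  moreover have "vderiv A (lie_bracket A X Y) (\<lambda>q. g q (Z q) (W q)) p =
      g p (D (lie_bracket A X Y) Z p) (W p) + g p (Z p) (D (lie_bracket A X Y) W p)"
    using assms by (simp add: vderiv_metric)
  ultimately show ?thesis
    by (simp add: curvature_eq metric_simps metric_sym[of p "Z p"])
qed

text \<open>Absence of torsion turns the cyclic sum into a sum of double brackets, which is zero by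
  Jacobi.\<close>

lemma first_bianchi:
  assumes "smooth_vfield A X" "smooth_vfield A Y" "smooth_vfield A Z"
  shows "R X Y Z p + R Y Z X p + R Z X Y p = 0"
proof -
  have *: "D U (D V W) p - D U (D W V) p - D (lie_bracket A V W) U p = lie_bracket A U (lie_bracket A V W) p"
    if "smooth_vfield A U" "smooth_vfield A V" "smooth_vfield A W" for U V W
    using that lie_bracket_eq_D[of U "lie_bracket A V W"]
    by (simp add: lie_bracket_eq_D[of V W] D_diff_right)
  have anti: "lie_bracket A (lie_bracket A V W) U p = - lie_bracket A U (lie_bracket A V W) p"
    if "smooth_vfield A U" "smooth_vfield A V" "smooth_vfield A W" for U V W
    by (rule fun_cong[OF lie_bracket_antisym]) (simp_all add: that)
  have "lie_bracket A X (lie_bracket A Y Z) p + lie_bracket A Y (lie_bracket A Z X) p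
      + lie_bracket A Z (lie_bracket A X Y) p = 0"
    using lie_bracket_jacobi_cyclic[OF assms, of p]
    unfolding anti[OF assms] anti[OF assms(2,3,1)] anti[OF assms(3,1,2)]
    by (simp add: add_eq_0_iff algebra_simps)
  then show ?thesis
    using *[OF assms] *[OF assms(2,3,1)] *[OF assms(3,1,2)]
    by (simp add: curvature_eq algebra_simps)
qed

text \<open>Absence of torsion merges the derivatives in the first two slots of R into brackets, so
  no covariant derivative of a tensor has to be introduced. In the expansion the triple derivatives
  cancel and the rest is \<open>D\<close> along the Jacobi sum.\<close>

lemma second_bianchi:
  assumes "smooth_vfield A X" "smooth_vfield A Y" "smooth_vfield A Z" "smooth_vfield A W"
  shows "(D X (R Y Z W) p - R Y Z (D X W) p) + (D Y (R Z X W) p - R Z X (D Y W) p)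
      + (D Z (R X Y W) p - R X Y (D Z W) p)
    = R (lie_bracket A X Y) Z W p + R (lie_bracket A Y Z) X W p + R (lie_bracket A Z X) Y W p"
proof -
  let ?J = "\<lambda>p. (lie_bracket A (lie_bracket A X Y) Z p + lie_bracket A (lie_bracket A Y Z) X p)
    + lie_bracket A (lie_bracket A Z X) Y p"
  \<comment> \<open>Writing zero as a multiple of X makes \<open>D_scaleR_left\<close>
    applicable.\<close>
  have "?J = (\<lambda>p. 0 *\<^sub>R X p)" using lie_bracket_jacobi_cyclic[OF assms(1-3)] by auto
  then have "D ?J W p = 0"
    using D_scaleR_left[of X W "\<lambda>p. 0"] assms by simp
  then have "D (lie_bracket A (lie_bracket A X Y) Z) W p + D (lie_bracket A (lie_bracket A Y Z) X) W p
      + D (lie_bracket A (lie_bracket A Z X) Y) W p = 0"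
    using assms by (simp add: D_add_left)
  then show ?thesis
    using assms by (simp add: curvature_eq D_calculus algebra_simps)
qed

lemma curvature_at_add:
  "curvature_at A g p (x + x') y z = curvature_at A g p x y z + curvature_at A g p x' y z"
  "curvature_at A g p y (x + x') z = curvature_at A g p y x z + curvature_at A g p y x' z"
  "curvature_at A g p y z (x + x') = curvature_at A g p y z x + curvature_at A g p y z x'"
proof -
  let ?E = "extend_vector A p"
  have [simp]: "smooth_vfield A (?E v)" "?E v p = v" for v by (simp_all add: extend_vector)
  have S: "smooth_vfield A (\<lambda>q. ?E x q + ?E x' q)" by simp
  show "curvature_at A g p (x + x') y z = curvature_at A g p x y z + curvature_at A g p x' y z"
    using curvature_at_eq[OF S, of "?E y" "?E z" p] curvature_at_eq[of "?E _" "?E y" "?E z" p]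
    by (simp add: curvature_add)
  show "curvature_at A g p y (x + x') z = curvature_at A g p y x z + curvature_at A g p y x' z"
    using curvature_at_eq[OF _ S, of "?E y" "?E z" p] curvature_at_eq[of "?E y" "?E _" "?E z" p]
    by (simp add: curvature_add)
  show "curvature_at A g p y z (x + x') = curvature_at A g p y z x + curvature_at A g p y z x'"
    using curvature_at_eq[OF _ _ S, of "?E y" "?E z" p] curvature_at_eq[of "?E y" "?E z" "?E _" p]
    by (simp add: curvature_add)
qed

lemma curvature_at_scaleR:
  "curvature_at A g p (k *\<^sub>R x) y z = k *\<^sub>R curvature_at A g p x y z"
  "curvature_at A g p y (k *\<^sub>R x) z = k *\<^sub>R curvature_at A g p y x z"
  "curvature_at A g p y z (k *\<^sub>R x) = k *\<^sub>R curvature_at A g p y z x"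
proof -
  let ?E = "extend_vector A p"
  have [simp]: "smooth_vfield A (?E v)" "?E v p = v" for v by (simp_all add: extend_vector)
  have S: "smooth_vfield A (\<lambda>q. k *\<^sub>R ?E x q)" by simp
  note scale = curvature_scaleR[of "?E _" "?E _" "?E _" "\<lambda>q. k"]
  show "curvature_at A g p (k *\<^sub>R x) y z = k *\<^sub>R curvature_at A g p x y z"
    using curvature_at_eq[OF S, of "?E y" "?E z" p] curvature_at_eq[of "?E _" "?E y" "?E z" p]
    by (simp add: scale)
  show "curvature_at A g p y (k *\<^sub>R x) z = k *\<^sub>R curvature_at A g p y x z"
    using curvature_at_eq[OF _ S, of "?E y" "?E z" p] curvature_at_eq[of "?E y" "?E _" "?E z" p]
    by (simp add: scale)
  show "curvature_at A g p y z (k *\<^sub>R x) = k *\<^sub>R curvature_at A g p y z x"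
    using curvature_at_eq[OF _ _ S, of "?E y" "?E z" p] curvature_at_eq[of "?E y" "?E z" "?E _" p]
    by (simp add: scale)
qed

section \<open>Lie derivatives of the metric\<close>

abbreviation L :: "('m, 'n) vfield \<Rightarrow> ('m, 'n) vfield \<Rightarrow> ('m, 'n) vfield \<Rightarrow> 'm \<Rightarrow> real" where
  "L V \<equiv> lie_deriv_metric A V g"

lemma lie_deriv_metric_eq_D:
  assumes "smooth_vfield A V" "smooth_vfield A X" "smooth_vfield A Y"
  shows "L V X Y p = g p (D X V p) (Y p) + g p (X p) (D Y V p)"
  using assms by (simp add: lie_deriv_metric_def vderiv_metric lie_bracket_eq_D metric_simps)

text \<open>Jacobi and the commutator of derivations, combined to L_[U,W] = [L_U, L_W] on g. Each
  outer Lie derivative acts on a bilinear form other than g and is therefore written out.\<close>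

lemma lie_deriv_metric_commutator:
  assumes "smooth_vfield A U" "smooth_vfield A W" "smooth_vfield A X" "smooth_vfield A Y"
  shows "L (lie_bracket A U W) X Y p =
      (vderiv A U (L W X Y) p - L W (lie_bracket A U X) Y p - L W X (lie_bracket A U Y) p)
    - (vderiv A W (L U X Y) p - L U (lie_bracket A W X) Y p - L U X (lie_bracket A W Y) p)"
proof -
  have jac: "lie_bracket A (lie_bracket A U W) Z p
      = lie_bracket A U (lie_bracket A W Z) p - lie_bracket A W (lie_bracket A U Z) p"
    if "smooth_vfield A Z" for Z
    using fun_cong[OF lie_bracket_jacobi[OF assms(1,2) that], of p] by simp
  show ?thesis
    using assms
    by (simp add: lie_deriv_metric_def[abs_def] vderiv_diff vderiv_lie_bracket jac metric_simps)
qed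

end

section \<open>Para-Kenmotsu manifolds\<close>

locale para_kenmotsu_manifold = semi_riemannian_manifold A g
  for A :: "('m::{t2_space,second_countable_topology}, 'n::finite) chart set" and g +
  fixes phi :: "'m \<Rightarrow> real^'n \<Rightarrow> real^'n" and xi :: "'m \<Rightarrow> real^'n" and eta :: "'m \<Rightarrow> real^'n \<Rightarrow> real"
  assumes para_kenmotsu: "para_kenmotsu A phi xi eta g"
begin

lemma para_kenmotsu_unfold:
  "almost_paracontact A phi xi eta" "normal_structure A phi xi eta"
  "g p (phi p v) (phi p w) = - g p v w + eta p v * eta p w"
  "smooth_vfield A X \<Longrightarrow> smooth_vfield A Y \<Longrightarrow> ext_deriv_1 A eta X Y p = 0"
  "smooth_vfield A X \<Longrightarrow> smooth_vfield A Y \<Longrightarrow> smooth_vfield A Z \<Longrightarrow>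
    ext_deriv_2 A (fundamental_form phi g) X Y Z p
      = 2 * wedge_1_2 eta (fundamental_form phi g) p (X p) (Y p) (Z p)"
  using para_kenmotsu by (auto simp: para_kenmotsu_def almost_paracontact_metric_def)

lemma linear_phi: "linear (phi p)" and linear_eta: "linear (eta p)"
  and smooth_vfield_xi [simp]: "smooth_vfield A xi"
  and smooth_vfield_phi [simp]: "smooth_vfield A X \<Longrightarrow> smooth_vfield A (\<lambda>p. phi p (X p))"
  and smooth_fun_eta [simp]: "smooth_vfield A X \<Longrightarrow> smooth_fun A (\<lambda>p. eta p (X p))"
  and eta_xi [simp]: "eta p (xi p) = 1"
  and phi_phi: "phi p (phi p v) = v - eta p v *\<^sub>R xi p"
  using para_kenmotsu_unfold(1)
  by (auto simp: almost_paracontact_def smooth_endo_field_def smooth_one_form_def)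

lemma eta_simps:
  "eta p (u + v) = eta p u + eta p v" "eta p (u - v) = eta p u - eta p v"
  "eta p (- v) = - eta p v" "eta p (k *\<^sub>R v) = k * eta p v" "eta p 0 = 0"
  using linear_eta[of p] by (simp_all add: linear_add linear_diff linear_neg linear_scale linear_0)

lemma phi_simps:
  "phi p (u + v) = phi p u + phi p v" "phi p (u - v) = phi p u - phi p v"
  "phi p (- v) = - phi p v" "phi p (k *\<^sub>R v) = k *\<^sub>R phi p v" "phi p 0 = 0"
  using linear_phi[of p] by (simp_all add: linear_add linear_diff linear_neg linear_scale linear_0)

lemma xi_nonzero [simp]: "xi p \<noteq> 0"
  by (metis eta_xi eta_simps(5) zero_neq_one)

text \<open>The formula for the square of \<open>phi\<close> shows first that
  \<open>phi p (xi p)\<close> is a multiple of \<open>xi p\<close>, and then that the square of the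
  multiplier is 0.\<close>

lemma phi_xi [simp]: "phi p (xi p) = 0"
proof -
  let ?k = "eta p (phi p (xi p))"
  have 0: "phi p (phi p (xi p)) = 0" using phi_phi[of p "xi p"] by simp
  have k: "phi p (xi p) = ?k *\<^sub>R xi p"
    using phi_phi[of p "phi p (xi p)"] by (simp add: 0 phi_simps)
  have "0 = phi p (?k *\<^sub>R xi p)" using 0 k by metis
  also have "\<dots> = ?k *\<^sub>R phi p (xi p)" by (rule phi_simps)
  also have "\<dots> = ?k *\<^sub>R (?k *\<^sub>R xi p)" using k by metis
  finally have "?k = 0" by simp
  then show ?thesis using k by simp
qed

lemma eta_phi [simp]: "eta p (phi p v) = 0"
proof -
  have "phi p (phi p (phi p v)) = phi p v - eta p (phi p v) *\<^sub>R xi p" by (rule phi_phi)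
  moreover have "phi p (phi p (phi p v)) = phi p v" by (simp add: phi_phi[of p v] phi_simps)
  ultimately show ?thesis by simp
qed

lemma metric_xi: "g p (xi p) v = eta p v" "g p v (xi p) = eta p v"
proof -
  show "g p (xi p) v = eta p v" using para_kenmotsu_unfold(3)[of p "xi p" v] by (simp add: metric_simps)
  then show "g p v (xi p) = eta p v" by (metis metric_sym)
qed

lemma metric_phi: "g p (phi p v) w = - g p v (phi p w)"
  using para_kenmotsu_unfold(3)[of p v "phi p w"] by (simp add: phi_phi metric_simps metric_xi)

text \<open>Closedness of \<open>eta\<close>, the reason why brackets of horizontal fields are
  horizontal.\<close>

lemma eta_lie_bracket:
  assumes "smooth_vfield A X" "smooth_vfield A Y"
  shows "eta p (lie_bracket A X Y p) = vderiv A X (\<lambda>q. eta q (Y q)) p - vderiv A Y (\<lambda>q. eta q (X q)) p"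
  using para_kenmotsu_unfold(4)[OF assms, of p] by (simp add: ext_deriv_1_def)

text \<open>Normality with \<open>xi\<close> in the first slot: the terms containing
  \<open>phi\<close> of \<open>xi\<close> drop, and so does the differential of \<open>eta\<close>.
  The remaining difference is killed by \<open>phi\<close>, hence is a multiple of
  \<open>xi\<close>, and \<open>eta\<close> vanishes on it.\<close>

lemma phi_lie_bracket_xi:
  assumes X: "smooth_vfield A X"
  shows "lie_bracket A xi (\<lambda>q. phi q (X q)) p = phi p (lie_bracket A xi X p)"
proof -
  let ?u = "phi p (lie_bracket A xi X p) - lie_bracket A xi (\<lambda>q. phi q (X q)) p"
  have zero: "lie_bracket A (\<lambda>q. 0) Y = (\<lambda>p. 0)" if "smooth_vfield A Y" for Y
    using lie_bracket_scaleR_left[of xi Y "\<lambda>q. 0"] that by simp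
  have "nijenhuis A phi xi X p = 0"
    using para_kenmotsu_unfold(2,4) X by (simp add: normal_structure_def)
  then have "phi p ?u = 0"
    using X by (simp add: nijenhuis_def zero phi_simps)
  then have "?u = eta p ?u *\<^sub>R xi p"
    using phi_phi[of p ?u] by (simp add: phi_simps)
  moreover have "eta p ?u = 0"
    using X by (simp add: eta_simps eta_lie_bracket)
  ultimately show ?thesis by simp
qed

definition horizontal_metric :: "'m \<Rightarrow> real^'n \<Rightarrow> real^'n \<Rightarrow> real" where
  "horizontal_metric p v w = g p v w - eta p v * eta p w"

text \<open>Contracting the equation for the fundamental form with \<open>xi\<close> gives twice
  that form as its Lie derivative along \<open>xi\<close>. As \<open>phi\<close> is invariant along
  \<open>xi\<close>, the rate 2 passes to g on horizontal vectors.\<close>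

lemma lie_deriv_metric_xi:
  assumes X: "smooth_vfield A X" and Y: "smooth_vfield A Y"
  shows "L xi X Y p = 2 * horizontal_metric p (X p) (Y p)"
proof -
  have Phi: "vderiv A xi (\<lambda>q. g q (U q) (phi q (Y q))) p
     - g p (lie_bracket A xi U p) (phi p (Y p)) - g p (U p) (phi p (lie_bracket A xi Y p))
     = 2 * g p (U p) (phi p (Y p))" if U: "smooth_vfield A U" for U
  proof -
    have "lie_bracket A Y xi p = - lie_bracket A xi Y p"
      by (rule fun_cong[OF lie_bracket_antisym]) (simp_all add: Y)
    moreover have "g p (phi p (lie_bracket A xi Y p)) (U p) = g p (U p) (phi p (lie_bracket A xi Y p))"
      by (rule metric_sym)
    moreover have "g p (lie_bracket A xi Y p) (phi p (U p)) = - g p (phi p (lie_bracket A xi Y p)) (U p)"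
      by (simp add: metric_phi)
    ultimately show ?thesis
      using para_kenmotsu_unfold(5)[OF smooth_vfield_xi U Y, of p]
      by (simp add: ext_deriv_2_def wedge_1_2_def fundamental_form_def metric_simps metric_xi)
  qed
  \<comment> \<open>With \<open>phi\<close> of X for U the form becomes -g plus the square of
    \<open>eta\<close>, and \<open>eta\<close> is invariant along \<open>xi\<close> because it is
    closed.\<close>
  have "vderiv A xi (\<lambda>q. g q (phi q (X q)) (phi q (Y q))) p
      - g p (phi p (lie_bracket A xi X p)) (phi p (Y p)) - g p (phi p (X p)) (phi p (lie_bracket A xi Y p))
     = 2 * g p (phi p (X p)) (phi p (Y p))"
    using Phi[OF smooth_vfield_phi[OF X]] X by (simp add: phi_lie_bracket_xi)
  then show ?thesis
    using X Y by (simp add: para_kenmotsu_unfold(3) vderiv_add vderiv_diff vderiv_uminus vderiv_mult eta_lie_bracket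
        lie_deriv_metric_def horizontal_metric_def algebra_simps)
qed

text \<open>The symmetric part of the derivative of \<open>xi\<close> is half the Lie derivative of
  g; the antisymmetric part is the differential of \<open>eta\<close>, which is zero.\<close>

lemma D_xi:
  assumes X: "smooth_vfield A X"
  shows "D X xi = (\<lambda>p. X p - eta p (X p) *\<^sub>R xi p)"
proof (rule field_eqI)
  fix Y p assume Y: "smooth_vfield A Y"
  have "g p (D X xi p) (Y p) + g p (X p) (D Y xi p) = 2 * horizontal_metric p (X p) (Y p)"
    using lie_deriv_metric_xi[OF X Y] lie_deriv_metric_eq_D[OF smooth_vfield_xi X Y] by simp
  moreover have "g p (D X xi p) (Y p) = g p (D Y xi p) (X p)"
    using eta_lie_bracket[OF X Y, of p] X Y
    by (simp add: metric_xi[symmetric] vderiv_metric lie_bracket_eq_D metric_simps)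
  moreover have "g p (D Y xi p) (X p) = g p (X p) (D Y xi p)" by (rule metric_sym)
  ultimately show "g p (D X xi p) (Y p) = g p (X p - eta p (X p) *\<^sub>R xi p) (Y p)"
    by (simp add: horizontal_metric_def metric_simps metric_xi)
qed

lemma vderiv_eta:
  assumes "smooth_vfield A X" "smooth_vfield A Y"
  shows "vderiv A X (\<lambda>q. eta q (Y q)) = (\<lambda>p. eta p (D X Y p) + horizontal_metric p (X p) (Y p))"
proof -
  have "vderiv A X (\<lambda>q. g q (xi q) (Y q)) = (\<lambda>p. g p (D X xi p) (Y p) + g p (xi p) (D X Y p))"
    using assms by (simp add: vderiv_metric)
  then show ?thesis
    using assms by (simp add: D_xi metric_xi metric_simps horizontal_metric_def fun_eq_iff)
qed

lemma curvature_xi: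
  assumes "smooth_vfield A X" "smooth_vfield A Y"
  shows "R X Y xi p = eta p (X p) *\<^sub>R Y p - eta p (Y p) *\<^sub>R X p"
  using assms
  by (simp add: curvature_eq D_xi D_calculus lie_bracket_eq_D vderiv_eta eta_simps horizontal_metric_def
      metric_sym algebra_simps)

end

section \<open>Dimension three\<close>

locale para_kenmotsu_3_manifold = para_kenmotsu_manifold A g phi xi eta
  for A :: "('m::{t2_space,second_countable_topology}, 'n::finite) chart set" and g phi xi eta +
  assumes dim_3: "CARD('n) = 3"
begin

text \<open>The two eigenlines of \<open>phi\<close> are null, since \<open>phi\<close> reverses the
  sign of the horizontal metric. They pair nontrivially: otherwise a would be orthogonal to
  everything.\<close>

lemma null_frame:
  obtains a b where "eta p a = 0" "eta p b = 0" "g p a a = 0" "g p b b = 0" "g p a b = 1"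
    "\<And>v. v = eta p v *\<^sub>R xi p + g p v b *\<^sub>R a + g p v a *\<^sub>R b"
proof -
  let ?E = "\<lambda>s. {v. eta p v = 0 \<and> phi p v = s *\<^sub>R v}"
  have sub: "subspace (?E s)" for s
    by (auto simp: subspace_def eta_simps phi_simps scaleR_add_right)
  obtain n where "CARD('n) = 2 * n + 1"
    "dim {v. eta p v = 0 \<and> phi p v = v} = n" "dim {v. eta p v = 0 \<and> phi p v = - v} = n"
    using para_kenmotsu_unfold(1) unfolding almost_paracontact_def by blast
  then have dims: "dim (?E 1) = 1" "dim (?E (-1)) = 1"
    using dim_3 by auto
  have "\<exists>v. v \<in> ?E s \<and> v \<noteq> 0" if "dim (?E s) = 1" for s
    using that dim_eq_0[of "?E s"] by auto
  then obtain a b' where a: "a \<in> ?E 1" "a \<noteq> 0" and b': "b' \<in> ?E (-1)" "b' \<noteq> 0"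
    using dims by blast
  have span: "\<exists>x y. v = eta p v *\<^sub>R xi p + x *\<^sub>R a + y *\<^sub>R b'" for v
  proof -
    define h where "h = v - eta p v *\<^sub>R xi p"
    have h: "phi p (phi p h) = h" "eta p h = 0" by (simp_all add: h_def phi_phi phi_simps eta_simps)
    \<comment> \<open>Projections of the horizontal part onto the eigenlines of
      \<open>phi\<close>.\<close>
    have "(1/2) *\<^sub>R (h + phi p h) \<in> ?E 1" "(1/2) *\<^sub>R (h - phi p h) \<in> ?E (-1)"
      by (simp_all add: h phi_simps eta_simps algebra_simps)
    then obtain x y where xy: "(1/2) *\<^sub>R (h + phi p h) = x *\<^sub>R a" "(1/2) *\<^sub>R (h - phi p h) = y *\<^sub>R b'"
      using subspace_dim_1_multiple[OF sub dims(1) a] subspace_dim_1_multiple[OF sub dims(2) b'] by metis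
    have "h = (1/2) *\<^sub>R (h + phi p h) + (1/2) *\<^sub>R (h - phi p h)"
      by (simp add: scaleR_add_right[symmetric] scaleR_2[symmetric])
    then have "h = x *\<^sub>R a + y *\<^sub>R b'" unfolding xy .
    then show ?thesis unfolding h_def by (intro exI[of _ x] exI[of _ y]) (simp add: algebra_simps)
  qed
  have null: "g p a a = 0" "g p b' b' = 0"
    using para_kenmotsu_unfold(3)[of p a a] para_kenmotsu_unfold(3)[of p b' b'] a b'
    by (auto simp: metric_simps)
  have ab: "g p a b' \<noteq> 0"
  proof
    assume "g p a b' = 0"
    then have "g p a v = 0" for v
      using span[of v] a null by (metis (mono_tags, lifting) add.right_neutral metric_simps(2,8) metric_xi(2)
          mem_Collect_eq mult_zero_right)
    then show False using metric_nondegenerate a(2) by blast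
  qed
  define b where "b = (1 / g p a b') *\<^sub>R b'"
  have b: "eta p b = 0" "g p b b = 0" "g p a b = 1" "g p b a = 1"
    using b' null ab metric_sym[of p b' a] by (auto simp: b_def eta_simps metric_simps)
  have "v = eta p v *\<^sub>R xi p + g p v b *\<^sub>R a + g p v a *\<^sub>R b" for v
  proof -
    obtain x y where xy: "v = eta p v *\<^sub>R xi p + x *\<^sub>R a + y *\<^sub>R b'" using span by blast
    then have "v = eta p v *\<^sub>R xi p + x *\<^sub>R a + (y * g p a b') *\<^sub>R b" (is "_ = ?r")
      using ab by (simp add: b_def)
    moreover have "g p ?r b = x" "g p ?r a = y * g p a b'"
      using a null b by (auto simp: metric_simps metric_xi)
    ultimately show ?thesis by metis
  qed
  then show ?thesis using that[of a b] a null b by auto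
qed

definition hor :: "('m, 'n) vfield \<Rightarrow> bool" where
  "hor X \<longleftrightarrow> smooth_vfield A X \<and> (\<forall>p. eta p (X p) = 0)"

lemma horD: "hor X \<Longrightarrow> smooth_vfield A X" "hor X \<Longrightarrow> eta p (X p) = 0"
  by (auto simp: hor_def)

lemma hor_horizontal_part: "smooth_vfield A X \<Longrightarrow> hor (\<lambda>q. X q - eta q (X q) *\<^sub>R xi q)"
  by (simp add: hor_def eta_simps)

text \<open>The fields are horizontal everywhere, while the null relations and the expansion are
  asserted at p, where the pointwise arguments use them.\<close>

lemma hor_null_frame:
  obtains U V where "hor U" "hor V" "g p (U p) (U p) = 0" "g p (V p) (V p) = 0" "g p (U p) (V p) = 1"
    "\<And>v. v = eta p v *\<^sub>R xi p + g p v (V p) *\<^sub>R U p + g p v (U p) *\<^sub>R V p"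
proof -
  obtain a b where ab: "eta p a = 0" "eta p b = 0" "g p a a = 0" "g p b b = 0" "g p a b = 1"
    "\<And>v. v = eta p v *\<^sub>R xi p + g p v b *\<^sub>R a + g p v a *\<^sub>R b"
    using null_frame by blast
  let ?F = "\<lambda>v q. extend_vector A p v q - eta q (extend_vector A p v q) *\<^sub>R xi q"
  have "hor (?F a)" "hor (?F b)" by (simp_all add: hor_horizontal_part extend_vector)
  moreover have "?F a p = a" "?F b p = b" using ab by (simp_all add: extend_vector)
  ultimately show ?thesis using that[of "?F a" "?F b"] ab by metis
qed

section \<open>The algebraic form of the curvature\<close>

text \<open>\<open>curvature_defect\<close> measures the deviation from constant curvature \<open>- 1\<close>. It annihilates \<open>\<xi>\<close>,
  hence lives on the two-dimensional horizontal space and is a multiple of \<open>hor_curvature\<close>.\<close>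

definition unit_curvature :: "'m \<Rightarrow> real^'n \<Rightarrow> real^'n \<Rightarrow> real^'n \<Rightarrow> real^'n" where
  "unit_curvature p x y z = g p y z *\<^sub>R x - g p x z *\<^sub>R y"

definition hor_curvature :: "'m \<Rightarrow> real^'n \<Rightarrow> real^'n \<Rightarrow> real^'n \<Rightarrow> real^'n" where
  "hor_curvature p x y z = horizontal_metric p y z *\<^sub>R (x - eta p x *\<^sub>R xi p)
     - horizontal_metric p x z *\<^sub>R (y - eta p y *\<^sub>R xi p)"

definition curvature_defect :: "'m \<Rightarrow> real^'n \<Rightarrow> real^'n \<Rightarrow> real^'n \<Rightarrow> real^'n" where
  "curvature_defect p x y z = curvature_at A g p x y z + unit_curvature p x y z"

lemma curvature_defect_eq:
  "curvature_defect p x y z = R (extend_vector A p x) (extend_vector A p y) (extend_vector A p z) p + unit_curvature p x y z"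
  by (simp add: curvature_defect_def curvature_at_def)

lemma curvature_defect_add:
  "curvature_defect p (x + x') y z = curvature_defect p x y z + curvature_defect p x' y z"
  "curvature_defect p y (x + x') z = curvature_defect p y x z + curvature_defect p y x' z"
  "curvature_defect p y z (x + x') = curvature_defect p y z x + curvature_defect p y z x'"
  by (simp_all add: curvature_defect_def unit_curvature_def curvature_at_add metric_simps algebra_simps)

lemma curvature_defect_scaleR:
  "curvature_defect p (k *\<^sub>R x) y z = k *\<^sub>R curvature_defect p x y z"
  "curvature_defect p y (k *\<^sub>R x) z = k *\<^sub>R curvature_defect p y x z"
  "curvature_defect p y z (k *\<^sub>R x) = k *\<^sub>R curvature_defect p y z x"
  by (simp_all add: curvature_defect_def unit_curvature_def curvature_at_scaleR metric_simps algebra_simps)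

lemma curvature_defect_antisym: "curvature_defect p x y z = - curvature_defect p y x z"
  using curvature_antisym[of "extend_vector A p x" "extend_vector A p y" "extend_vector A p z" p]
  by (simp add: curvature_defect_eq unit_curvature_def extend_vector)

lemma curvature_defect_metric_antisym: "g p (curvature_defect p x y z) w = - g p (curvature_defect p x y w) z"
  using curvature_metric_antisym[of "extend_vector A p x" "extend_vector A p y" "extend_vector A p z"
      "extend_vector A p w" p]
  by (simp add: curvature_defect_eq unit_curvature_def extend_vector metric_simps)

lemma curvature_defect_bianchi: "curvature_defect p x y z + curvature_defect p y z x + curvature_defect p z x y = 0"
proof -
  have "unit_curvature p x y z + unit_curvature p y z x + unit_curvature p z x y = 0"
    using metric_sym[of p x y] metric_sym[of p y z] metric_sym[of p x z] by (simp add: unit_curvature_def)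
  moreover have "curvature_at A g p x y z + curvature_at A g p y z x + curvature_at A g p z x y = 0"
    using first_bianchi[of "extend_vector A p x" "extend_vector A p y" "extend_vector A p z" p]
    by (simp add: curvature_at_def extend_vector)
  ultimately show ?thesis by (simp add: curvature_defect_def algebra_simps)
qed

lemma curvature_defect_xi_right: "curvature_defect p x y (xi p) = 0"
proof -
  have "curvature_at A g p x y (xi p) = R (extend_vector A p x) (extend_vector A p y) xi p"
    using curvature_at_eq[of "extend_vector A p x" "extend_vector A p y" xi p] by (simp add: extend_vector)
  then show ?thesis by (simp add: curvature_defect_def unit_curvature_def curvature_xi extend_vector metric_xi)
qed

text \<open>First Bianchi and the vanishing in the last slot make the defect at (xi, x, y) symmetric
  in x and y. Paired with w it is also antisymmetric in y and w, and a trilinear form with both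
  symmetries is zero.\<close>

lemma curvature_defect_xi_left: "curvature_defect p (xi p) x y = 0"
  and curvature_defect_xi_middle: "curvature_defect p x (xi p) y = 0"
proof -
  have sym: "curvature_defect p (xi p) x y = curvature_defect p (xi p) y x" for x y
    using curvature_defect_bianchi[of p "xi p" x y] curvature_defect_antisym[of p y "xi p" x] by (simp add: curvature_defect_xi_right)
  have "g p (curvature_defect p (xi p) x y) w = - g p (curvature_defect p (xi p) x y) w" for w
    by (metis curvature_defect_metric_antisym minus_equation_iff sym)
  then have "g p (curvature_defect p (xi p) x y) w = 0" for w by (metis add.inverse_neutral equal_neg_zero)
  then show "curvature_defect p (xi p) x y = 0" by (rule metric_nondegenerate)
  then show "curvature_defect p x (xi p) y = 0" by (metis curvature_defect_antisym neg_equal_0_iff_equal)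
qed

text \<open>The defect at (a, b) is skew for g, so it multiplies the null vectors a and b by
  opposite scalars. The other components vanish by antisymmetry or because \<open>xi\<close> is
  annihilated.\<close>

lemma exists_kappa: "\<exists>k. \<forall>x y z. curvature_defect p x y z = k *\<^sub>R hor_curvature p x y z"
proof -
  obtain a b where ab: "eta p a = 0" "eta p b = 0" "g p a a = 0" "g p b b = 0" "g p a b = 1"
    and frame: "\<And>v. v = eta p v *\<^sub>R xi p + g p v b *\<^sub>R a + g p v a *\<^sub>R b"
    using null_frame by blast
  have ba: "g p b a = 1" using ab metric_sym by metis
  have self: "g p (curvature_defect p x y z) z = 0" for x y z
    using curvature_defect_metric_antisym[of p x y z z] by simp
  have eta_P: "eta p (curvature_defect p x y z) = 0" for x y z
    using curvature_defect_metric_antisym[of p x y z "xi p"] by (simp add: curvature_defect_xi_right metric_xi metric_simps)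
  define k where "k = g p (curvature_defect p a b a) b"
  have Pa: "curvature_defect p a b a = k *\<^sub>R a"
    using frame[of "curvature_defect p a b a"] by (simp add: eta_P self k_def)
  have Pb: "curvature_defect p a b b = - k *\<^sub>R b"
    using frame[of "curvature_defect p a b b"] curvature_defect_metric_antisym[of p a b b a] by (simp add: eta_P self k_def)
  have Pxx: "curvature_defect p x x z = 0" for x z
  proof -
    have "curvature_defect p x x z + curvature_defect p x x z = 0" by (metis curvature_defect_antisym add.right_inverse)
    then have "2 *\<^sub>R curvature_defect p x x z = 0" by (simp only: scaleR_2)
    then show ?thesis by simp
  qed
  have "curvature_defect p x y z = k *\<^sub>R hor_curvature p x y z" for x y z
  proof -
    define x1 x2 y1 y2 z1 z2 where d: "x1 = g p x b" "x2 = g p x a" "y1 = g p y b" "y2 = g p y a"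
      "z1 = g p z b" "z2 = g p z a"
    have x: "x = eta p x *\<^sub>R xi p + x1 *\<^sub>R a + x2 *\<^sub>R b"
      and y: "y = eta p y *\<^sub>R xi p + y1 *\<^sub>R a + y2 *\<^sub>R b"
      and z: "z = eta p z *\<^sub>R xi p + z1 *\<^sub>R a + z2 *\<^sub>R b"
      using frame d by auto
    have "curvature_defect p x y z = curvature_defect p (eta p x *\<^sub>R xi p + x1 *\<^sub>R a + x2 *\<^sub>R b) (eta p y *\<^sub>R xi p + y1 *\<^sub>R a + y2 *\<^sub>R b)
        (eta p z *\<^sub>R xi p + z1 *\<^sub>R a + z2 *\<^sub>R b)"
      using x y z by metis
    also have "\<dots> = (x1 * y2 - x2 * y1) *\<^sub>R (z1 *\<^sub>R curvature_defect p a b a + z2 *\<^sub>R curvature_defect p a b b)"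
      by (simp add: curvature_defect_add curvature_defect_scaleR curvature_defect_xi_left
          curvature_defect_xi_middle curvature_defect_xi_right Pxx curvature_defect_antisym[of p b a] algebra_simps)
    also have "\<dots> = k *\<^sub>R ((x1 * y2 - x2 * y1) *\<^sub>R (z1 *\<^sub>R a - z2 *\<^sub>R b))"
      by (simp add: Pa Pb algebra_simps)
    also have "(x1 * y2 - x2 * y1) *\<^sub>R (z1 *\<^sub>R a - z2 *\<^sub>R b) = hor_curvature p x y z"
    proof -
      have "horizontal_metric p y z = y1 * z2 + y2 * z1" "horizontal_metric p x z = x1 * z2 + x2 * z1"
        by (subst x y, subst z, simp add: horizontal_metric_def metric_simps metric_xi eta_simps ab ba)+
      moreover have "x - eta p x *\<^sub>R xi p = x1 *\<^sub>R a + x2 *\<^sub>R b" "y - eta p y *\<^sub>R xi p = y1 *\<^sub>R a + y2 *\<^sub>R b"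
        using x y by (metis add.assoc add_diff_cancel_left')+
      ultimately have "hor_curvature p x y z = (y1 * z2 + y2 * z1) *\<^sub>R (x1 *\<^sub>R a + x2 *\<^sub>R b)
          - (x1 * z2 + x2 * z1) *\<^sub>R (y1 *\<^sub>R a + y2 *\<^sub>R b)"
        by (simp only: hor_curvature_def)
      then show ?thesis by (simp add: algebra_simps)
    qed
    finally show ?thesis .
  qed
  then show ?thesis by blast
qed

text \<open>One plus the sectional curvature of the horizontal plane. The choice is unique since
  \<open>hor_curvature\<close> is nonzero at every point.\<close>

definition kappa :: "'m \<Rightarrow> real" where
  "kappa p = (SOME k. \<forall>x y z. curvature_defect p x y z = k *\<^sub>R hor_curvature p x y z)"

lemma curvature_defect_eq_kappa: "curvature_defect p x y z = kappa p *\<^sub>R hor_curvature p x y z"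
  using someI_ex[OF exists_kappa[of p]] unfolding kappa_def by blast

lemma curvature_at_eq_kappa: "curvature_at A g p x y z = kappa p *\<^sub>R hor_curvature p x y z - unit_curvature p x y z"
  using curvature_defect_eq_kappa[of p x y z] by (simp add: curvature_defect_def algebra_simps)

lemma curvature_eq_kappa:
  assumes "smooth_vfield A X" "smooth_vfield A Y" "smooth_vfield A Z"
  shows "R X Y Z = (\<lambda>p. kappa p *\<^sub>R hor_curvature p (X p) (Y p) (Z p) - unit_curvature p (X p) (Y p) (Z p))"
  using curvature_at_eq[OF assms] by (simp add: curvature_at_eq_kappa fun_eq_iff)

lemma ricci_eq: "ricci A g p x y = kappa p * horizontal_metric p x y - 2 * g p x y"
proof -
  let ?h = "horizontal_metric p" and ?k = "kappa p"
  \<comment> \<open>A multiple of the identity plus rank one maps with values along x,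
    \<open>xi\<close> and the horizontal part of x, ready for the trace lemmas.\<close>
  have "curvature_at A g p z x y = (?k * ?h x y - g p x y) *\<^sub>R z + (g p z y *\<^sub>R x
      + ((- ?k * ?h x y * eta p z) *\<^sub>R xi p + (- ?k * ?h z y) *\<^sub>R (x - eta p x *\<^sub>R xi p)))" for z
    by (simp add: curvature_at_eq_kappa hor_curvature_def unit_curvature_def algebra_simps)
  moreover have lin: "linear (\<lambda>z. g p z y)" "linear (\<lambda>z. - ?k * ?h x y * eta p z)" "linear (\<lambda>z. - ?k * ?h z y)"
    by (auto intro!: linearI simp: metric_simps eta_simps horizontal_metric_def algebra_simps)
  ultimately have "ricci A g p x y = (?k * ?h x y - g p x y) * 3 + (g p x y
      + (- ?k * ?h x y * eta p (xi p) + - ?k * ?h (x - eta p x *\<^sub>R xi p) y))"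
    unfolding ricci_def
    by (simp only: trace_matrix_add trace_matrix_scaleR trace_matrix_rank_one[OF lin(1)]
        trace_matrix_rank_one[OF lin(2)] trace_matrix_rank_one[OF lin(3)] dim_3 of_nat_numeral)
  then show ?thesis
    by (simp add: horizontal_metric_def metric_simps metric_xi eta_simps algebra_simps)
qed

lemma scalar_curvature_eq: "scalar_curvature A g p = 2 * kappa p - 6"
proof -
  \<comment> \<open>The Ricci operator, whose trace is 3 (kappa - 2) - kappa.\<close>
  have "(THE q. \<forall>y. g p q y = ricci A g p x y) = (kappa p - 2) *\<^sub>R x + (- kappa p * eta p x) *\<^sub>R xi p" for x
  proof (rule the_equality)
    show "\<forall>y. g p ((kappa p - 2) *\<^sub>R x + (- kappa p * eta p x) *\<^sub>R xi p) y = ricci A g p x y"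
      by (simp add: ricci_eq horizontal_metric_def metric_simps metric_xi algebra_simps)
    then show "q = (kappa p - 2) *\<^sub>R x + (- kappa p * eta p x) *\<^sub>R xi p"
      if "\<forall>y. g p q y = ricci A g p x y" for q
      by (intro metric_eqI[of p]) (simp add: that)
  qed
  moreover have "linear (\<lambda>x. - kappa p * eta p x)"
    by (auto intro!: linearI simp: eta_simps algebra_simps)
  ultimately have "scalar_curvature A g p = (kappa p - 2) * 3 + - kappa p * eta p (xi p)"
    unfolding scalar_curvature_def metric_trace_def
    by (simp only: trace_matrix_add trace_matrix_scaleR trace_matrix_rank_one dim_3 of_nat_numeral)
  then show ?thesis by simp
qed

lemma smooth_fun_horizontal_metric [simp]:
  "smooth_vfield A X \<Longrightarrow> smooth_vfield A Y \<Longrightarrow> smooth_fun A (\<lambda>p. horizontal_metric p (X p) (Y p))"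
  by (simp add: horizontal_metric_def)

text \<open>\<open>kappa\<close> is recovered by division from the (U, V, U, V) component of the
  defect, where its coefficient h equals 1 at p.\<close>

lemma smooth_fun_kappa [simp]: "smooth_fun A kappa"
proof (rule smooth_fun_divide_local)
  fix p
  obtain U V where UV: "hor U" "hor V" "g p (U p) (U p) = 0" "g p (V p) (V p) = 0" "g p (U p) (V p) = 1"
    using hor_null_frame by metis
  have s [simp]: "smooth_vfield A U" "smooth_vfield A V" using UV horD by auto
  let ?h = "\<lambda>q. g q (hor_curvature q (U q) (V q) (U q)) (V q)"
  have h: "smooth_fun A ?h"
    by (simp add: hor_curvature_def metric_simps metric_xi)
  have "(\<lambda>q. ?h q * kappa q) = (\<lambda>q. g q (R U V U q) (V q) + g q (unit_curvature q (U q) (V q) (U q)) (V q))"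
    by (simp add: curvature_eq_kappa metric_simps fun_eq_iff)
  moreover have "smooth_fun A (\<lambda>q. g q (R U V U q) (V q) + g q (unit_curvature q (U q) (V q) (U q)) (V q))"
    by (simp add: unit_curvature_def metric_simps)
  ultimately have "smooth_fun A (\<lambda>q. ?h q * kappa q)" by simp
  moreover have "?h p \<noteq> 0"
    using UV metric_sym[of p "V p" "U p"] horD(2)[OF UV(1)] horD(2)[OF UV(2)]
    by (simp add: hor_curvature_def horizontal_metric_def metric_simps)
  ultimately show "\<exists>h. smooth_fun A h \<and> smooth_fun A (\<lambda>q. h q * kappa q) \<and> h p \<noteq> 0"
    using h by blast
qed

section \<open>The derivative of \<open>kappa\<close> along \<open>xi\<close>\<close>

lemma D_unit_curvature:
  assumes "smooth_vfield A W" "smooth_vfield A X" "smooth_vfield A Y" "smooth_vfield A Z"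
  shows "D W (\<lambda>q. unit_curvature q (X q) (Y q) (Z q)) p
    = unit_curvature p (D W X p) (Y p) (Z p) + unit_curvature p (X p) (D W Y p) (Z p) + unit_curvature p (X p) (Y p) (D W Z p)"
  using assms by (simp add: unit_curvature_def D_calculus vderiv_metric algebra_simps)

text \<open>Holds along \<open>xi\<close> because \<open>D xi xi\<close> is zero, so that
  \<open>xi\<close> and \<open>eta\<close> are parallel in this direction.\<close>

lemma D_xi_hor_curvature:
  assumes "smooth_vfield A X" "smooth_vfield A Y" "smooth_vfield A Z"
  shows "D xi (\<lambda>q. hor_curvature q (X q) (Y q) (Z q)) p
    = hor_curvature p (D xi X p) (Y p) (Z p) + hor_curvature p (X p) (D xi Y p) (Z p) + hor_curvature p (X p) (Y p) (D xi Z p)"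
  using assms by (simp add: hor_curvature_def D_calculus D_xi vderiv_metric vderiv_eta horizontal_metric_def
      vderiv_diff vderiv_mult metric_xi algebra_simps)

lemma unit_curvature_linear: "unit_curvature p (x + x') y z = unit_curvature p x y z + unit_curvature p x' y z"
  "unit_curvature p y (x + x') z = unit_curvature p y x z + unit_curvature p y x' z"
  "unit_curvature p (x - x') y z = unit_curvature p x y z - unit_curvature p x' y z"
  "unit_curvature p y (x - x') z = unit_curvature p y x z - unit_curvature p y x' z"
  "unit_curvature p (k *\<^sub>R x) y z = k *\<^sub>R unit_curvature p x y z"
  "unit_curvature p y (k *\<^sub>R x) z = k *\<^sub>R unit_curvature p y x z"
  by (simp_all add: unit_curvature_def metric_simps algebra_simps)

lemma hor_curvature_linear: "hor_curvature p (x + x') y z = hor_curvature p x y z + hor_curvature p x' y z"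
  "hor_curvature p y (x + x') z = hor_curvature p y x z + hor_curvature p y x' z"
  "hor_curvature p (x - x') y z = hor_curvature p x y z - hor_curvature p x' y z"
  "hor_curvature p y (x - x') z = hor_curvature p y x z - hor_curvature p y x' z"
  "hor_curvature p (k *\<^sub>R x) y z = k *\<^sub>R hor_curvature p x y z"
  "hor_curvature p y (k *\<^sub>R x) z = k *\<^sub>R hor_curvature p y x z"
  by (simp_all add: hor_curvature_def horizontal_metric_def metric_simps eta_simps algebra_simps)

lemma hor_curvature_xi: "hor_curvature p (xi p) y z = 0" "hor_curvature p x (xi p) z = 0"
  by (simp_all add: hor_curvature_def horizontal_metric_def metric_xi)

lemma hor_curvature_antisym: "hor_curvature p x y z = - hor_curvature p y x z" and unit_curvature_antisym: "unit_curvature p x y z = - unit_curvature p y x z"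
  by (simp_all add: hor_curvature_def unit_curvature_def)

lemma smooth_vfield_unit_curvature [simp]:
  "smooth_vfield A X \<Longrightarrow> smooth_vfield A Y \<Longrightarrow> smooth_vfield A Z \<Longrightarrow>
    smooth_vfield A (\<lambda>q. unit_curvature q (X q) (Y q) (Z q))"
  by (simp add: unit_curvature_def)

lemma smooth_vfield_hor_curvature [simp]:
  "smooth_vfield A X \<Longrightarrow> smooth_vfield A Y \<Longrightarrow> smooth_vfield A Z \<Longrightarrow>
    smooth_vfield A (\<lambda>q. hor_curvature q (X q) (Y q) (Z q))"
  by (simp add: hor_curvature_def)

text \<open>Second Bianchi in the directions \<open>xi\<close>, U, V. The constant curvature part is
  parallel and drops; differentiating \<open>xi\<close> in the slots of \<open>hor_curvature\<close>
  along U and V returns U and V, and each of these terms contributes one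
  \<open>kappa\<close>.\<close>

lemma vderiv_xi_kappa: "vderiv A xi kappa p = - 2 * kappa p"
proof -
  obtain U V where UV: "hor U" "hor V" "g p (U p) (U p) = 0" "g p (V p) (V p) = 0" "g p (U p) (V p) = 1"
    using hor_null_frame by metis
  have s [simp]: "smooth_vfield A U" "smooth_vfield A V" using UV horD by auto
  have bianchi: "(D xi (R U V U) p - R U V (D xi U) p) + (D U (R V xi U) p - R V xi (D U U) p)
      + (D V (R xi U U) p - R xi U (D V U) p)
    = R (lie_bracket A xi U) V U p + R (lie_bracket A U V) xi U p + R (lie_bracket A V xi) U U p"
    by (rule second_bianchi) simp_all
  have "(vderiv A xi kappa p + 2 * kappa p) *\<^sub>R hor_curvature p (U p) (V p) (U p) = 0"
    using bianchi unit_curvature_antisym[of p "V p" "U p" "U p"] hor_curvature_antisym[of p "V p" "U p" "U p"]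
      unit_curvature_antisym[of p "D xi V p" "U p" "U p"] unit_curvature_antisym[of p "D V U p" "xi p" "U p"]
      hor_curvature_antisym[of p "D xi V p" "U p" "U p"] horD(2)[OF UV(1)] horD(2)[OF UV(2)]
    by (simp add: curvature_eq_kappa D_calculus D_unit_curvature D_xi_hor_curvature hor_curvature_xi D_xi lie_bracket_eq_D unit_curvature_linear hor_curvature_linear
        numeral_mult_vec algebra_simps)
  moreover have "hor_curvature p (U p) (V p) (U p) \<noteq> 0"
  proof
    assume "hor_curvature p (U p) (V p) (U p) = 0"
    then have "g p (hor_curvature p (U p) (V p) (U p)) (V p) = 0" by (simp add: metric_simps)
    then show False
      using UV metric_sym[of p "V p" "U p"] horD(2)[OF UV(1)] horD(2)[OF UV(2)]
      by (simp add: hor_curvature_def horizontal_metric_def metric_simps)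
  qed
  ultimately show ?thesis by simp
qed

section \<open>Yamabe solitons\<close>

text \<open>Restricted to horizontal arguments: for horizontal W the Lie derivative of g vanishes on
  the pair (\<open>xi\<close>, \<open>xi\<close>), so the full equation would force t = 0.\<close>

definition conformal :: "('m, 'n) vfield \<Rightarrow> ('m \<Rightarrow> real) \<Rightarrow> bool" where
  "conformal W t \<longleftrightarrow> (\<forall>X Y p. hor X \<longrightarrow> hor Y \<longrightarrow> L W X Y p = t p * g p (X p) (Y p))"

text \<open>A relation instead of a function, since the gradients that occur are already given as
  brackets and only have to be recognised.\<close>

definition hor_gradient :: "('m, 'n) vfield \<Rightarrow> ('m \<Rightarrow> real) \<Rightarrow> bool" where
  "hor_gradient G u \<longleftrightarrow> hor G \<and> (\<forall>X p. hor X \<longrightarrow> g p (G p) (X p) = vderiv A X u p)"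

lemma conformalD: "conformal W t \<Longrightarrow> hor X \<Longrightarrow> hor Y \<Longrightarrow> L W X Y p = t p * g p (X p) (Y p)"
  by (simp add: conformal_def)

lemma hor_gradientD:
  "hor_gradient G u \<Longrightarrow> hor G" "hor_gradient G u \<Longrightarrow> hor X \<Longrightarrow> g p (G p) (X p) = vderiv A X u p"
  by (simp_all add: hor_gradient_def)

lemma hor_smooth [simp]: "hor X \<Longrightarrow> smooth_vfield A X"
  by (rule horD)

lemma eta_hor_fun: "hor X \<Longrightarrow> (\<lambda>q. eta q (X q)) = (\<lambda>q. 0)"
  by (simp add: horD(2))

lemma hor_lie_bracket: "hor X \<Longrightarrow> hor Y \<Longrightarrow> hor (lie_bracket A X Y)"
  by (simp add: hor_def[of "lie_bracket A X Y"] eta_lie_bracket eta_hor_fun)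

lemma hor_lie_bracket_xi: "hor X \<Longrightarrow> hor (lie_bracket A xi X)"
  by (simp add: hor_def[of "lie_bracket A xi X"] eta_lie_bracket eta_hor_fun)

lemma hor_scaleR_add: "hor X \<Longrightarrow> hor Y \<Longrightarrow> hor (\<lambda>p. k *\<^sub>R X p + l *\<^sub>R Y p)"
  by (simp add: hor_def[of "\<lambda>p. k *\<^sub>R X p + l *\<^sub>R Y p"] eta_simps horD)

lemma hor_scaleR: "hor X \<Longrightarrow> hor (\<lambda>p. k *\<^sub>R X p)"
  using hor_scaleR_add[of X X k 0] by simp

lemma conformal_scaleR_add:
  assumes "smooth_vfield A W" "smooth_vfield A W'" "conformal W t" "conformal W' t'"
  shows "conformal (\<lambda>p. k *\<^sub>R W p + l *\<^sub>R W' p) (\<lambda>p. k * t p + l * t' p)"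
  unfolding conformal_def
proof (intro allI impI)
  fix X Y p assume XY: "hor X" "hor Y"
  have "L W X Y p = t p * g p (X p) (Y p)" "L W' X Y p = t' p * g p (X p) (Y p)"
    using assms XY by (auto intro: conformalD)
  then show "L (\<lambda>p. k *\<^sub>R W p + l *\<^sub>R W' p) X Y p = (k * t p + l * t' p) * g p (X p) (Y p)"
    using assms XY D_scaleR_right[of _ _ "\<lambda>_. k"] D_scaleR_right[of _ _ "\<lambda>_. l"]
    by (simp add: lie_deriv_metric_eq_D D_add_right metric_simps)
      (simp add: algebra_simps flip: distrib_left)
qed

lemma conformal_scaleR:
  "smooth_vfield A W \<Longrightarrow> conformal W t \<Longrightarrow> conformal (\<lambda>p. k *\<^sub>R W p) (\<lambda>p. k * t p)"
  using conformal_scaleR_add[of W W t t k 0] by simp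

text \<open>On horizontal fields the commutator is L_xi (t g) - L_W (2 g); the two terms 2 t g
  cancel and the derivative of t is left. All inner brackets are horizontal, so the restricted
  hypotheses apply to them.\<close>

lemma conformal_lie_bracket_xi:
  assumes W: "hor W" and t: "smooth_fun A t" and conf: "conformal W t"
  shows "conformal (lie_bracket A xi W) (vderiv A xi t)"
  unfolding conformal_def
proof (intro allI impI)
  fix X Y p assume X: "hor X" and Y: "hor Y"
  note hb = hor_lie_bracket_xi[OF X] hor_lie_bracket_xi[OF Y] hor_lie_bracket[OF W X] hor_lie_bracket[OF W Y]
  have xi: "L xi U V = (\<lambda>p. 2 * g p (U p) (V p))" if "hor U" "hor V" for U V
    using that by (simp add: fun_eq_iff lie_deriv_metric_xi horizontal_metric_def horD)
  have LW: "L W X Y = (\<lambda>p. t p * g p (X p) (Y p))"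
    using conformalD[OF conf X Y] by auto
  have v: "vderiv A xi (\<lambda>q. g q (X q) (Y q)) p = 2 * g p (X p) (Y p)
      + g p (lie_bracket A xi X p) (Y p) + g p (X p) (lie_bracket A xi Y p)"
    "vderiv A W (\<lambda>q. g q (X q) (Y q)) p = t p * g p (X p) (Y p)
      + g p (lie_bracket A W X p) (Y p) + g p (X p) (lie_bracket A W Y p)"
    using fun_cong[OF xi[OF X Y], of p] fun_cong[OF LW, of p] by (simp_all add: lie_deriv_metric_def)
  show "L (lie_bracket A xi W) X Y p = vderiv A xi t p * g p (X p) (Y p)"
    using W X Y t hb
    by (simp add: lie_deriv_metric_commutator xi LW v conformalD[OF conf] vderiv_mult algebra_simps)
qed

lemma hor_gradient_scaleR_add:
  assumes "hor_gradient G u" "hor_gradient G' u'" "smooth_fun A u" "smooth_fun A u'"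
  shows "hor_gradient (\<lambda>p. k *\<^sub>R G p + l *\<^sub>R G' p) (\<lambda>p. k * u p + l * u' p)"
  using assms by (simp add: hor_gradient_def hor_scaleR_add metric_simps vderiv_add vderiv_mult)

text \<open>The rate 2 of the horizontal metric along \<open>xi\<close> accounts for -2 u; what
  remains is the commutator of \<open>xi\<close> and X applied to u.\<close>

lemma hor_gradient_lie_bracket_xi:
  assumes G: "hor_gradient G u" and u: "smooth_fun A u"
  shows "hor_gradient (lie_bracket A xi G) (\<lambda>p. vderiv A xi u p - 2 * u p)"
  unfolding hor_gradient_def
proof (intro conjI allI impI)
  note hG = hor_gradientD(1)[OF G]
  show "hor (lie_bracket A xi G)" by (rule hor_lie_bracket_xi[OF hG])
  fix X p assume X: "hor X"
  have "2 * g p (G p) (X p) = vderiv A xi (\<lambda>q. g q (G q) (X q)) p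
      - g p (lie_bracket A xi G p) (X p) - g p (G p) (lie_bracket A xi X p)"
    using lie_deriv_metric_xi[of G X p] hG X
    by (simp add: lie_deriv_metric_def horizontal_metric_def horD)
  then show "g p (lie_bracket A xi G p) (X p) = vderiv A X (\<lambda>p. vderiv A xi u p - 2 * u p) p"
    using X u by (simp add: hor_gradientD(2)[OF G] hor_lie_bracket_xi vderiv_lie_bracket vderiv_diff vderiv_mult)
qed

lemma hor_gradient_unique:
  assumes "hor_gradient G u" "hor_gradient G' u"
  shows "G = G'"
proof (rule field_eqI)
  fix Z p assume Z: "smooth_vfield A Z"
  have "g p (G p) (Z p - eta p (Z p) *\<^sub>R xi p) = g p (G' p) (Z p - eta p (Z p) *\<^sub>R xi p)"
    using assms hor_gradientD(2)[OF _ hor_horizontal_part[OF Z]] by simp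
  then show "g p (G p) (Z p) = g p (G' p) (Z p)"
    using assms[THEN hor_gradientD(1)] by (simp add: metric_simps metric_xi horD)
qed

text \<open>The horizontal Hessian is symmetric by absence of torsion, so it is half the Lie
  derivative of g along G; hence the factor 2. The \<open>xi\<close> component comes from
  differentiating \<open>eta\<close> of G, which is zero.\<close>

lemma D_hor_gradient:
  assumes G: "hor_gradient G u" and conf: "conformal G (\<lambda>p. 2 * t p)" and u: "smooth_fun A u" and X: "hor X"
  shows "D X G = (\<lambda>p. t p *\<^sub>R X p - vderiv A X u p *\<^sub>R xi p)"
proof (rule field_eqI)
  fix Z p assume Z: "smooth_vfield A Z"
  note hG = hor_gradientD(1)[OF G]
  define Y where "Y = (\<lambda>q. Z q - eta q (Z q) *\<^sub>R xi q)"
  have Y: "hor Y" unfolding Y_def by (rule hor_horizontal_part[OF Z])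
  have "Z p = Y p + eta p (Z p) *\<^sub>R xi p" by (simp add: Y_def)
  then have Z: "g p v (Z p) = g p v (Y p) + eta p (Z p) * eta p v" for v
    by (metis metric_simps(2,8) metric_xi(2))
  have "vderiv A X (\<lambda>q. g q (G q) (Y q)) p - vderiv A Y (\<lambda>q. g q (G q) (X q)) p
      = g p (G p) (lie_bracket A X Y p)"
    using X Y u by (simp add: hor_gradientD(2)[OF G] hor_lie_bracket vderiv_lie_bracket)
  then have "g p (D X G p) (Y p) = g p (D Y G p) (X p)"
    using X Y hG by (simp add: vderiv_metric lie_bracket_eq_D metric_simps)
  moreover have "g p (D X G p) (Y p) + g p (D Y G p) (X p) = 2 * (t p * g p (X p) (Y p))"
    using conformalD[OF conf X Y, of p] lie_deriv_metric_eq_D[of G X Y p] X Y hG metric_sym[of p "X p" "D Y G p"]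
    by simp
  ultimately have hor_part: "g p (D X G p) (Y p) = t p * g p (X p) (Y p)" by simp
  have "eta p (D X G p) = - vderiv A X u p"
    using fun_cong[OF vderiv_eta[of X G], of p] X hG hor_gradientD(2)[OF G X, of p] metric_sym[of p "X p" "G p"]
    by (simp add: eta_hor_fun horizontal_metric_def horD)
  then show "g p (D X G p) (Z p) = g p (t p *\<^sub>R X p - vderiv A X u p *\<^sub>R xi p) (Z p)"
    unfolding Z using hor_part X Y by (simp add: metric_simps metric_xi horD eta_simps)
qed

text \<open>R(X, Y) G is computed from the Hessian and from the form of the curvature. Comparison
  gives \<open>swap\<close>, and a covector with that property on a plane is zero.\<close>

lemma hor_gradient_ricci_identity:
  assumes G: "hor_gradient G u" and conf: "conformal G (\<lambda>p. 2 * t p)"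
    and u: "smooth_fun A u" and t: "smooth_fun A t" and X: "hor X"
  shows "vderiv A X t p + kappa p * vderiv A X u p = 0"
proof -
  note hG = hor_gradientD(1)[OF G]
  let ?b = "\<lambda>X. vderiv A X t p + kappa p * vderiv A X u p"
  have swap: "?b X *\<^sub>R Y p = ?b Y *\<^sub>R X p" if X: "hor X" and Y: "hor Y" for X Y
  proof -
    note DG = D_hor_gradient[OF G conf u]
    have "D (lie_bracket A X Y) G p = t p *\<^sub>R lie_bracket A X Y p
        - (vderiv A X (vderiv A Y u) p - vderiv A Y (vderiv A X u) p) *\<^sub>R xi p"
      using X Y u by (simp add: DG[OF hor_lie_bracket] vderiv_lie_bracket)
    then have "R X Y G p = vderiv A X t p *\<^sub>R Y p - vderiv A Y t p *\<^sub>R X p - vderiv A Y u p *\<^sub>R X p + vderiv A X u p *\<^sub>R Y p"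
      using X Y u t
      by (simp add: curvature_eq DG D_calculus D_xi horD)
        (simp add: fun_cong[OF lie_bracket_eq_D] algebra_simps)
    moreover have "R X Y G p = (kappa p - 1) *\<^sub>R (vderiv A Y u p *\<^sub>R X p - vderiv A X u p *\<^sub>R Y p)"
      using X Y hG hor_gradientD(2)[OF G X, of p] hor_gradientD(2)[OF G Y, of p]
        metric_sym[of p "G p" "X p"] metric_sym[of p "G p" "Y p"]
      by (simp add: curvature_eq_kappa hor_curvature_def unit_curvature_def horizontal_metric_def horD algebra_simps)
    ultimately show ?thesis by (simp add: algebra_simps)
  qed
  obtain U V where UV: "hor U" "hor V" "g p (U p) (U p) = 0" "g p (V p) (V p) = 0" "g p (U p) (V p) = 1"
    using hor_null_frame by metis
  have VU: "g p (V p) (U p) = 1" using UV(5) metric_sym by metis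
  have U: "?b X * g p (U p) w = ?b U * g p (X p) w" and V: "?b X * g p (V p) w = ?b V * g p (X p) w" for w
    using arg_cong[OF swap[OF X UV(1)], of "\<lambda>v. g p v w"] arg_cong[OF swap[OF X UV(2)], of "\<lambda>v. g p v w"]
    by (simp_all only: metric_simps)
  have "?b X = ?b U * g p (X p) (V p)" "0 = ?b V * g p (X p) (V p)"
    using U[of "V p"] V[of "V p"] by (simp_all only: UV VU mult_1_right mult_zero_right)
  moreover have "?b X = ?b V * g p (X p) (U p)"
    using V[of "U p"] by (simp only: VU mult_1_right)
  \<comment> \<open>If x is nonzero then so is m, hence v = 0 and x = 0 after all.\<close>
  moreover have "x = 0" if "x = u * m" "0 = v * m" "x = v * n" for x u v m n :: real
    using that by auto
  ultimately show ?thesis by blast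
qed

lemma yamabe_soliton_kappa_zero:
  assumes V: "smooth_vfield A V"
    and yamabe: "\<And>X Y p. smooth_vfield A X \<Longrightarrow> smooth_vfield A Y \<Longrightarrow>
      L V X Y p = (lam - scalar_curvature A g p) * g p (X p) (Y p)"
  shows "kappa p = 0"
proof -
  \<comment> \<open>By \<open>scalar_curvature_eq\<close> the soliton factor is c - 2 kappa.\<close>
  define c where "c = lam + 6"
  define a where "a = (\<lambda>p. eta p (V p))"
  define W where "W = (\<lambda>p. V p - a p *\<^sub>R xi p)"
  have a [simp]: "smooth_fun A a" unfolding a_def using V by simp
  have W: "hor W" unfolding W_def a_def by (rule hor_horizontal_part[OF V])
  have LV: "g p (D X V p) (Y p) + g p (X p) (D Y V p) = (c - 2 * kappa p) * g p (X p) (Y p)"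
    if "smooth_vfield A X" "smooth_vfield A Y" for X Y p
    using yamabe[OF that, of p] lie_deriv_metric_eq_D[OF V that, of p]
    by (simp add: scalar_curvature_eq c_def)
  have Da: "vderiv A X a = (\<lambda>p. eta p (D X V p) + horizontal_metric p (X p) (V p))" if "smooth_vfield A X" for X
    unfolding a_def using vderiv_eta[OF that V] .
  \<comment> \<open>The soliton equation enters through three kinds of pairs: (\<open>xi\<close>,
    \<open>xi\<close>) here, horizontal pairs in \<open>conf_W\<close>, mixed pairs in
    \<open>grad_a\<close>.\<close>
  have xi_a: "vderiv A xi a p = (c - 2 * kappa p) / 2" for p
    using LV[of xi xi p] by (simp add: Da metric_xi horizontal_metric_def)
  have xi_kappa: "vderiv A xi kappa = (\<lambda>p. - 2 * kappa p)"
    by (simp add: vderiv_xi_kappa fun_eq_iff)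
  \<comment> \<open>The summand a \<open>xi\<close> of V contributes 2 a g on horizontal pairs,
    which is subtracted.\<close>
  have conf_W: "conformal W (\<lambda>p. c - 2 * kappa p - 2 * a p)"
    unfolding conformal_def
  proof (intro allI impI)
    fix X Y p assume X: "hor X" and Y: "hor Y"
    show "L W X Y p = (c - 2 * kappa p - 2 * a p) * g p (X p) (Y p)"
      using X Y V LV[of X Y p] metric_sym[of p "Y p" "X p"]
      by (simp add: lie_deriv_metric_eq_D W_def D_calculus D_xi metric_simps metric_xi horD algebra_simps)
  qed
  have grad_a: "hor_gradient (\<lambda>p. -1 *\<^sub>R lie_bracket A xi W p) a"
    unfolding hor_gradient_def
  proof (intro conjI allI impI)
    show "hor (\<lambda>p. -1 *\<^sub>R lie_bracket A xi W p)" by (rule hor_scaleR[OF hor_lie_bracket_xi[OF W]])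
    fix X p assume X: "hor X"
    show "g p (-1 *\<^sub>R lie_bracket A xi W p) (X p) = vderiv A X a p"
      using LV[of xi X p] X V metric_sym[of p "X p" "V p"] metric_sym[of p "D xi V p" "X p"]
      by (simp add: W_def lie_bracket_eq_D D_calculus D_xi Da metric_simps metric_xi horizontal_metric_def
          horD eta_simps algebra_simps)
  qed
  define G where "G = (\<lambda>p. -1 *\<^sub>R lie_bracket A xi W p)"
  have grad_G: "hor_gradient G a" unfolding G_def by (rule grad_a)
  then have G: "hor G" by (rule hor_gradientD)
  have "conformal G (\<lambda>p. -1 * vderiv A xi (\<lambda>p. c - 2 * kappa p - 2 * a p) p)"
    unfolding G_def
    by (rule conformal_scaleR[OF hor_smooth[OF hor_lie_bracket_xi[OF W]] conformal_lie_bracket_xi[OF W _ conf_W]]) simp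
  moreover have "vderiv A xi (\<lambda>p. c - 2 * kappa p - 2 * a p) = (\<lambda>p. 6 * kappa p - c)"
    by (simp add: vderiv_diff vderiv_mult xi_kappa xi_a) (simp add: fun_eq_iff field_simps)
  ultimately have conf_G: "conformal G (\<lambda>p. c - 6 * kappa p)" by simp
  define G2 where "G2 = lie_bracket A xi G"
  have G2: "hor G2" unfolding G2_def by (rule hor_lie_bracket_xi[OF G])
  have "hor_gradient G2 (\<lambda>p. vderiv A xi a p - 2 * a p)"
    unfolding G2_def by (rule hor_gradient_lie_bracket_xi[OF grad_G a])
  then have grad_G2: "hor_gradient G2 (\<lambda>p. c / 2 - kappa p - 2 * a p)"
    by (simp add: xi_a field_simps)
  have "conformal G2 (vderiv A xi (\<lambda>p. c - 6 * kappa p))"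
    unfolding G2_def by (rule conformal_lie_bracket_xi[OF G _ conf_G]) simp
  then have conf_G2: "conformal G2 (\<lambda>p. 12 * kappa p)"
    by (simp add: vderiv_diff vderiv_mult xi_kappa)
  \<comment> \<open>The coefficients eliminate a from the potential c / 2 - kappa - 2 a of G2; in
    the conformal factors the terms 12 kappa cancel at the same time.\<close>
  define K where "K = (\<lambda>p. -1 *\<^sub>R G2 p + -2 *\<^sub>R G p)"
  have "hor_gradient K (\<lambda>p. -1 * (c / 2 - kappa p - 2 * a p) + -2 * a p)"
    unfolding K_def by (rule hor_gradient_scaleR_add[OF grad_G2 grad_G]) simp_all
  then have grad_K': "hor_gradient K (\<lambda>p. kappa p - c / 2)" by simp
  have grad_K: "hor_gradient K kappa"
    using grad_K' by (simp add: hor_gradient_def vderiv_diff)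
  then have K: "hor K" by (rule hor_gradientD)
  have "conformal K (\<lambda>p. -1 * (12 * kappa p) + -2 * (c - 6 * kappa p))"
    unfolding K_def by (rule conformal_scaleR_add) (simp_all add: G G2 conf_G conf_G2)
  then have conf_K: "conformal K (\<lambda>p. - 2 * c)"
    by (simp add: algebra_simps)
  \<comment> \<open>As a gradient the bracket of \<open>xi\<close> and K is -4 K, with conformal
    factor 8 c; as a bracket it has the derivative of the constant -2 c as factor.\<close>
  have "c = 0"
  proof -
    have "hor_gradient (lie_bracket A xi K) (\<lambda>p. -4 * kappa p)"
      using hor_gradient_lie_bracket_xi[OF grad_K smooth_fun_kappa] by (simp add: xi_kappa)
    moreover have "hor_gradient (\<lambda>p. -4 *\<^sub>R K p + 0 *\<^sub>R K p) (\<lambda>p. -4 * kappa p + 0 * kappa p)"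
      by (rule hor_gradient_scaleR_add[OF grad_K grad_K]) simp_all
    ultimately have eq: "lie_bracket A xi K = (\<lambda>p. -4 *\<^sub>R K p)"
      using hor_gradient_unique by simp
    have "conformal (lie_bracket A xi K) (\<lambda>p. 0)"
      using conformal_lie_bracket_xi[OF K _ conf_K] by simp
    moreover have "conformal (\<lambda>p. -4 *\<^sub>R K p) (\<lambda>p. -4 * (- 2 * c))"
      by (rule conformal_scaleR[OF hor_smooth[OF K] conf_K])
    moreover obtain X Y where "hor X" "hor Y" "g p (X p) (Y p) = 1"
      using hor_null_frame by metis
    ultimately have "0 = -4 * (- 2 * c)"
      unfolding eq by (metis conformalD mult_cancel_right zero_neq_one)
    then show ?thesis by simp
  qed
  have kappa_flat: "kappa p * vderiv A X kappa p = 0" if "hor X" for X p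
    using hor_gradient_ricci_identity[OF grad_K, of "\<lambda>p. 0" X p] conf_K that \<open>c = 0\<close> by simp
  have conf_G': "conformal G (\<lambda>p. 2 * (- 3 * kappa p))"
    using conf_G \<open>c = 0\<close> by simp
  have kappa_a: "kappa p * vderiv A X a p = 3 * vderiv A X kappa p" if "hor X" for X p
    using hor_gradient_ricci_identity[OF grad_G conf_G', of X p] that by (simp add: vderiv_mult vderiv_uminus)
  have flat: "kappa p * kappa p * vderiv A X a p = 0" if "hor X" for X p
    using kappa_a[OF that, of p] kappa_flat[OF that, of p] by auto
  obtain X Y where X: "hor X" and Y: "hor Y" and XY: "g p (X p) (Y p) = 1"
    using hor_null_frame by metis
  have "(\<lambda>q. kappa q * kappa q * vderiv A Y a q) = (\<lambda>q. 0)"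
    by (rule ext) (rule flat[OF Y])
  then have "vderiv A X (\<lambda>q. kappa q * kappa q * vderiv A Y a q) p = 0"
    by (simp only: vderiv_const)
  \<comment> \<open>The terms in which \<open>kappa\<close> itself is differentiated vanish by
    \<open>kappa_flat\<close>.\<close>
  then have "kappa p * kappa p * vderiv A X (vderiv A Y a) p = 0"
    using X Y kappa_flat[OF X, of p] by (auto simp: vderiv_mult algebra_simps)
  moreover have "vderiv A X (vderiv A Y a) p = g p (D X G p) (Y p) + g p (G p) (D X Y p)"
  proof -
    have "vderiv A Y a = (\<lambda>q. g q (G q) (Y q))"
      using hor_gradientD(2)[OF grad_G Y] by auto
    then show ?thesis using X Y G by (simp add: vderiv_metric)
  qed
  moreover have "g p (D X G p) (Y p) = - 3 * kappa p"
    using D_hor_gradient[OF grad_G conf_G' a X] Y XY by (simp add: metric_simps metric_xi horD)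
  moreover have "kappa p * kappa p * g p (G p) (D X Y p) = 0"
  proof -
    \<comment> \<open>G is horizontal, so only the horizontal part of \<open>D X Y\<close> counts,
      and \<open>flat\<close> applies to it.\<close>
    define Z where "Z = (\<lambda>q. D X Y q - eta q (D X Y q) *\<^sub>R xi q)"
    have Z: "hor Z" unfolding Z_def using X Y by (simp add: hor_horizontal_part)
    have "g p (G p) (D X Y p) = g p (G p) (Z p)"
      using G by (simp add: Z_def metric_simps metric_xi horD)
    then show ?thesis using hor_gradientD(2)[OF grad_G Z] flat[OF Z] by simp
  qed
  ultimately show ?thesis by auto
qed

lemma ricci_soliton_if_yamabe_soliton:
  assumes "yamabe_soliton A g"
  shows "ricci_soliton A g"
proof -
  obtain V lam where "smooth_vfield A V"
    "\<And>X Y p. smooth_vfield A X \<Longrightarrow> smooth_vfield A Y \<Longrightarrow>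
      L V X Y p = (lam - scalar_curvature A g p) * g p (X p) (Y p)"
    using assms unfolding yamabe_soliton_def by blast
  then have "kappa p = 0" for p by (rule yamabe_soliton_kappa_zero)
  then have "ricci A g p v w = - 2 * g p v w" for p v w by (simp add: ricci_eq)
  moreover have "L (\<lambda>p. 0) X Y p = 0" if "smooth_vfield A X" "smooth_vfield A Y" for X Y p
    using that D_scaleR_right[of _ xi "\<lambda>p. 0"] by (simp add: lie_deriv_metric_eq_D metric_simps)
  \<comment> \<open>The constant is mu = 2: with the zero field the equation reads 2 S + 4 g =
    0.\<close>
  ultimately have "smooth_vfield A (\<lambda>p. 0) \<and> (\<forall>X Y p. smooth_vfield A X \<longrightarrow> smooth_vfield A Y \<longrightarrow>
      L (\<lambda>p. 0) X Y p + 2 * ricci A g p (X p) (Y p) + 2 * 2 * g p (X p) (Y p) = 0)"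
    by simp
  then show ?thesis unfolding ricci_soliton_def by blast
qed

end

theorem theorem5:
  fixes A :: "('m::{t2_space,second_countable_topology}, 'n::finite) chart set"
    and phi :: "'m \<Rightarrow> real^'n \<Rightarrow> real^'n"
    and xi :: "'m \<Rightarrow> real^'n"
    and eta :: "'m \<Rightarrow> real^'n \<Rightarrow> real"
    and g :: "'m \<Rightarrow> real^'n \<Rightarrow> real^'n \<Rightarrow> real"
  assumes "CARD('n) = 3"
    and "para_kenmotsu A phi xi eta g"
    and "yamabe_soliton A g"
  shows "ricci_soliton A g"
proof -
  have "smooth_atlas A" "semi_riemannian_metric A g"
    using assms(2) by (simp_all add: para_kenmotsu_def almost_paracontact_metric_def
        almost_paracontact_def connected_smooth_manifold_def)
  then interpret para_kenmotsu_3_manifold A g phi xi eta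
    using assms(1,2) by unfold_locales
  show ?thesis using assms(3) by (rule ricci_soliton_if_yamabe_soliton)
qed

end
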